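(* Let $k$ be a field, let $n\ge 4$, and let $\mathcal A=\{d_1,\ldots,d_n\}\subset\mathbb Z^+$ be a set of $n$ positive integers with $\gcd(\mathcal A)=1$ such that $\mathcal A\setminus\{d_n\}=\{d_1,\ldots,d_{n-1}\}$ is a generalized arithmetic sequence, and such that $d_n,d_2,\ldots,d_{n-1}$ is not an arithmetic sequence. Then $I_{\mathcal A^\star}$ is a complete intersection if and only if $n=4$, $\{d_1,d_2,d_3\}$ is an arithmetic sequence (i.e. $d_1,d_2,d_3$ is an increasing arithmetic sequence), and one of the following holds: 1. $d_1/\gcd\{d_1,d_2\}$ is even and $\gcd\{d_1,d_2\}\,d_4=\beta_1d_1+\beta_2d_2+\beta_3d_3$ for some $\beta_1,\beta_2,\beta_3\in\mathbb N$ with $\beta_1+\beta_2+\beta_3\le\gcd\{d_1,d_2\}$; or 2. $d_1$ and $d_4$ are even and $\mathcal C^\star_{red}=\emptyset$, where $\mathcal C=\{d_1,d_3,d_4\}$.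
   Context: $\mathbb N$ denotes the nonnegative integers and $\mathbb Z^+$ the positive integers. For $\mathcal A=\{d_1,\ldots,d_n\}\subset\mathbb Z^+$ put $D:=\max(\mathcal A)$ and $\mathcal A^\star:=\{a_1,\ldots,a_{n+1}\}\subset\mathbb N^2$ with $a_i:=(d_i,D-d_i)$ for $1\le i\le n$ and $a_{n+1}:=(0,D)$; $\mathcal C^\star$ is formed in the same way from $\mathcal C$. The toric ideal $I_{\mathcal A^\star}$ is the kernel of the $k$-algebra homomorphism $k[x_1,\ldots,x_{n+1}]\to k[t,u]$, $x_i\mapsto t^{d_i}u^{D-d_i}$ $(1\le i\le n)$, $x_{n+1}\mapsto u^{D}$. It has height $n-1$; it is a complete intersection if its minimal number of generators equals $n-1$. $\{d_1,\ldots,d_m\}$ is a generalized arithmetic sequence if there exists $h\in\mathbb Z^+$ such that $hd_1,d_2,\ldots,d_m$ is an increasing arithmetic sequence. Definition of $\mathcal B_{red}$ for a finite family $\mathcal B=\{b_1,\ldots,b_s\}$ of nonzero vectors in $\mathbb N^m$: starting from $\mathcal B$, apply iteratively the following operations as long as one of them changes the family: (i) if $b_i\notin\sum_{j\ne i}\mathbb Q b_j$, remove $b_i$; (ii) if $b_i\in\sum_{j\neq i}\mathbb N b_j$, remove $b_i$; (iii) if $b_i\in\sum_{j\ne i}\mathbb Q b_j$, replace $b_i$ by $B_ib_i$, where $B_i=\min\{B\in\mathbb Z^+ : Bb_i\in\sum_{j\ne i}\mathbb Z b_j\}$. The final result, which is uniquely determined by $\mathcal B$, is $\mathcal B_{red}$;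 it is either empty or a family $\{b_1',\ldots,b_r'\}$ with $b_i'\in\sum_{j\neq i}\mathbb Z b_j'\setminus\sum_{j\ne i}\mathbb N b_j'$ for all $i$. $\mathcal C^\star_{red}$ means $(\mathcal C^\star)_{red}$. *)

theory Defs
  imports
    "HOL-Library.Multiset"
    "HOL-Library.Poly_Mapping"
    "HOL-Algebra.Ideal"
    "HOL-Analysis.Cartesian_Space"
begin

section \<open>Arithmetic sequences\<close>

definition arith_seq :: "nat list \<Rightarrow> bool" where
  "arith_seq xs \<longleftrightarrow>
     (\<exists>r::int. \<forall>i. Suc i < length xs \<longrightarrow> int (xs ! Suc i) = int (xs ! i) + r)"

definition increasing_arith_seq :: "nat list \<Rightarrow> bool" where
  "increasing_arith_seq xs \<longleftrightarrow> arith_seq xs \<and> sorted_wrt (<) xs"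

definition generalized_arith_seq :: "nat list \<Rightarrow> bool" where
  "generalized_arith_seq xs \<longleftrightarrow> (\<exists>h>0. increasing_arith_seq (h * hd xs # tl xs))"


section \<open>The family of plane vectors attached to a set of positive integers\<close>

text \<open>For \<open>ds = [d\<^sub>1, \<dots>, d\<^sub>n]\<close> this is \<open>[a\<^sub>1, \<dots>, a\<^sub>n, a\<^sub>n\<^sub>+\<^sub>1]\<close>; the truncated subtraction is
  exact because \<open>D\<close> is the maximum.\<close>

definition star :: "nat list \<Rightarrow> (nat ^ 2) list" where
  "star ds = (let D = Max (set ds) in map (\<lambda>d. vector [d, D - d]) ds @ [vector [0, D]])"


section \<open>Toric ideals\<close>

text \<open>\<open>mpoly_ring N\<close> is the polynomial ring over \<open>'k\<close> in \<open>N\<close> variables, numbered \<open>0, \<dots>, N - 1\<close>: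
  the polynomials in countably many variables in which only these occur.\<close>

definition mpoly_ring :: "nat \<Rightarrow> ((nat \<Rightarrow>\<^sub>0 nat) \<Rightarrow>\<^sub>0 'k::field) ring" where
  "mpoly_ring N =
     \<lparr>carrier = {p. \<forall>m \<in> Poly_Mapping.keys p. Poly_Mapping.keys m \<subseteq> {..<N}},
      mult = (*), one = 1, zero = 0, add = (+)\<rparr>"

text \<open>The \<open>'k\<close>-algebra homomorphism sending the \<open>i\<close>-th variable to the monomial with exponent
  vector \<open>bs ! i\<close>. Its target \<open>(nat ^ 'm) \<Rightarrow>\<^sub>0 'k\<close> is the polynomial ring over \<open>'k\<close> in the variables
  indexed by \<open>'m\<close>, a monomial being represented by its exponent vector; thus for \<open>'m = 2\<close> it is
  \<open>k[t, u]\<close>, and \<open>single (vector [d, D - d]) 1\<close> is \<open>t\<^sup>d u\<^sup>D\<^sup>-\<^sup>d\<close>.\<close>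

definition toric_map ::
  "(nat ^ 'm) list \<Rightarrow> ((nat \<Rightarrow>\<^sub>0 nat) \<Rightarrow>\<^sub>0 'k::field) \<Rightarrow> ((nat ^ 'm) \<Rightarrow>\<^sub>0 'k)" where
  "toric_map bs p =
     (\<Sum>m \<in> Poly_Mapping.keys p. Poly_Mapping.single 0 (Poly_Mapping.lookup p m) *
        (\<Prod>i \<in> Poly_Mapping.keys m. Poly_Mapping.single (bs ! i) 1 ^ Poly_Mapping.lookup m i))"

definition toric_ideal :: "(nat ^ 'm) list \<Rightarrow> ((nat \<Rightarrow>\<^sub>0 nat) \<Rightarrow>\<^sub>0 'k::field) set" where
  "toric_ideal bs = {p \<in> carrier (mpoly_ring (length bs)). toric_map bs p = 0}"

definition min_num_generators :: "('a, 'b) ring_scheme \<Rightarrow> 'a set \<Rightarrow> nat" where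
  "min_num_generators R I =
     (LEAST r. \<exists>S. S \<subseteq> carrier R \<and> finite S \<and> card S = r \<and> genideal R S = I)"

text \<open>For an ideal of height \<open>n - 1\<close> of the polynomial ring in \<open>n + 1\<close> variables, as is the toric
  ideal of \<open>star ds\<close> when \<open>length ds = n\<close>.\<close>

definition complete_intersection :: "nat \<Rightarrow> ((nat \<Rightarrow>\<^sub>0 nat) \<Rightarrow>\<^sub>0 'k::field) set \<Rightarrow> bool" where
  "complete_intersection n I \<longleftrightarrow> min_num_generators (mpoly_ring (n + 1)) I = n - 1"


section \<open>Reduction of a family of vectors\<close>

definition in_nat_span :: "(nat ^ 'm) set \<Rightarrow> nat ^ 'm \<Rightarrow> bool" where
  "in_nat_span V b \<longleftrightarrow> (\<exists>c :: nat ^ 'm \<Rightarrow> nat. \<forall>j. b $ j = (\<Sum>v\<in>V. c v * v $ j))"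

definition in_int_span :: "(nat ^ 'm) set \<Rightarrow> nat ^ 'm \<Rightarrow> bool" where
  "in_int_span V b \<longleftrightarrow>
     (\<exists>c :: nat ^ 'm \<Rightarrow> int. \<forall>j. of_nat (b $ j) = (\<Sum>v\<in>V. c v * of_nat (v $ j)))"

definition in_rat_span :: "(nat ^ 'm) set \<Rightarrow> nat ^ 'm \<Rightarrow> bool" where
  "in_rat_span V b \<longleftrightarrow>
     (\<exists>c :: nat ^ 'm \<Rightarrow> rat. \<forall>j. of_nat (b $ j) = (\<Sum>v\<in>V. c v * of_nat (v $ j)))"

definition red_multiplier :: "(nat ^ 'm) set \<Rightarrow> nat ^ 'm \<Rightarrow> nat" where
  "red_multiplier V b = (LEAST B. B > 0 \<and> in_int_span V (B *s b))"

text \<open>Families are multisets, since operation (iii) may create repeated vectors. In each rule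
  \<open>b\<close> is the vector operated on and \<open>R\<close> is the rest of the family. Operation (iii) is a step only
  if it changes the family.\<close>

inductive red_step :: "(nat ^ 'm) multiset \<Rightarrow> (nat ^ 'm) multiset \<Rightarrow> bool" where
  op_i: "\<not> in_rat_span (set_mset R) b \<Longrightarrow> red_step (add_mset b R) R"
| op_ii: "in_nat_span (set_mset R) b \<Longrightarrow> red_step (add_mset b R) R"
| op_iii: "in_rat_span (set_mset R) b \<Longrightarrow> B = red_multiplier (set_mset R) b \<Longrightarrow> B *s b \<noteq> b \<Longrightarrow>
    red_step (add_mset b R) (add_mset (B *s b) R)"

definition red :: "(nat ^ 'm) multiset \<Rightarrow> (nat ^ 'm) multiset" where
  "red M = (THE M'. red_step\<^sup>*\<^sup>* M M' \<and> (\<nexists>M''. red_step M' M''))"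

end

theory Submission
  imports Defs
    "HOL-Library.Function_Algebras"
    "HOL-Library.Confluence"
begin

text \<open>Two monomials have the same image under the toric map iff they have the same weight, so the
  ideal is spanned by binomials and its generation can be studied through moves that connect all
  monomials of a common weight. For an irredundant set of moves, the coefficient sums over the
  connected components are functionals which show that no generating set of the ideal is smaller.

  As the points lie on a line, a binomial of the ideal contains at most one pure power of an inner
  (that is, non-extremal) variable, whereas every inner variable needs one. Hence in a complete
  intersection there is exactly one move \<open>x\<^sub>i ^ m\<^sub>i \<leftrightarrow> x ^ \<beta>\<^sub>i\<close> for each inner variable, and the
  relation ``\<open>x\<^sub>j\<close> divides \<open>x ^ \<beta>\<^sub>i\<close>'' is acyclic. If \<open>n \<ge> 5\<close> or \<open>h \<ge> 2\<close>, such moves cannot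
  connect all monomials of the weight of \<open>x\<^sub>1 ^ h x\<^sub>3\<close> or of \<open>x\<^sub>1 x\<^sub>4\<close> or of \<open>x\<^sub>2 x\<^sub>5\<close>. If \<open>n = 4\<close> and \<open>h = 1\<close>, then
  \<open>x\<^sub>2 ^ 2 \<leftrightarrow> x\<^sub>1 x\<^sub>3\<close> is one of the three moves, and linear forms in the exponents that all moves
  preserve modulo a suitable number yield the divisibility conditions in the two cases, according to
  whether \<open>x\<^sub>2\<close> occurs in another \<open>x ^ \<beta>\<^sub>i\<close>. Conversely, in both cases the three moves are found
  by adding one variable at a time.

  The reduction has unique normal forms because it becomes strongly confluent when a vector may be
  scaled by any divisor of its multiplier.\<close>

text \<open>The minimum defining the number of generators ranges over all finite generating sets,
  and the field is arbitrary. The lower bound is a graded Nakayama argument: the component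
  functionals vanish on the product of the irrelevant ideal with the toric ideal, and on an
  irredundant set of binomials they form an identity matrix. The number \<open>n - 1\<close> counts
  the inner variables: \<open>n + 1\<close> points, two of them extremal.

  By \<open>h d_1 + d_3 = 2 d_2\<close> the monomials \<open>x_1 ^ h x_3\<close> and
  \<open>x_2 ^ 2 x_0 ^ (h - 1)\<close> have the same weight, where \<open>x_0\<close> belongs to the
  point 0. The obstacle for \<open>h \<ge> 2\<close> is that \<open>d_n\<close> may lie anywhere, so
  its generator might supply the connection.

  The explicit generators and the reduction are governed by the same number, the order of a point
  modulo the group spanned by other points: it is the exponent of the pure power when a variable is
  added, and the multiplier in operation (iii). \<open>gluable\<close> is the condition common to
  both; a four-point family reduces to the empty one iff it holds in one of the two orders of the
  inner points.\<close>

abbreviation "lookup \<equiv> Poly_Mapping.lookup"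
abbreviation "keys \<equiv> Poly_Mapping.keys"
abbreviation "single \<equiv> Poly_Mapping.single"

type_synonym mon = "nat \<Rightarrow>\<^sub>0 nat"

section \<open>Toric ideals and their binomials\<close>

lemma keys_add_nat: "keys (u + v) = keys u \<union> keys (v :: 'a \<Rightarrow>\<^sub>0 nat)"
  by (auto simp: in_keys_iff lookup_add)

text \<open>The exponent vector of the image of the monomial \<open>m\<close> under the toric
  map.\<close>

definition wt :: "(nat ^ 'm) list \<Rightarrow> mon \<Rightarrow> nat ^ 'm" where
  "wt bs m = (\<Sum>i\<in>keys m. lookup m i *s bs ! i)"

lemma wt_superset:
  assumes "finite A" "keys m \<subseteq> A"
  shows "wt bs m = (\<Sum>i\<in>A. lookup m i *s bs ! i)"
  unfolding wt_def
  by (rule sum.mono_neutral_left) (use assms in \<open>auto simp: in_keys_iff\<close>)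

lemma wt_add: "wt bs (u + v) = wt bs u + wt bs v"
proof -
  let ?A = "keys u \<union> keys v"
  have "wt bs (u + v) = (\<Sum>i\<in>?A. lookup (u + v) i *s bs ! i)"
    by (rule wt_superset) (auto simp: keys_add_nat)
  also have "\<dots> = (\<Sum>i\<in>?A. lookup u i *s bs ! i) + (\<Sum>i\<in>?A. lookup v i *s bs ! i)"
    by (simp add: lookup_add vec_eq_iff algebra_simps sum.distrib)
  also have "(\<Sum>i\<in>?A. lookup u i *s bs ! i) = wt bs u"
    by (rule wt_superset[symmetric]) auto
  also have "(\<Sum>i\<in>?A. lookup v i *s bs ! i) = wt bs v"
    by (rule wt_superset[symmetric]) auto
  finally show ?thesis .
qed

lemma single_one_power:
  "single (b :: nat ^ 'm) (1 :: 'k::field) ^ k = single (k *s b) 1"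
proof (induction k)
  case (Suc k)
  have "b + k *s b = Suc k *s b"
    by (simp add: vec_eq_iff)
  with Suc show ?case by (simp add: mult_single)
qed (simp flip: single_one)

lemma prod_single_one:
  "finite A \<Longrightarrow> (\<Prod>i\<in>A. single (f i :: 'b::comm_monoid_add) (1 :: 'k::field)) = single (\<Sum>i\<in>A. f i) 1"
  by (induction A rule: finite_induct) (simp_all add: mult_single)

lemma toric_map_eq:
  "toric_map bs p = (\<Sum>m\<in>keys p. single (wt bs m) (lookup p m))"
  unfolding toric_map_def
  by (simp add: single_one_power prod_single_one mult_single wt_def)

lemma toric_map_eq_0_iff:
  "toric_map bs p = 0 \<longleftrightarrow> (\<forall>b. (\<Sum>m | m \<in> keys p \<and> wt bs m = b. lookup p m) = 0)"
proof -
  have "lookup (toric_map bs p) b = (\<Sum>m | m \<in> keys p \<and> wt bs m = b. lookup p m)" for b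
    unfolding toric_map_eq lookup_sum lookup_single
    by (simp add: when_def sum.If_cases Int_def)
  thus ?thesis by (simp add: poly_mapping_eq_iff fun_eq_iff)
qed

lemma mpoly_ring_simps [simp]:
  "\<zero>\<^bsub>mpoly_ring N\<^esub> = 0" "\<one>\<^bsub>mpoly_ring N\<^esub> = 1"
  "x \<oplus>\<^bsub>mpoly_ring N\<^esub> y = x + y" "x \<otimes>\<^bsub>mpoly_ring N\<^esub> y = x * y"
  by (simp_all add: mpoly_ring_def)

lemma mem_carrier_mpoly_ring:
  "p \<in> carrier (mpoly_ring N) \<longleftrightarrow> (\<forall>m\<in>keys p. keys m \<subseteq> {..<N})"
  by (simp add: mpoly_ring_def)

lemma mpoly_ring_add:
  "p \<in> carrier (mpoly_ring N) \<Longrightarrow> q \<in> carrier (mpoly_ring N) \<Longrightarrow> p + q \<in> carrier (mpoly_ring N)"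
  unfolding mem_carrier_mpoly_ring using Poly_Mapping.keys_add[of p q] by blast

lemma mpoly_ring_uminus:
  "p \<in> carrier (mpoly_ring N) \<Longrightarrow> - p \<in> carrier (mpoly_ring N)"
  unfolding mem_carrier_mpoly_ring by (auto simp: in_keys_iff)

lemma mpoly_ring_mult:
  assumes "p \<in> carrier (mpoly_ring N)" "q \<in> carrier (mpoly_ring N)"
  shows "p * q \<in> carrier (mpoly_ring N)"
  unfolding mem_carrier_mpoly_ring
proof
  fix m assume "m \<in> keys (p * q)"
  then obtain a b where "a \<in> keys p" "b \<in> keys q" "m = a + b"
    using keys_mult[of p q] by blast
  with assms show "keys m \<subseteq> {..<N}"
    by (auto simp: mem_carrier_mpoly_ring keys_add_nat)
qed

lemma ring_mpoly_ring: "ring (mpoly_ring N)"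
proof (rule ringI)
  show "abelian_group (mpoly_ring N)"
  proof (rule abelian_groupI)
    fix x assume x: "x \<in> carrier (mpoly_ring N)"
    show "\<exists>y\<in>carrier (mpoly_ring N). y \<oplus>\<^bsub>mpoly_ring N\<^esub> x = \<zero>\<^bsub>mpoly_ring N\<^esub>"
      by (rule bexI[of _ "- x"]) (use mpoly_ring_uminus[OF x] in auto)
  qed (simp_all add: mpoly_ring_add add_ac, simp add: mem_carrier_mpoly_ring)
next
  show "Group.monoid (mpoly_ring N)"
    by unfold_locales (simp_all add: mpoly_ring_mult mult_ac, simp add: mem_carrier_mpoly_ring)
qed (auto simp: algebra_simps)

lemma ideal_mpoly_ringI:
  assumes "I \<subseteq> carrier (mpoly_ring N)" "0 \<in> I"
    and plus: "\<And>f g. f \<in> I \<Longrightarrow> g \<in> I \<Longrightarrow> f + g \<in> I"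
    and mult: "\<And>f g. f \<in> I \<Longrightarrow> g \<in> carrier (mpoly_ring N) \<Longrightarrow> g * f \<in> I"
  shows "ideal I (mpoly_ring N)"
proof -
  interpret ring "mpoly_ring N" by (rule ring_mpoly_ring)
  have neg: "- f \<in> I" if "f \<in> I" for f
    using mult[OF that, of "- 1"] mpoly_ring_uminus[of 1 N] by (simp add: mem_carrier_mpoly_ring)
  show ?thesis
  proof (rule idealI[OF ring_mpoly_ring])
    show "subgroup I (add_monoid (mpoly_ring N))"
    proof (rule add.subgroupI)
      fix a assume "a \<in> I"
      hence "\<ominus>\<^bsub>mpoly_ring N\<^esub> a = - a"
        using assms(1) by (intro minus_equality mpoly_ring_uminus) auto
      thus "\<ominus>\<^bsub>mpoly_ring N\<^esub> a \<in> I" using neg \<open>a \<in> I\<close> by simp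
    qed (use assms(1,2) plus in auto)
  qed (use mult in \<open>auto simp: mult.commute[of _ "_ :: mon \<Rightarrow>\<^sub>0 'a"]\<close>)
qed

lemma ideal_mpoly_ring_closed:
  assumes "ideal I (mpoly_ring N)"
  shows "I \<subseteq> carrier (mpoly_ring N)" "0 \<in> I"
    and "f \<in> I \<Longrightarrow> g \<in> I \<Longrightarrow> f + g \<in> I"
    and "f \<in> I \<Longrightarrow> g \<in> carrier (mpoly_ring N) \<Longrightarrow> g * f \<in> I"
    and "f \<in> I \<Longrightarrow> - f \<in> I"
    and "finite A \<Longrightarrow> (\<And>x. x \<in> A \<Longrightarrow> F x \<in> I) \<Longrightarrow> sum F A \<in> I"
proof -
  interpret ideal I "mpoly_ring N" by fact
  show c: "I \<subseteq> carrier (mpoly_ring N)" by (rule a_subset)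
  show z: "0 \<in> I" using additive_subgroup.zero_closed[OF is_additive_subgroup] by simp
  show a: "f \<in> I \<Longrightarrow> g \<in> I \<Longrightarrow> f + g \<in> I" for f g 
    using additive_subgroup.a_closed[OF is_additive_subgroup, of f g] by simp
  show m: "f \<in> I \<Longrightarrow> g \<in> carrier (mpoly_ring N) \<Longrightarrow> g * f \<in> I" for f g
    using I_l_closed[of f g] by simp
  show "f \<in> I \<Longrightarrow> - f \<in> I"
    using m[of f "- 1"] mpoly_ring_uminus[of 1 N] by (simp add: mem_carrier_mpoly_ring)
  show "finite A \<Longrightarrow> (\<And>x. x \<in> A \<Longrightarrow> F x \<in> I) \<Longrightarrow> sum F A \<in> I"
    by (induction A rule: finite_induct) (auto simp: z a)
qed

section \<open>Coefficient sums over sets of monomials\<close>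

definition coeff_sum :: "'a set \<Rightarrow> ('a \<Rightarrow>\<^sub>0 'k::field) \<Rightarrow> 'k" where
  "coeff_sum C f = (\<Sum>u | u \<in> keys f \<and> u \<in> C. lookup f u)"

lemma coeff_sum_superset:
  assumes "finite A" "keys f \<subseteq> A"
  shows "coeff_sum C f = (\<Sum>u\<in>A. if u \<in> C then lookup f u else 0)"
proof -
  have "coeff_sum C f = (\<Sum>u\<in>keys f. if u \<in> C then lookup f u else 0)"
    unfolding coeff_sum_def by (simp add: sum.If_cases Int_def)
  also have "\<dots> = (\<Sum>u\<in>A. if u \<in> C then lookup f u else 0)"
    by (rule sum.mono_neutral_left) (use assms in \<open>auto simp: in_keys_iff\<close>)
  finally show ?thesis .
qed

lemma coeff_sum_add:
  fixes f g :: "'a \<Rightarrow>\<^sub>0 'k::field"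
  shows "coeff_sum C (f + g) = coeff_sum C f + coeff_sum C g"
proof -
  let ?A = "keys f \<union> keys g"
  have "coeff_sum C h = (\<Sum>u\<in>?A. if u \<in> C then lookup h u else 0)" if "keys h \<subseteq> ?A" for h :: "'a \<Rightarrow>\<^sub>0 'k"
    by (rule coeff_sum_superset) (use that in auto)
  from this[of f] this[of g] this[of "f + g"] show ?thesis
    by (simp add: Poly_Mapping.keys_add flip: sum.distrib) (intro sum.cong, auto simp: lookup_add)
qed

lemma coeff_sum_zero [simp]: "coeff_sum C 0 = 0"
  by (simp add: coeff_sum_def)

lemma coeff_sum_sum: "finite A \<Longrightarrow> coeff_sum C (sum F A) = (\<Sum>x\<in>A. coeff_sum C (F x))"
  by (induction A rule: finite_induct) (simp_all add: coeff_sum_add)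

lemma coeff_sum_single: "coeff_sum C (single u c) = (if u \<in> C then c else 0)"
  by (subst coeff_sum_superset[of "{u}"]) (auto split: if_splits)

lemma poly_mapping_eq_sum_singles: "f = (\<Sum>m\<in>keys f. single m (lookup f m))"
  by (rule poly_mapping_eqI)
     (auto simp: lookup_sum lookup_single when_def in_keys_iff sum.delta if_distrib cong: if_cong)

lemma coeff_sum_single_mult:
  fixes f :: "'a::cancel_comm_monoid_add \<Rightarrow>\<^sub>0 'k::field"
  shows "coeff_sum C (single w c * f) = c * coeff_sum {u. w + u \<in> C} f"
proof -
  have "single w c * f = (\<Sum>m\<in>keys f. single (w + m) (c * lookup f m))"
    by (subst poly_mapping_eq_sum_singles[of f]) (simp add: sum_distrib_left mult_single)
  hence "coeff_sum C (single w c * f) = (\<Sum>m\<in>keys f. if w + m \<in> C then c * lookup f m else 0)"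
    by (simp add: coeff_sum_sum coeff_sum_single)
  also have "\<dots> = c * (\<Sum>m\<in>keys f. if w + m \<in> C then lookup f m else 0)"
    by (simp add: sum_distrib_left if_distrib cong: if_cong)
  also have "(\<Sum>m\<in>keys f. if w + m \<in> C then lookup f m else 0) = coeff_sum {u. w + u \<in> C} f"
    by (subst coeff_sum_superset[of "keys f"]) auto
  finally show ?thesis .
qed

lemma mem_toric_ideal:
  "f \<in> toric_ideal bs \<longleftrightarrow>
     f \<in> carrier (mpoly_ring (length bs)) \<and> (\<forall>b. coeff_sum {u. wt bs u = b} f = 0)"
  by (simp add: toric_ideal_def toric_map_eq_0_iff coeff_sum_def)

lemma ideal_toric_ideal:
  "ideal (toric_ideal bs :: (mon \<Rightarrow>\<^sub>0 'k::field) set) (mpoly_ring (length bs))"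
proof (rule ideal_mpoly_ringI)
  fix f g :: "mon \<Rightarrow>\<^sub>0 'k"
  assume f: "f \<in> toric_ideal bs" and g: "g \<in> carrier (mpoly_ring (length bs))"
  \<comment> \<open>Division by \<open>m\<close> turns the fibre of weight \<open>b\<close> into
    another fibre or into the empty set.\<close>
  have "coeff_sum {u. wt bs u = b} (single m c * f) = 0" for m c b
  proof (cases "\<exists>b'. b = wt bs m + b'")
    case True
    then obtain b' where "b = wt bs m + b'" by blast
    hence "{u. m + u \<in> {u. wt bs u = b}} = {u. wt bs u = b'}" by (auto simp: wt_add)
    thus ?thesis using f by (simp add: coeff_sum_single_mult mem_toric_ideal)
  next
    case False
    hence "{u. m + u \<in> {u. wt bs u = b}} = {}" by (auto simp: wt_add)
    thus ?thesis by (simp add: coeff_sum_single_mult) (simp add: coeff_sum_def)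
  qed
  hence "coeff_sum {u. wt bs u = b} (g * f) = 0" for b
    by (subst poly_mapping_eq_sum_singles[of g]) (simp add: sum_distrib_right coeff_sum_sum)
  thus "g * f \<in> toric_ideal bs"
    using f g by (auto simp: mem_toric_ideal mpoly_ring_mult)
qed (simp_all add: mem_toric_ideal coeff_sum_add mpoly_ring_add subset_iff, simp add: mem_carrier_mpoly_ring)

section \<open>Moves between monomials, and generation as connectivity\<close>

definition tor :: "(nat ^ 'm) list \<Rightarrow> mon \<Rightarrow> mon \<Rightarrow> bool" where
  "tor bs u v \<longleftrightarrow> keys u \<subseteq> {..<length bs} \<and> keys v \<subseteq> {..<length bs} \<and> wt bs u = wt bs v"

definition mstep :: "(mon \<times> mon) set \<Rightarrow> mon \<Rightarrow> mon \<Rightarrow> bool" where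
  "mstep P u v \<longleftrightarrow> (\<exists>p q w. ((p, q) \<in> P \<or> (q, p) \<in> P) \<and> u = p + w \<and> v = q + w)"

abbreviation conn :: "(mon \<times> mon) set \<Rightarrow> mon \<Rightarrow> mon \<Rightarrow> bool" where
  "conn P \<equiv> (mstep P)\<^sup>*\<^sup>*"

text \<open>Such sets are known as Markov bases: connectivity of the fibres replaces membership in
  an ideal.\<close>

definition generates :: "(nat ^ 'm) list \<Rightarrow> (mon \<times> mon) set \<Rightarrow> bool" where
  "generates bs P \<longleftrightarrow> (\<forall>(p, q)\<in>P. tor bs p q) \<and> (\<forall>u v. tor bs u v \<longrightarrow> conn P u v)"

definition irredundant :: "(nat ^ 'm) list \<Rightarrow> (mon \<times> mon) set \<Rightarrow> bool" where
  "irredundant bs P \<longleftrightarrow> generates bs P \<and> (\<forall>x\<in>P. \<not> generates bs (P - {x}))"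

lemma tor_sym: "tor bs u v \<Longrightarrow> tor bs v u"
  by (auto simp: tor_def)

lemma tor_trans: "tor bs u v \<Longrightarrow> tor bs v w \<Longrightarrow> tor bs u w"
  by (auto simp: tor_def)

lemma mstep_sym: "mstep P u v \<Longrightarrow> mstep P v u"
  unfolding mstep_def by blast

lemma conn_sym: "conn P u v \<Longrightarrow> conn P v u"
  by (induction rule: rtranclp_induct) (auto intro: converse_rtranclp_into_rtranclp mstep_sym)

lemma mstep_add: "mstep P u v \<Longrightarrow> mstep P (u + w) (v + w)"
  unfolding mstep_def by (metis add.assoc)

lemma conn_add: "conn P u v \<Longrightarrow> conn P (u + w) (v + w)"
  by (induction rule: rtranclp_induct) (auto intro: rtranclp.rtrancl_into_rtrancl mstep_add)

lemma conn_pair: "(p, q) \<in> P \<Longrightarrow> conn P p q"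
  unfolding mstep_def by (rule r_into_rtranclp) (metis add_0_right mstep_def)

lemma mstep_mono: "P \<subseteq> Q \<Longrightarrow> mstep P u v \<Longrightarrow> mstep Q u v"
  unfolding mstep_def by blast

lemma conn_mono: "P \<subseteq> Q \<Longrightarrow> conn P u v \<Longrightarrow> conn Q u v"
  by (metis mono_rtranclp mstep_mono)

lemma conn_subst:
  assumes "conn Q u v" "\<And>p q. (p, q) \<in> Q \<Longrightarrow> conn P p q"
  shows "conn P u v"
  using assms(1)
proof (induction rule: rtranclp_induct)
  case (step y z)
  from step(2) obtain p q w where "(p, q) \<in> Q \<or> (q, p) \<in> Q" "y = p + w" "z = q + w"
    unfolding mstep_def by blast
  moreover have "conn P p q"
    using calculation(1) assms(2) conn_sym by blast
  ultimately have "conn P y z" by (simp add: conn_add)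
  with step(3) show ?case by simp
qed simp

lemma mstep_tor:
  assumes P: "\<forall>(p, q)\<in>P. tor bs p q" and st: "mstep P u v" and u: "keys u \<subseteq> {..<length bs}"
  shows "tor bs u v"
proof -
  from st obtain p q w where *: "(p, q) \<in> P \<or> (q, p) \<in> P" "u = p + w" "v = q + w"
    unfolding mstep_def by blast
  hence "tor bs p q" using P tor_sym by blast
  with * u show ?thesis by (auto simp: tor_def keys_add_nat wt_add)
qed

lemma conn_tor:
  assumes P: "\<forall>(p, q)\<in>P. tor bs p q" and "conn P u v" and u: "keys u \<subseteq> {..<length bs}"
  shows "tor bs u v"
  using assms(2)
proof (induction rule: rtranclp_induct)
  case base show ?case using u by (simp add: tor_def)
next
  case (step y z)
  hence "keys y \<subseteq> {..<length bs}" by (simp add: tor_def)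
  with step mstep_tor[OF P step(2)] tor_trans show ?case by blast
qed

lemma irredundant_subset_exists:
  assumes "finite P" "generates bs P"
  shows "\<exists>Q\<subseteq>P. irredundant bs Q"
  using assms
proof (induction P rule: finite_psubset_induct)
  case (psubset P)
  show ?case
  proof (cases "irredundant bs P")
    case False
    then obtain x where "x \<in> P" "generates bs (P - {x})"
      using psubset.prems unfolding irredundant_def by blast
    with psubset.IH[of "P - {x}"] show ?thesis by blast
  qed blast
qed

definition binomial_of :: "mon \<times> mon \<Rightarrow> (mon \<Rightarrow>\<^sub>0 'k::field)" where
  "binomial_of x = single (fst x) 1 - single (snd x) 1"

lemma coeff_sum_binomial:
  "coeff_sum C (binomial_of x :: mon \<Rightarrow>\<^sub>0 'k::field) = of_bool (fst x \<in> C) - of_bool (snd x \<in> C)"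
proof -
  have "(binomial_of x :: mon \<Rightarrow>\<^sub>0 'k) = single (fst x) 1 + single (snd x) (- 1)"
    by (simp add: binomial_of_def single_uminus)
  thus ?thesis by (auto simp: coeff_sum_add coeff_sum_single)
qed

lemma binomial_of_carrier:
  assumes "keys u \<subseteq> {..<N}" "keys v \<subseteq> {..<N}"
  shows "binomial_of (u, v) \<in> carrier (mpoly_ring N)"
  unfolding mem_carrier_mpoly_ring
proof
  fix m assume "m \<in> keys (binomial_of (u, v) :: mon \<Rightarrow>\<^sub>0 'a)"
  hence "m = u \<or> m = v" by (auto simp: in_keys_iff binomial_of_def lookup_minus lookup_single when_def split: if_splits)
  thus "keys m \<subseteq> {..<N}" using assms by blast
qed

lemma binomial_of_toric: "tor bs u v \<Longrightarrow> binomial_of (u, v) \<in> toric_ideal bs"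
  by (auto simp: mem_toric_ideal coeff_sum_binomial tor_def binomial_of_carrier)

text \<open>A walk telescopes: up to sign, each step contributes a monomial multiple of a binomial
  of \<open>P\<close>. A polynomial of the ideal is a combination of such walks because moving each
  of its monomials to a representative of the same weight leaves zero.\<close>

lemma toric_ideal_generated:
  assumes gen: "generates bs P"
  shows "genideal (mpoly_ring (length bs)) (binomial_of ` P) = (toric_ideal bs :: (mon \<Rightarrow>\<^sub>0 'k::field) set)"
proof -
  let ?R = "mpoly_ring (length bs) :: (mon \<Rightarrow>\<^sub>0 'k) ring"
  let ?S = "binomial_of ` P :: (mon \<Rightarrow>\<^sub>0 'k) set"
  interpret ring ?R by (rule ring_mpoly_ring)
  have S: "?S \<subseteq> toric_ideal bs"
    using gen binomial_of_toric unfolding generates_def by fastforce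
  hence Sc: "?S \<subseteq> carrier ?R" by (auto simp: toric_ideal_def)
  let ?J = "genideal ?R ?S"
  have J: "ideal ?J ?R" by (rule genideal_ideal[OF Sc])
  note closed = ideal_mpoly_ring_closed[OF J]
  have P: "\<forall>(p, q)\<in>P. tor bs p q" using gen by (simp add: generates_def)
  have bin: "binomial_of (u, v) \<in> ?J" if "conn P u v" "keys u \<subseteq> {..<length bs}" for u v
    using that(1)
  proof (induction rule: rtranclp_induct)
    case base show ?case using closed(2) by (simp add: binomial_of_def)
  next
    case (step y z)
    have "tor bs u y" using conn_tor[OF P step(1) that(2)] .
    from step(2) obtain p q w where *: "(p, q) \<in> P \<or> (q, p) \<in> P" "y = p + w" "z = q + w"
      unfolding mstep_def by blast
    have "binomial_of (p, q) \<in> ?J"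
    proof (cases "(p, q) \<in> P")
      case True
      thus ?thesis using genideal_self[OF Sc] by blast
    next
      case False
      hence "binomial_of (q, p) \<in> ?J" using * genideal_self[OF Sc] by blast
      from closed(5)[OF this] show ?thesis by (simp add: binomial_of_def)
    qed
    moreover have "single w 1 \<in> carrier ?R"
      using * \<open>tor bs u y\<close> by (auto simp: tor_def mem_carrier_mpoly_ring keys_add_nat)
    ultimately have "single w 1 * binomial_of (p, q) \<in> ?J" by (rule closed(4))
    also have "single w 1 * binomial_of (p, q) = (binomial_of (y, z) :: mon \<Rightarrow>\<^sub>0 'k)"
      by (simp add: binomial_of_def * algebra_simps mult_single)
    finally have "binomial_of (u, y) + binomial_of (y, z) \<in> ?J"
      using step(3) closed(3) by blast
    thus ?case by (simp add: binomial_of_def)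
  qed
  show ?thesis
  proof
    show "?J \<subseteq> toric_ideal bs" by (rule genideal_minimal[OF ideal_toric_ideal S])
    show "toric_ideal bs \<subseteq> ?J"
    proof
      fix f :: "mon \<Rightarrow>\<^sub>0 'k" assume f: "f \<in> toric_ideal bs"
      \<comment> \<open>The choice depends on \<open>m\<close> only through its weight, so all
        monomials of \<open>f\<close> in one fibre share a representative.\<close>
      define r where "r m = (SOME u. u \<in> keys f \<and> wt bs u = wt bs m)" for m
      have r: "r m \<in> keys f \<and> wt bs (r m) = wt bs m" if "m \<in> keys f" for m
        unfolding r_def by (rule someI[of _ m]) (use that in auto)
      have r': "r m = r m'" if "wt bs m = wt bs m'" for m m'
        using that by (simp add: r_def)
      have kf: "keys m \<subseteq> {..<length bs}" if "m \<in> keys f" for m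
        using f that by (auto simp: mem_toric_ideal mem_carrier_mpoly_ring)
      have "(\<Sum>m\<in>keys f. single (r m) (lookup f m)) = 0"
      proof (rule poly_mapping_eqI)
        fix u
        have "lookup (\<Sum>m\<in>keys f. single (r m) (lookup f m)) u = (\<Sum>m | m \<in> keys f \<and> r m = u. lookup f m)"
          by (simp add: lookup_sum lookup_single when_def sum.If_cases Int_def)
        also have "\<dots> = 0"
        proof (cases "\<exists>m0\<in>keys f. r m0 = u")
          case True
          then obtain m0 where m0: "m0 \<in> keys f" "r m0 = u" by blast
          have "{m. m \<in> keys f \<and> r m = u} = {m. m \<in> keys f \<and> m \<in> {m. wt bs m = wt bs m0}}"
          proof (intro Collect_cong conj_cong refl)
            fix m assume "m \<in> keys f"
            show "r m = u \<longleftrightarrow> m \<in> {m. wt bs m = wt bs m0}"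
              using m0 r[OF m0(1)] r[OF \<open>m \<in> keys f\<close>] r'[of m m0] by auto
          qed
          thus ?thesis using f by (simp add: mem_toric_ideal coeff_sum_def)
        next
          case False
          hence "{m. m \<in> keys f \<and> r m = u} = {}" by auto
          thus ?thesis by (simp only: sum.empty)
        qed
        finally show "lookup (\<Sum>m\<in>keys f. single (r m) (lookup f m)) u = lookup 0 u" by simp
      qed
      hence "f = (\<Sum>m\<in>keys f. single m (lookup f m)) - (\<Sum>m\<in>keys f. single (r m) (lookup f m))"
        by (simp flip: poly_mapping_eq_sum_singles)
      also have "\<dots> = (\<Sum>m\<in>keys f. single 0 (lookup f m) * binomial_of (m, r m))"
        by (simp add: binomial_of_def right_diff_distrib mult_single sum_subtractf)
      also have "\<dots> \<in> ?J"
      proof (rule closed(6))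
        fix m assume m: "m \<in> keys f"
        have "tor bs m (r m)" using m r[OF m] kf by (auto simp: tor_def)
        hence "binomial_of (m, r m) \<in> ?J"
          using gen kf[OF m] unfolding generates_def by (intro bin) auto
        thus "single 0 (lookup f m) * binomial_of (m, r m) \<in> ?J"
          by (rule closed(4)) (auto simp: mem_carrier_mpoly_ring)
      qed simp
      finally show "f \<in> ?J" .
    qed
  qed
qed

text \<open>A walk in the fibre of \<open>u\<close> cannot use the pair, whose weight is larger by
  that of \<open>w\<close>. The latter is nonzero because points are nonzero with nonnegative
  coordinates, so nothing cancels.\<close>

lemma conn_remove_pair:
  assumes nz: "\<And>i. i < length bs \<Longrightarrow> bs ! i \<noteq> 0"
    and P: "\<forall>(p, q)\<in>P. tor bs p q"
    and q0: "(p0, q0) \<in> P" and c: "conn P u v" and u: "keys u \<subseteq> {..<length bs}"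
    and w: "wt bs u + wt bs w = wt bs p0" "w \<noteq> 0" "keys w \<subseteq> {..<length bs}"
  shows "conn (P - {(p0, q0)}) u v"
proof -
  have wtnz: "wt bs w \<noteq> 0"
  proof
    assume "wt bs w = 0"
    obtain i where i: "i \<in> keys w" using w(2) by (metis all_not_in_conv keys_eq_empty)
    hence "bs ! i \<noteq> 0" using nz w(3) by auto
    then obtain j where j: "(bs ! i) $ j \<noteq> 0" by (metis vec_eq_iff zero_index)
    have "(\<Sum>i\<in>keys w. lookup w i * (bs ! i) $ j) = 0"
      using \<open>wt bs w = 0\<close> by (simp add: wt_def vec_eq_iff)
    hence "lookup w i * (bs ! i) $ j = 0" using i by (simp add: sum_eq_0_iff)
    thus False using i j by (simp add: in_keys_iff)
  qed
  show ?thesis using c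
  proof (induction rule: rtranclp_induct)
    case (step y z)
    have t: "tor bs u y" using conn_tor[OF P step(1) u] .
    from step(2) obtain p q w' where *: "(p, q) \<in> P \<or> (q, p) \<in> P" "y = p + w'" "z = q + w'"
      unfolding mstep_def by blast
    have "wt bs p = wt bs p0" if "(p, q) = (p0, q0) \<or> (q, p) = (p0, q0)"
      using that P q0 by (auto simp: tor_def)
    moreover have "wt bs p \<noteq> wt bs p0"
    proof
      assume "wt bs p = wt bs p0"
      hence "wt bs p0 + wt bs w' + wt bs w = wt bs p0"
        using t * w(1) by (simp add: tor_def wt_add)
      hence "wt bs w = 0" by (simp add: add.assoc) (simp add: vec_eq_iff)
      with wtnz show False ..
    qed
    ultimately have "(p, q) \<in> P - {(p0, q0)} \<or> (q, p) \<in> P - {(p0, q0)}" using * by blast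
    hence "mstep (P - {(p0, q0)}) y z" using * unfolding mstep_def by blast
    with step(3) show ?case by simp
  qed simp
qed

text \<open>Graded Nakayama: on the toric ideal, multiplication by a polynomial acts on
  \<open>\<Phi>\<close> through the constant coefficient alone, so the images of \<open>S\<close>
  span the image of the whole ideal, in which the binomials of \<open>P\<close> are
  independent.\<close>

lemma irredundant_card_le:
  fixes S :: "(mon \<Rightarrow>\<^sub>0 'k::field) set"
  assumes nz: "\<And>i. i < length bs \<Longrightarrow> bs ! i \<noteq> 0"
    and irr: "irredundant bs P"
    and S: "finite S" "S \<subseteq> carrier (mpoly_ring (length bs))"
      "genideal (mpoly_ring (length bs)) S = toric_ideal bs"
  shows "card P \<le> card S"
proof -
  let ?R = "mpoly_ring (length bs) :: (mon \<Rightarrow>\<^sub>0 'k) ring"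
  interpret ring ?R by (rule ring_mpoly_ring)
  interpret V: vector_space "\<lambda>(c::'k) (f :: mon \<times> mon \<Rightarrow> 'k) x. c * f x"
    by unfold_locales (auto simp: fun_eq_iff algebra_simps)
  have P: "\<forall>(p, q)\<in>P. tor bs p q" and conn: "\<And>u v. tor bs u v \<Longrightarrow> conn P u v"
    using irr unfolding irredundant_def generates_def by blast+
  \<comment> \<open>The component of \<open>fst x\<close> once \<open>x\<close> is dropped.
    Irredundance keeps \<open>snd x\<close> out of it, whereas any other pair of \<open>P\<close>
    lies inside or outside as a whole.\<close>
  define cls where "cls x = {u. conn (P - {x}) (fst x) u}" for x
  have cls_iff: "(fst y \<in> cls x) = (snd y \<in> cls x)" if "y \<in> P" "y \<noteq> x" for x y
  proof -
    have "conn (P - {x}) (fst y) (snd y)" by (rule conn_pair) (use that in auto)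
    from this conn_sym[OF this] show ?thesis
      unfolding cls_def by (auto intro: rtranclp_trans)
  qed
  have fst_cls: "fst x \<in> cls x" for x by (simp add: cls_def)
  have snd_cls: "snd x \<notin> cls x" if x: "x \<in> P" for x
  proof
    assume "snd x \<in> cls x"
    hence "conn (P - {x}) p q" if "(p, q) \<in> P" for p q
      using that conn_pair[of p q "P - {x}"] by (cases "(p, q) = x") (auto simp: cls_def)
    hence "conn (P - {x}) u v" if "conn P u v" for u v
      using conn_subst[OF that] by blast
    hence "generates bs (P - {x})" using P conn unfolding generates_def by blast
    thus False using irr x unfolding irredundant_def by blast
  qed
  define \<Phi> where "\<Phi> f = (\<lambda>x. if x \<in> P then coeff_sum (cls x) f else 0)" for f :: "mon \<Rightarrow>\<^sub>0 'k"
  have \<Phi>_add: "\<Phi> (f + g) = \<Phi> f + \<Phi> g" for f g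
    by (auto simp: \<Phi>_def fun_eq_iff coeff_sum_add)
  text \<open>The functionals kill the product of the irrelevant ideal with the toric ideal: a fibre of
    strictly smaller weight than the pair \<open>x\<close> is already connected by the other pairs.\<close>
  have kill: "coeff_sum (cls x) (single w c * f) = 0"
    if f: "f \<in> toric_ideal bs" and x: "x \<in> P" and w: "w \<noteq> 0" "keys w \<subseteq> {..<length bs}" for f x w c
  proof -
    obtain p0 q0 where pq: "x = (p0, q0)" by (cases x)
    have t0: "tor bs p0 q0" using P x pq by auto
    have cls_wt: "wt bs u = wt bs p0" if "u \<in> cls x" for u
    proof -
      have "conn P p0 u" using that conn_mono[of "P - {x}" P] by (auto simp: cls_def pq)
      from conn_tor[OF P this] show ?thesis using t0 by (simp add: tor_def)
    qed
    have kf: "keys m \<subseteq> {..<length bs}" if "m \<in> keys f" for m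
      using f that by (auto simp: mem_toric_ideal mem_carrier_mpoly_ring)
    have "coeff_sum {u. w + u \<in> cls x} f = 0"
    proof (cases "\<exists>u0\<in>keys f. w + u0 \<in> cls x")
      case True
      then obtain u0 where u0: "u0 \<in> keys f" "w + u0 \<in> cls x" by blast
      have "u \<in> {u. w + u \<in> cls x} \<longleftrightarrow> wt bs u = wt bs u0" if u: "u \<in> keys f" for u
      proof
        assume "u \<in> {u. w + u \<in> cls x}"
        hence "wt bs (w + u) = wt bs (w + u0)" using cls_wt u0 by auto
        thus "wt bs u = wt bs u0" by (simp add: wt_add)
      next
        assume "wt bs u = wt bs u0"
        hence "conn P u0 u" using kf[OF u] kf[OF u0(1)] by (intro conn) (auto simp: tor_def)
        hence "conn (P - {(p0, q0)}) u0 u"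
          using x pq kf[OF u0(1)] w cls_wt[OF u0(2)]
          by (intro conn_remove_pair[OF nz P, where w = w]) (auto simp: wt_add add.commute)
        from conn_add[OF this, of w] have "conn (P - {x}) (w + u0) (w + u)"
          by (simp add: pq add.commute)
        thus "u \<in> {u. w + u \<in> cls x}" using u0(2) by (auto simp: cls_def)
      qed
      hence "{u. u \<in> keys f \<and> u \<in> {u. w + u \<in> cls x}} = {u. u \<in> keys f \<and> u \<in> {u. wt bs u = wt bs u0}}"
        by blast
      thus ?thesis using f by (simp only: mem_toric_ideal coeff_sum_def)
    next
      case False
      hence "{u. u \<in> keys f \<and> u \<in> {u. w + u \<in> cls x}} = {}" by blast
      thus ?thesis by (simp only: coeff_sum_def sum.empty)
    qed
    thus ?thesis by (simp add: coeff_sum_single_mult)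
  qed
  have \<Phi>_mult: "\<Phi> (g * f) = (\<lambda>x. lookup g 0 * \<Phi> f x)"
    if f: "f \<in> toric_ideal bs" and g: "g \<in> carrier ?R" for f g
  proof
    fix x
    show "\<Phi> (g * f) x = lookup g 0 * \<Phi> f x"
    proof (cases "x \<in> P")
      case True
      have "coeff_sum (cls x) (g * f) = (\<Sum>m\<in>keys g. coeff_sum (cls x) (single m (lookup g m) * f))"
        by (subst (1) poly_mapping_eq_sum_singles[of g]) (simp add: sum_distrib_right coeff_sum_sum)
      also have "\<dots> = (\<Sum>m\<in>keys g. if m = 0 then coeff_sum (cls x) (single 0 (lookup g 0) * f) else 0)"
        using kill[OF f True] g by (intro sum.cong) (auto simp: mem_carrier_mpoly_ring)
      also have "\<dots> = coeff_sum (cls x) (single 0 (lookup g 0) * f)"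
        by (auto simp: in_keys_iff sum.delta)
      also have "\<dots> = lookup g 0 * coeff_sum (cls x) f"
        by (simp add: coeff_sum_single_mult)
      finally show ?thesis using True by (simp add: \<Phi>_def)
    qed (simp add: \<Phi>_def)
  qed
  have ST: "S \<subseteq> toric_ideal bs" using genideal_self[OF S(2)] S(3) by simp
  \<comment> \<open>An ideal containing \<open>S\<close>, hence all of the toric ideal: this carries
    the span condition from \<open>S\<close> to every element.\<close>
  define J where "J = {f \<in> toric_ideal bs. \<Phi> f \<in> V.span (\<Phi> ` S)}"
  have "ideal J ?R"
  proof (rule ideal_mpoly_ringI)
    note closed = ideal_mpoly_ring_closed[OF ideal_toric_ideal[of bs, where 'k='k]]
    show "J \<subseteq> carrier ?R" by (auto simp: J_def toric_ideal_def)
    have "\<Phi> 0 = 0" by (auto simp: \<Phi>_def fun_eq_iff)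
    thus "0 \<in> J" using closed(2) V.span_zero by (auto simp: J_def)
    show "f + g \<in> J" if "f \<in> J" "g \<in> J" for f g
      using that closed(3) V.span_add by (auto simp: J_def \<Phi>_add)
    show "g * f \<in> J" if "f \<in> J" "g \<in> carrier ?R" for f g
      using that closed(4) \<Phi>_mult V.span_scale[of "\<Phi> f" "\<Phi> ` S" "lookup g 0"] by (auto simp: J_def)
  qed
  moreover have "S \<subseteq> J" using ST by (auto simp: J_def intro: V.span_base)
  ultimately have "toric_ideal bs \<subseteq> J" using genideal_minimal S(3) by metis
  define \<delta> where "\<delta> x = (\<lambda>y. of_bool (x = y) :: 'k)" for x :: "mon \<times> mon"
  have \<delta>_inj: "inj \<delta>" 
  proof (rule injI)
    fix x y assume "\<delta> x = \<delta> y"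
    hence "\<delta> x x = \<delta> y x" by simp
    thus "x = y" by (simp add: \<delta>_def split: if_splits)
  qed
  have "\<Phi> (binomial_of x) = \<delta> x" if "x \<in> P" for x
  proof
    fix y show "\<Phi> (binomial_of x) y = \<delta> x y"
      using that cls_iff[of x y] snd_cls[of x] fst_cls[of x]
      by (cases "x = y") (simp_all add: \<Phi>_def \<delta>_def coeff_sum_binomial)
  qed
  moreover have "binomial_of x \<in> toric_ideal bs" if "x \<in> P" for x
    using P that binomial_of_toric[of bs "fst x" "snd x"] by auto
  ultimately have "\<delta> ` P \<subseteq> V.span (\<Phi> ` S)"
    using \<open>toric_ideal bs \<subseteq> J\<close> unfolding J_def by fastforce
  moreover have "V.independent (\<delta> ` P)"
    unfolding V.dependent_def
  proof safe
    fix x assume x: "x \<in> P" "\<delta> x \<in> V.span (\<delta> ` P - {\<delta> x})"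
    have "V.span (\<delta> ` P - {\<delta> x}) \<subseteq> {f. f x = 0}"
      by (rule V.span_minimal) (auto simp: \<delta>_def V.subspace_def)
    thus False using x by (auto simp: \<delta>_def)
  qed
  ultimately have "card (\<delta> ` P) \<le> card (\<Phi> ` S)"
    using V.independent_span_bound S(1) by blast
  also have "\<dots> \<le> card S" using S(1) by (rule card_image_le)
  finally show ?thesis by (simp add: card_image[OF inj_on_subset[OF \<delta>_inj]])
qed

theorem min_num_generators_toric_ideal:
  assumes nz: "\<And>i. i < length bs \<Longrightarrow> bs ! i \<noteq> 0"
    and irr: "irredundant bs P" and fin: "finite P"
  shows "min_num_generators (mpoly_ring (length bs)) (toric_ideal bs :: (mon \<Rightarrow>\<^sub>0 'k::field) set) = card P"
proof -
  let ?R = "mpoly_ring (length bs) :: (mon \<Rightarrow>\<^sub>0 'k) ring"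
  let ?S = "binomial_of ` P :: (mon \<Rightarrow>\<^sub>0 'k) set"
  have gen: "generates bs P" using irr by (simp add: irredundant_def)
  have S: "finite ?S" "?S \<subseteq> carrier ?R" "genideal ?R ?S = toric_ideal bs"
  proof -
    show "?S \<subseteq> carrier ?R"
      using gen binomial_of_toric unfolding generates_def toric_ideal_def by fastforce
  qed (use fin toric_ideal_generated[OF gen] in auto)
  \<comment> \<open>The bound applied to the image itself shows that distinct pairs give distinct
    binomials.\<close>
  have "card ?S = card P"
    using irredundant_card_le[OF nz irr S] card_image_le[OF fin, of "binomial_of :: _ \<Rightarrow> (mon \<Rightarrow>\<^sub>0 'k)"]
    by simp
  show ?thesis unfolding min_num_generators_def
  proof (rule Least_equality)
    show "\<exists>S. S \<subseteq> carrier ?R \<and> finite S \<and> card S = card P \<and> genideal ?R S = toric_ideal bs"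
      using S \<open>card ?S = card P\<close> by blast
  qed (use irredundant_card_le[OF nz irr] in blast)
qed

lemma conn_exit:
  assumes "conn P u v" "u \<in> Y" "v \<notin> Y"
  shows "\<exists>y y'. mstep P y y' \<and> y \<in> Y \<and> y' \<notin> Y"
  using assms by (induction rule: rtranclp_induct) blast+

lemmas lookup_simps = lookup_add lookup_single when_def

text \<open>Subtraction is truncated, so \<open>u - (u - v)\<close> is the pointwise minimum, the
  greatest common divisor of the two monomials.\<close>

lemma mon_diff_decomp: "(u :: mon) = (u - (u - v)) + (u - v)" "v = (u - (u - v)) + (v - u)"
  by (auto intro!: poly_mapping_eqI simp: lookup_add lookup_minus)

lemma mon_le_decomp:
  assumes "\<And>i. lookup p i \<le> lookup (u :: mon) i"
  shows "u = p + (u - p)"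
  using assms by (auto intro!: poly_mapping_eqI simp: lookup_add lookup_minus)

lemma mon_single_decomp: "k \<le> lookup (u :: mon) i \<Longrightarrow> u = single i k + (u - single i k)"
  by (rule mon_le_decomp) (auto simp: lookup_single when_def)

section \<open>Projective monomial curves\<close>

text \<open>\<open>z\<close> and \<open>t\<close> are the indices of the two extremal points \<open>0\<close> and \<open>e t\<close>.\<close>

locale monomial_curve =
  fixes N :: nat and e :: "nat \<Rightarrow> nat" and z t :: nat
  assumes z_less: "z < N" and t_less: "t < N" and inj_e: "inj_on e {..<N}"
    and e_z: "e z = 0" and e_le: "\<And>i. i < N \<Longrightarrow> e i \<le> e t" and e_t_pos: "0 < e t"
begin

definition points :: "(nat ^ 2) list" where
  "points = map (\<lambda>i. vector [e i, e t - e i]) [0..<N]"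

definition inner :: "nat set" where "inner = {..<N} - {z, t}"

definition deg :: "mon \<Rightarrow> nat" where "deg u = (\<Sum>i<N. lookup u i)"

definition val :: "mon \<Rightarrow> nat" where "val u = (\<Sum>i<N. lookup u i * e i)"

abbreviation rel :: "mon \<Rightarrow> mon \<Rightarrow> bool" where "rel \<equiv> tor points"

lemma z_neq_t: "z \<noteq> t" using e_z e_t_pos by auto

lemma length_points [simp]: "length points = N" by (simp add: points_def)

lemma innerD: "i \<in> inner \<Longrightarrow> i < N \<and> i \<noteq> z \<and> i \<noteq> t \<and> 0 < e i \<and> e i < e t"
proof -
  assume i: "i \<in> inner"
  hence "e i \<noteq> e z" "e i \<noteq> e t" using inj_onD[OF inj_e] z_less t_less by (auto simp: inner_def)
  with i e_le[of i] e_z show ?thesis by (auto simp: inner_def)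
qed

lemma finite_inner [simp]: "finite inner" by (simp add: inner_def)

lemma card_inner: "card inner = N - 2"
  unfolding inner_def using z_neq_t z_less t_less by (subst card_Diff_subset) auto

lemma e_eqD: "e i = e j \<Longrightarrow> i < N \<Longrightarrow> j < N \<Longrightarrow> i = j"
  using inj_onD[OF inj_e] by auto

lemma deg_add [simp]: "deg (u + v) = deg u + deg v"
  by (simp add: deg_def lookup_add sum.distrib)

lemma val_add [simp]: "val (u + v) = val u + val v"
  by (simp add: val_def lookup_add sum.distrib algebra_simps)

lemma deg_single [simp]: "i < N \<Longrightarrow> deg (single i k) = k"
  by (simp add: deg_def lookup_single when_def)

lemma val_single [simp]: "i < N \<Longrightarrow> val (single i k) = k * e i"
  by (simp add: val_def lookup_single when_def if_distrib if_distribR cong: if_cong)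

lemma deg_zero [simp]: "deg 0 = 0" and val_zero [simp]: "val 0 = 0"
  by (simp_all add: deg_def val_def)

lemma deg_eq_0: "keys u \<subseteq> {..<N} \<Longrightarrow> deg u = 0 \<Longrightarrow> u = 0"
  by (rule poly_mapping_eqI) (auto simp: deg_def in_keys_iff subset_iff)

lemma sum_split_inner: "(\<Sum>i<N. f i) = f z + f t + (\<Sum>i\<in>inner. f i)"
proof -
  have "{..<N} = insert z (insert t inner)" using z_less t_less by (auto simp: inner_def)
  hence "(\<Sum>i<N. f i) = sum f (insert z (insert t inner))" by simp
  also have "\<dots> = f z + f t + (\<Sum>i\<in>inner. f i)"
    using z_neq_t by (simp add: inner_def add.assoc)
  finally show ?thesis .
qed

text \<open>The coordinates of each point add up to \<open>e t\<close>, so the second coordinate of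
  the weight is \<open>deg u * e t - val u\<close>.\<close>

lemma rel_iff:
  "rel u v \<longleftrightarrow> keys u \<subseteq> {..<N} \<and> keys v \<subseteq> {..<N} \<and> deg u = deg v \<and> val u = val v"
proof -
  have c1: "wt points u $ 1 = val u" if "keys u \<subseteq> {..<N}" for u
    by (subst wt_superset[OF _ that]) (simp_all add: val_def points_def)
  have c2: "wt points u $ 2 + val u = deg u * e t" if "keys u \<subseteq> {..<N}" for u
  proof -
    have "wt points u $ 2 = (\<Sum>i<N. lookup u i * (e t - e i))"
      by (subst wt_superset[OF _ that]) (simp_all add: points_def)
    also have "\<dots> + val u = (\<Sum>i<N. lookup u i * e t)"
      unfolding val_def sum.distrib[symmetric]
      by (intro sum.cong) (use e_le in \<open>auto simp flip: distrib_left\<close>)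
    finally show ?thesis by (simp add: deg_def sum_distrib_right)
  qed
  have "wt points u = wt points v \<longleftrightarrow> deg u = deg v \<and> val u = val v"
    if "keys u \<subseteq> {..<N}" "keys v \<subseteq> {..<N}"
    using c1[OF that(1)] c1[OF that(2)] c2[OF that(1)] c2[OF that(2)] e_t_pos
    by (auto simp: vec_eq_iff forall_2)
  thus ?thesis by (auto simp: tor_def)
qed

lemma points_nonzero: "i < length points \<Longrightarrow> points ! i \<noteq> 0"
  using e_t_pos e_le[of i] by (auto simp: points_def vec_eq_iff forall_2)

lemma rel_cancel: "rel (u + w) (v + w) \<Longrightarrow> rel u v"
  by (auto simp: rel_iff keys_add_nat)

lemma deg_ge: "i < N \<Longrightarrow> lookup u i \<le> deg u"
  unfolding deg_def by (rule member_le_sum) auto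

lemma val_ge: "i < N \<Longrightarrow> lookup u i * e i \<le> val u"
  unfolding val_def by (rule member_le_sum) auto

text \<open>Makes the inner variables integral over the extremal ones; it is the source of
  finiteness, of the pure powers and of acyclicity.\<close>

lemma rel_extreme: "i \<in> inner \<Longrightarrow> rel (single i (e t)) (single z (e t - e i) + single t (e i))"
  using innerD[of i] z_less t_less e_z by (auto simp: rel_iff keys_add_nat split: if_splits)

lemma finite_deg_le: "finite {u. keys u \<subseteq> {..<N} \<and> deg u \<le> K}"
proof (rule finite_imageD[where f = lookup])
  show "inj_on lookup {u. keys u \<subseteq> {..<N} \<and> deg u \<le> K}"
    by (rule inj_onI) (rule poly_mapping_eqI, rule fun_cong)
  have "lookup ` {u. keys u \<subseteq> {..<N} \<and> deg u \<le> K} \<subseteq>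
      {f. \<forall>x. (x \<in> {..<N} \<longrightarrow> f x \<in> {..K}) \<and> (x \<notin> {..<N} \<longrightarrow> f x = 0)}"
  proof (rule image_subsetI)
    fix u assume "u \<in> {u. keys u \<subseteq> {..<N} \<and> deg u \<le> K}"
    hence u: "keys u \<subseteq> {..<N}" "deg u \<le> K" by simp_all
    have "lookup u i \<le> K" if "i < N" for i
      using deg_ge[OF that, of u] u(2) by simp
    moreover have "lookup u i = 0" if "i \<notin> {..<N}" for i
      using that u(1) by (meson in_keys_iff subsetD)
    ultimately show "lookup u \<in> {f. \<forall>x. (x \<in> {..<N} \<longrightarrow> f x \<in> {..K}) \<and> (x \<notin> {..<N} \<longrightarrow> f x = 0)}"
      by simp
  qed
  thus "finite (lookup ` {u. keys u \<subseteq> {..<N} \<and> deg u \<le> K})"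
    by (rule finite_subset) (rule finite_set_of_finite_funs, auto)
qed

text \<open>A direct degree bound: inner exponents are lowered below \<open>e t\<close> by
  \<open>rel_extreme\<close>, the common factor is cancelled, and what remains has bounded
  degree.\<close>

lemma finite_generating_set: "\<exists>P. finite P \<and> generates points P"
proof -
  define D where "D = e t"
  \<comment> \<open>\<open>D\<close> is the degree of the relations \<open>rel_extreme\<close>;
    \<open>2 * (N * D)\<close> bounds the inner exponents together with that of \<open>t\<close>,
    hence the degree of whichever monomial lacks the variable \<open>z\<close>.\<close>
  define K where "K = 2 * (N * D) + D"
  define P where "P = {(u, v). rel u v \<and> deg u \<le> K}"
  have "P \<subseteq> {u. keys u \<subseteq> {..<N} \<and> deg u \<le> K} \<times> {u. keys u \<subseteq> {..<N} \<and> deg u \<le> K}"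
    by (auto simp: P_def rel_iff)
  hence fin: "finite P" by (rule finite_subset) (simp add: finite_deg_le)
  have P: "\<forall>(p, q)\<in>P. rel p q" by (auto simp: P_def)
  have small: "\<exists>u'. conn P u u' \<and> (\<forall>i\<in>inner. lookup u' i < D)" if "keys u \<subseteq> {..<N}" for u
    using that
  proof (induction "\<Sum>i\<in>inner. lookup u i" arbitrary: u rule: less_induct)
    case less
    show ?case
    proof (cases "\<forall>i\<in>inner. lookup u i < D")
      case False
      then obtain i where i: "i \<in> inner" "D \<le> lookup u i" by force
      define w where "w = u - single i D"
      define v where "v = single z (D - e i) + single t (e i)"
      have u: "u = single i D + w" unfolding w_def by (rule mon_single_decomp) (rule i(2))
      have r: "rel (single i D) v" using rel_extreme[OF i(1)] by (simp add: v_def D_def)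
      moreover have "deg (single i D) \<le> K" using innerD[OF i(1)] by (simp add: K_def)
      ultimately have st: "conn P u (v + w)"
        unfolding u by (intro conn_add conn_pair) (simp add: P_def)
      have "(\<Sum>j\<in>inner. lookup (v + w) j) = (\<Sum>j\<in>inner. lookup w j)"
      proof (rule sum.cong)
        fix j assume "j \<in> inner"
        thus "lookup (v + w) j = lookup w j"
          using innerD[of j] by (simp add: v_def lookup_simps)
      qed simp
      moreover have "(\<Sum>j\<in>inner. lookup u j) = D + (\<Sum>j\<in>inner. lookup w j)"
        unfolding u using i(1) by (simp add: lookup_add sum.distrib lookup_single when_def)
      ultimately have "(\<Sum>j\<in>inner. lookup (v + w) j) < (\<Sum>j\<in>inner. lookup u j)"
        using e_t_pos by (simp add: D_def)
      moreover have "keys (v + w) \<subseteq> {..<N}"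
        using less.prems r unfolding u by (auto simp: keys_add_nat rel_iff)
      ultimately obtain u' where "conn P (v + w) u'" "\<forall>i\<in>inner. lookup u' i < D"
        using less.hyps by blast
      with st show ?thesis by (meson rtranclp_trans)
    qed auto
  qed
  have "conn P u v" if uv: "rel u v" for u v
  proof -
    obtain u' v' where u': "conn P u u'" "\<And>i. i \<in> inner \<Longrightarrow> lookup u' i < D"
      and v': "conn P v v'" "\<And>i. i \<in> inner \<Longrightarrow> lookup v' i < D"
      using small[of u] small[of v] uv by (auto simp: rel_iff)
    have "rel u u'" "rel v v'"
      using conn_tor[OF P u'(1)] conn_tor[OF P v'(1)] uv by (auto simp: rel_iff)
    hence r: "rel u' v'" using uv by (meson tor_sym tor_trans)
    define w where "w = u' - (u' - v')"
    define a where "a = u' - v'"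
    define b where "b = v' - u'"
    have uw: "u' = a + w" "v' = b + w"
      using mon_diff_decomp[where u = u' and v = v'] unfolding w_def a_def b_def by (metis add.commute)+
    have rab: "rel a b" using rel_cancel[of a w b] r uw by simp
    have disj: "lookup a i = 0 \<or> lookup b i = 0" for i by (auto simp: a_def b_def lookup_minus)
    have bound: "(\<Sum>i\<in>inner. lookup a i) \<le> N * D" "(\<Sum>i\<in>inner. lookup a i * e i) \<le> N * D * D"
      if "\<And>i. i \<in> inner \<Longrightarrow> lookup a i \<le> D" for a :: mon
    proof -
      have c: "card inner \<le> N" by (simp add: card_inner)
      have "(\<Sum>i\<in>inner. lookup a i) \<le> of_nat (card inner) * D" by (rule sum_bounded_above) (rule that)
      also have "\<dots> \<le> N * D" using c by simp
      finally show "(\<Sum>i\<in>inner. lookup a i) \<le> N * D" .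
      have "(\<Sum>i\<in>inner. lookup a i * e i) \<le> of_nat (card inner) * (D * D)"
      proof (rule sum_bounded_above)
        fix i assume "i \<in> inner"
        thus "lookup a i * e i \<le> D * D"
          using that[of i] innerD[of i] unfolding D_def by (intro mult_le_mono) auto
      qed
      also have "\<dots> \<le> N * D * D" using c by simp
      finally show "(\<Sum>i\<in>inner. lookup a i * e i) \<le> N * D * D" .
    qed
    have "lookup a i \<le> D" "lookup b i \<le> D" if "i \<in> inner" for i
      using u'(2)[OF that] v'(2)[OF that] by (simp_all add: a_def b_def lookup_minus)
    note ba = bound[OF this(1)] and bb = bound[OF this(2)]
    have val: "val c = lookup c t * D + (\<Sum>i\<in>inner. lookup c i * e i)"
      and deg: "deg c = lookup c z + lookup c t + (\<Sum>i\<in>inner. lookup c i)" for c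
      unfolding val_def deg_def D_def by (simp_all add: sum_split_inner e_z)
    have D: "D > 0" using e_t_pos by (simp add: D_def)
    have va: "val a = val b" and da: "deg a = deg b" using rab by (simp_all add: rel_iff)
    \<comment> \<open>The supports are disjoint: one monomial lacks \<open>t\<close>, so the common
      value is that of its inner part.\<close>
    have "lookup a t * D \<le> N * D * D \<and> lookup b t * D \<le> N * D * D"
    proof (cases "lookup a t = 0")
      case True
      hence "lookup a t * D = 0" by simp
      thus ?thesis using va ba(2) unfolding val by linarith
    next
      case False
      hence "lookup b t * D = 0" using disj[of t] by simp
      thus ?thesis using va bb(2) unfolding val by linarith
    qed
    hence "lookup a t \<le> N * D" "lookup b t \<le> N * D" using D by (metis mult_le_cancel2)+
    hence "deg a \<le> K" using disj[of z] da ba(1) bb(1) unfolding deg K_def by auto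
    with rab have "(a, b) \<in> P" by (simp add: P_def)
    from conn_add[OF conn_pair[OF this], of w] have "conn P u' v'" by (simp add: uw)
    with u'(1) conn_sym[OF v'(1)] show ?thesis by simp
  qed
  hence "generates points P" using P by (simp add: generates_def)
  with fin show ?thesis by blast
qed

text \<open>The first move away from \<open>x_i ^ (e t)\<close> replaces a divisor of it, and all
  divisors are powers of \<open>x_i\<close>.\<close>

lemma pure_power_in_generating_set:
  assumes gen: "generates points P" and i: "i \<in> inner"
  shows "\<exists>k q. ((single i k, q) \<in> P \<or> (q, single i k) \<in> P) \<and> q \<noteq> single i k \<and> 0 < k"
proof -
  let ?x = "single i (e t)" and ?y = "single z (e t - e i) + single t (e i)"
  have "?y \<noteq> ?x"
  proof
    assume "?y = ?x"
    hence "lookup ?y t = lookup ?x t" by simp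
    thus False using innerD[OF i] z_neq_t by (simp add: lookup_simps)
  qed
  moreover have "conn P ?x ?y" using gen rel_extreme[OF i] by (simp add: generates_def)
  ultimately obtain y where y: "mstep P ?x y" "y \<noteq> ?x"
    using conn_exit[of P ?x ?y "{?x}"] by auto
  then obtain p q w where *: "(p, q) \<in> P \<or> (q, p) \<in> P" "?x = p + w" "y = q + w"
    unfolding mstep_def by blast
  hence "keys p \<subseteq> keys ?x" by (metis Un_upper1 keys_add_nat)
  hence "keys p \<subseteq> {i}" by (auto split: if_splits)
  hence p: "p = single i (lookup p i)"
    by (intro poly_mapping_eqI) (auto simp: lookup_single when_def in_keys_iff)
  have "q \<noteq> p" using * y by auto
  have "rel p q" using * gen tor_sym unfolding generates_def by blast
  have "lookup p i \<noteq> 0"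
  proof
    assume "lookup p i = 0"
    hence "p = 0" using p by simp
    with \<open>rel p q\<close> have "q = 0" by (intro deg_eq_0) (auto simp: rel_iff)
    thus False using \<open>p = 0\<close> \<open>q \<noteq> p\<close> by simp
  qed
  thus ?thesis using p *(1) \<open>q \<noteq> p\<close> by (intro exI[of _ "lookup p i"] exI[of _ q]) (auto simp flip: p)
qed

lemma rel_single_single:
  assumes "rel (single i k) (single j l)" "i < N" "j < N"
  shows "single i k = single j l"
proof -
  have "k = l" "k * e i = l * e j" using assms by (auto simp: rel_iff)
  thus ?thesis using e_eqD[of i j] assms by (cases "k = 0") auto
qed

text \<open>Since a binomial of the ideal contains at most one pure power of an inner variable, these
  variables can be matched with distinct generators.\<close>

lemma inner_matching:
  assumes gen: "generates points P"
  obtains F where "inj_on F inner" "F ` inner \<subseteq> P"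
    "\<And>i. i \<in> inner \<Longrightarrow> \<exists>k q. (F i = (single i k, q) \<or> F i = (q, single i k)) \<and> q \<noteq> single i k \<and> 0 < k"
proof -
  have "\<exists>x. x \<in> P \<and> (\<exists>k q. (x = (single i k, q) \<or> x = (q, single i k)) \<and> q \<noteq> single i k \<and> 0 < k)"
    if "i \<in> inner" for i
    using pure_power_in_generating_set[OF gen that] by blast
  then obtain F where F: "\<And>i. i \<in> inner \<Longrightarrow> F i \<in> P"
    "\<And>i. i \<in> inner \<Longrightarrow> \<exists>k q. (F i = (single i k, q) \<or> F i = (q, single i k)) \<and> q \<noteq> single i k \<and> 0 < k"
    by metis
  have "inj_on F inner"
  proof (rule inj_onI)
    fix i j assume ij: "i \<in> inner" "j \<in> inner" "F i = F j"
    obtain k q where kq: "F i = (single i k, q) \<or> F i = (q, single i k)" "q \<noteq> single i k" "0 < k"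
      using F(2)[OF ij(1)] by blast
    obtain l r where lr: "F j = (single j l, r) \<or> F j = (r, single j l)" "r \<noteq> single j l" "0 < l"
      using F(2)[OF ij(2)] by blast
    have t: "rel (fst (F i)) (snd (F i))"
      using gen F(1)[OF ij(1)] unfolding generates_def by (auto simp: split_beta)
    have N: "i < N" "j < N" using ij innerD by auto
    have "single i k = single j l"
    proof (rule ccontr)
      assume ne: "single i k \<noteq> single j l"
      hence "rel (single i k) (single j l) \<or> rel (single j l) (single i k)"
        using kq lr ij(3) t by auto
      thus False using rel_single_single N ne by metis
    qed
    hence "lookup (single i k) i = lookup (single j l) i" by simp
    thus "i = j" using kq(3) by (simp add: lookup_single when_def split: if_splits)
  qed
  with F that show ?thesis by blast
qed

text \<open>The codimension bound for binomial generating sets, obtained by counting inner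
  variables.\<close>

lemma card_generating_ge:
  assumes "generates points P" "finite P"
  shows "N - 2 \<le> card P"
proof -
  obtain F where "inj_on F inner" "F ` inner \<subseteq> P" by (rule inner_matching[OF assms(1)])
  thus ?thesis using card_inj_on_le[of F inner P] assms(2) by (simp add: card_inner)
qed

lemma min_num_generators_eqI:
  assumes "generates points P" "finite P" "card P \<le> N - 2"
  shows "min_num_generators (mpoly_ring N) (toric_ideal points :: (mon \<Rightarrow>\<^sub>0 'k::field) set) = N - 2"
proof -
  obtain Q where Q: "Q \<subseteq> P" "irredundant points Q"
    using irredundant_subset_exists[OF assms(2,1)] by blast
  hence fin: "finite Q" using assms(2) finite_subset by blast
  have "N - 2 \<le> card Q" using card_generating_ge[OF _ fin] Q(2) by (simp add: irredundant_def)
  moreover have "card Q \<le> card P" using Q(1) assms(2) by (rule card_mono[rotated])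
  ultimately have "card Q = N - 2" using assms(3) by simp
  thus ?thesis using min_num_generators_toric_ideal[OF points_nonzero Q(2) fin, where 'k='k] by simp
qed

definition moves :: "(nat \<Rightarrow> nat) \<Rightarrow> (nat \<Rightarrow> mon) \<Rightarrow> (mon \<times> mon) set" where
  "moves m \<beta> = (\<lambda>i. (single i (m i), \<beta> i)) ` inner"

text \<open>A complete intersection is generated by the binomials \<open>x\<^sub>i ^ m\<^sub>i - x ^ \<beta>\<^sub>i\<close>, one for each
  inner variable.\<close>

definition ci :: "(nat \<Rightarrow> nat) \<Rightarrow> (nat \<Rightarrow> mon) \<Rightarrow> bool" where
  "ci m \<beta> \<longleftrightarrow> (\<forall>i\<in>inner. 2 \<le> m i) \<and> generates points (moves m \<beta>)"

text \<open>With as many generators as inner variables the injective matching is onto, and each pair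
  can be oriented so that its pure power comes first.\<close>

lemma ci_exists:
  assumes "min_num_generators (mpoly_ring N) (toric_ideal points :: (mon \<Rightarrow>\<^sub>0 'k::field) set) = N - 2"
  shows "\<exists>m \<beta>. ci m \<beta>"
proof -
  obtain P0 where P0: "finite P0" "generates points P0" using finite_generating_set by blast
  then obtain P where P: "P \<subseteq> P0" "irredundant points P" using irredundant_subset_exists by blast
  hence fin: "finite P" and gen: "generates points P"
    using P0 finite_subset by (auto simp: irredundant_def)
  have "card P = N - 2"
    using min_num_generators_toric_ideal[OF points_nonzero P(2) fin, where 'k='k] assms by simp
  obtain F where F: "inj_on F inner" "F ` inner \<subseteq> P"
    "\<And>i. i \<in> inner \<Longrightarrow> \<exists>k q. (F i = (single i k, q) \<or> F i = (q, single i k)) \<and> q \<noteq> single i k \<and> 0 < k"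
    by (rule inner_matching[OF gen]) (rule that)
  have "F ` inner = P"
    using F(1,2) \<open>card P = N - 2\<close> fin by (intro card_subset_eq) (auto simp: card_image card_inner)
  obtain m \<beta> where m\<beta>: "\<And>i. i \<in> inner \<Longrightarrow> F i = (single i (m i), \<beta> i) \<or> F i = (\<beta> i, single i (m i))"
    "\<And>i. i \<in> inner \<Longrightarrow> \<beta> i \<noteq> single i (m i)" "\<And>i. i \<in> inner \<Longrightarrow> 0 < m i"
    using F(3) by metis
  have t: "rel (single i (m i)) (\<beta> i)" if "i \<in> inner" for i
  proof -
    have "F i \<in> P" using that F(2) by blast
    thus ?thesis using gen m\<beta>(1)[OF that] tor_sym unfolding generates_def by (metis case_prodD)
  qed
  have "conn (moves m \<beta>) p q" if "(p, q) \<in> P" for p q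
  proof -
    have "(p, q) \<in> F ` inner" using that \<open>F ` inner = P\<close> by simp
    then obtain i where i: "i \<in> inner" "F i = (p, q)" by fastforce
    have "conn (moves m \<beta>) (single i (m i)) (\<beta> i)"
      by (rule conn_pair) (use i in \<open>auto simp: moves_def\<close>)
    thus ?thesis using m\<beta>(1)[OF i(1)] i(2) conn_sym by auto
  qed
  hence "generates points (moves m \<beta>)"
    using gen t conn_subst[of P _ _ "moves m \<beta>"] unfolding generates_def moves_def by auto
  \<comment> \<open>A move of degree 1 would exchange two distinct variables of equal value.\<close>
  moreover have "2 \<le> m i" if i: "i \<in> inner" for i
  proof (rule ccontr)
    assume "\<not> 2 \<le> m i"
    hence "m i = 1" using m\<beta>(3)[OF i] by simp
    with t[OF i] have b: "keys (\<beta> i) \<subseteq> {..<N}" "deg (\<beta> i) = 1" "val (\<beta> i) = e i"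
      using innerD[OF i] by (auto simp: rel_iff)
    then obtain j where j: "j \<in> keys (\<beta> i)" by (metis all_not_in_conv deg_zero keys_eq_empty zero_neq_one)
    hence jN: "j < N" using b by auto
    have "\<beta> i = single j 1 + (\<beta> i - single j 1)"
      by (rule mon_single_decomp) (use j in \<open>simp add: in_keys_iff\<close>)
    then obtain w where w: "\<beta> i = single j 1 + w" by blast
    hence "w = 0" using b jN by (intro deg_eq_0) (auto simp: keys_add_nat)
    hence "e j = e i" using b w jN by simp
    hence "j = i" using jN innerD[OF i] e_eqD by blast
    thus False using w \<open>w = 0\<close> m\<beta>(2)[OF i] \<open>m i = 1\<close> by simp
  qed
  ultimately show ?thesis unfolding ci_def by blast
qed

end

text \<open>\<open>G div gcd G q\<close> is the order of \<open>q\<close> in the integers modulo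
  \<open>G\<close>.\<close>

lemma dvd_mult_div_gcd:
  assumes "G dvd y * q" "0 < (G::nat)"
  shows "G div gcd G q dvd y"
proof -
  define g where "g = gcd G q"
  have g: "0 < g" "g dvd G" "g dvd q" using assms(2) by (auto simp: g_def)
  obtain G' q' where Gq: "G = g * G'" "q = g * q'" using g by (auto elim!: dvdE)
  have "coprime G' q'"
    using div_gcd_coprime[of G q] assms(2) g(1) unfolding g_def[symmetric] by (simp add: Gq)
  moreover have "G' dvd y * q'" using assms(1) g(1) unfolding Gq by (simp add: mult.left_commute)
  ultimately have "G' dvd y" by (simp add: coprime_dvd_mult_left_iff)
  thus ?thesis using g(1) unfolding g_def[symmetric] by (simp add: Gq(1))
qed

text \<open>The multiplier of \<open>q\<close> is its order modulo the group spanned by the points \<open>0\<close>, \<open>p\<close>, \<open>D\<close>; the slack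
  in the inequality is the coefficient of the point \<open>0\<close>.\<close>

definition gluable :: "nat \<Rightarrow> nat \<Rightarrow> nat \<Rightarrow> bool" where
  "gluable D p q \<longleftrightarrow>
     (\<exists>\<alpha> \<gamma>. gcd D p div gcd (gcd D p) q * q = \<alpha> * p + \<gamma> * D \<and>
        \<alpha> + \<gamma> \<le> gcd D p div gcd (gcd D p) q)"

section \<open>Adding variables one at a time\<close>

context monomial_curve
begin

text \<open>Only the endpoints are confined to \<open>K\<close>; the connecting walk may leave
  it.\<close>

definition conn_on :: "(mon \<times> mon) set \<Rightarrow> nat set \<Rightarrow> bool" where
  "conn_on P K \<longleftrightarrow> (\<forall>u v. rel u v \<and> keys u \<subseteq> K \<and> keys v \<subseteq> K \<longrightarrow> conn P u v)"

text \<open>Two distinct points of a line carry no relation: degree and value determine both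
  exponents.\<close>

lemma conn_on_extremes: "conn_on P {z, t}"
  unfolding conn_on_def
proof (intro allI impI)
  fix u v assume uv: "rel u v \<and> keys u \<subseteq> {z, t} \<and> keys v \<subseteq> {z, t}"
  have *: "deg w = lookup w z + lookup w t \<and> val w = lookup w t * e t" if "keys w \<subseteq> {z, t}" for w
  proof -
    have "lookup w i = 0" if "i \<in> inner" for i
      using \<open>keys w \<subseteq> {z, t}\<close> innerD[OF that] by (auto simp: in_keys_iff)
    thus ?thesis by (simp add: deg_def val_def sum_split_inner e_z)
  qed
  have "lookup u t = lookup v t" "lookup u z = lookup v z"
    using *[of u] *[of v] uv e_t_pos by (auto simp: rel_iff)
  moreover have "lookup u i = lookup v i" if "i \<noteq> z" "i \<noteq> t" for i
  proof -
    have "i \<notin> keys u" "i \<notin> keys v" using that uv by auto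
    thus ?thesis by (simp add: in_keys_iff)
  qed
  ultimately have "u = v" by (intro poly_mapping_eqI) metis
  thus "conn P u v" by simp
qed

text \<open>The pair lowers the exponent of \<open>j\<close> below \<open>k\<close> in both
  monomials. Being congruent modulo \<open>k\<close>, the remaining exponents agree and cancel,
  which leaves a relation in \<open>K\<close>.\<close>

lemma conn_on_insert:
  assumes K: "conn_on P K" and j: "j \<notin> K" and b: "(single j k, b) \<in> P" "keys b \<subseteq> K" "rel (single j k) b"
    and k: "0 < k"
    and dvd: "\<And>u v. rel u v \<Longrightarrow> keys u \<subseteq> insert j K \<Longrightarrow> keys v \<subseteq> insert j K \<Longrightarrow>
       int k dvd int (lookup u j) - int (lookup v j)"
  shows "conn_on P (insert j K)"
proof -
  have red: "\<exists>u'. conn P u u' \<and> rel u u' \<and> keys u' \<subseteq> insert j K \<and> lookup u' j < k"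
    if "keys u \<subseteq> insert j K" "keys u \<subseteq> {..<N}" for u
    using that
  proof (induction "lookup u j" arbitrary: u rule: less_induct)
    case less
    show ?case
    proof (cases "lookup u j < k")
      case True
      thus ?thesis using less.prems by (intro exI[of _ u]) (auto simp: tor_def)
    next
      case False
      define w where "w = u - single j k"
      have u: "u = single j k + w" unfolding w_def by (rule mon_single_decomp) (use False in simp)
      have st: "conn P u (b + w)" unfolding u by (intro conn_add conn_pair b(1))
      have r: "rel u (b + w)"
        using b(3) less.prems(2) unfolding u by (auto simp: rel_iff keys_add_nat)
      have "lookup b j = 0" using b(2) j by (auto simp: in_keys_iff)
      hence "lookup (b + w) j < lookup u j" using k unfolding u by (simp add: lookup_add)
      moreover have "keys (b + w) \<subseteq> insert j K" using b(2) less.prems(1) unfolding u by (auto simp: keys_add_nat)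
      moreover have "keys (b + w) \<subseteq> {..<N}" using r by (simp add: rel_iff)
      ultimately obtain u' where u': "conn P (b + w) u'" "rel (b + w) u'" "keys u' \<subseteq> insert j K" "lookup u' j < k"
        using less.hyps[of "b + w"] by blast
      have "conn P u u'" using st u'(1) by simp
      moreover have "rel u u'" using r u'(2) by (rule tor_trans)
      ultimately show ?thesis using u'(3,4) by blast
    qed
  qed
  show ?thesis unfolding conn_on_def
  proof (intro allI impI)
    fix u v assume uv: "rel u v \<and> keys u \<subseteq> insert j K \<and> keys v \<subseteq> insert j K"
    obtain u' where u': "conn P u u'" "rel u u'" "keys u' \<subseteq> insert j K" "lookup u' j < k"
      using red[of u] uv by (auto simp: rel_iff)
    obtain v' where v': "conn P v v'" "rel v v'" "keys v' \<subseteq> insert j K" "lookup v' j < k"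
      using red[of v] uv by (auto simp: rel_iff)
    have r: "rel u' v'" using u'(2) v'(2) uv tor_sym tor_trans by blast
    have "int k dvd int (lookup u' j) - int (lookup v' j)" using dvd[OF r u'(3) v'(3)] .
    moreover have "\<bar>int (lookup u' j) - int (lookup v' j)\<bar> < int k" using u'(4) v'(4) by linarith
    ultimately have eq: "lookup u' j = lookup v' j"
      by (metis dvd_imp_le_int abs_of_nat eq_iff_diff_eq_0 linorder_not_le of_nat_eq_iff)
    define a where "a = u' - single j (lookup u' j)"
    define c where "c = v' - single j (lookup v' j)"
    have ua: "u' = a + single j (lookup u' j)" and vc: "v' = c + single j (lookup u' j)"
      using mon_single_decomp[of "lookup u' j" u' j] mon_single_decomp[of "lookup v' j" v' j] eq
      unfolding a_def c_def by (simp_all add: add.commute)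
    have "rel a c" using r rel_cancel[of a "single j (lookup u' j)" c] ua vc by metis
    moreover have "keys a \<subseteq> K" "keys c \<subseteq> K"
    proof -
      have "keys a \<subseteq> keys u'" "keys c \<subseteq> keys v'" using ua vc by (metis keys_add_nat Un_upper1)+
      moreover have "j \<notin> keys a" "j \<notin> keys c" by (simp_all add: a_def c_def in_keys_iff lookup_minus)
      ultimately show "keys a \<subseteq> K" "keys c \<subseteq> K" using u'(3) v'(3) by blast+
    qed
    ultimately have "conn P a c" using K by (simp add: conn_on_def)
    from conn_add[OF this] have "conn P u' v'" using ua vc by metis
    thus "conn P u v" using u'(1) conn_sym[OF v'(1)] by simp
  qed
qed

lemma rel_int_val:
  assumes "rel u v" "finite K" "K \<subseteq> {..<N}" "keys u \<subseteq> K" "keys v \<subseteq> K"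
  shows "(\<Sum>i\<in>K. (int (lookup u i) - int (lookup v i)) * int (e i)) = 0"
proof -
  have *: "int (val w) = (\<Sum>i\<in>K. int (lookup w i) * int (e i))" if "keys w \<subseteq> K" for w
    unfolding val_def of_nat_sum of_nat_mult
    by (rule sum.mono_neutral_right) (use assms(2,3) that in \<open>auto simp: in_keys_iff\<close>)
  have "val u = val v" using assms(1) by (simp add: rel_iff)
  thus ?thesis using *[OF assms(4)] *[OF assms(5)] by (simp add: left_diff_distrib sum_subtractf)
qed

text \<open>Modulo \<open>G\<close> only the variable \<open>j\<close> contributes to the value, so
  the difference of its exponents is a multiple of the order of \<open>e j\<close>.\<close>

lemma rel_dvd:
  assumes uv: "rel u v" "keys u \<subseteq> insert j K" "keys v \<subseteq> insert j K" and K: "K \<subseteq> {..<N}" "j \<notin> K" "j < N"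
    and G: "\<And>i. i \<in> K \<Longrightarrow> G dvd e i" "0 < G" and k: "k dvd G div gcd G (e j)"
  shows "int k dvd int (lookup u j) - int (lookup v j)"
proof -
  have fin: "finite K" using K(1) finite_subset by blast
  define x where "x = int (lookup u j) - int (lookup v j)"
  define s where "s = (\<Sum>i\<in>K. (int (lookup u i) - int (lookup v i)) * int (e i))"
  have "x * int (e j) + s = 0"
    using rel_int_val[of u v "insert j K"] uv K fin by (simp add: x_def s_def)
  hence "x * int (e j) = - s" by simp
  moreover have "int G dvd s" unfolding s_def by (intro dvd_sum dvd_mult) (simp add: G(1))
  ultimately have "int G dvd x * int (e j)" by simp
  hence "int G dvd int (nat \<bar>x\<bar> * e j)" by (simp add: dvd_abs_iff[of _ "x * _", symmetric] abs_mult)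
  hence "G dvd nat \<bar>x\<bar> * e j" by (simp only: of_nat_dvd_iff)
  hence "k dvd nat \<bar>x\<bar>" using dvd_mult_div_gcd[OF _ G(2)] k dvd_trans by blast
  hence "int k dvd int (nat \<bar>x\<bar>)" by (simp only: of_nat_dvd_iff)
  thus ?thesis by (simp add: x_def)
qed

lemma lookup_sum_single:
  "finite A \<Longrightarrow> lookup (\<Sum>i\<in>A. single i (f i)) j = (if j \<in> A then f j else (0::nat))"
  by (simp add: lookup_sum lookup_single when_def sum.delta)

text \<open>The coefficient of the point \<open>0\<close> adjusts the degree.\<close>

lemma rel_of_int_relation:
  fixes f :: "nat \<Rightarrow> int"
  assumes "(\<Sum>i\<in>K. f i * int (e i)) = 0" "K \<subseteq> {..<N} - {z}"
  obtains u v where "rel u v"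
    "\<And>i. i \<noteq> z \<Longrightarrow> int (lookup u i) - int (lookup v i) = (if i \<in> K then f i else 0)"
    "\<And>i. i \<notin> insert z K \<Longrightarrow> lookup u i = 0 \<and> lookup v i = 0"
proof -
  have fin: "finite K" using assms(2) finite_subset by blast
  define s where "s = (\<Sum>i\<in>K. f i)"
  define u where "u = (\<Sum>i\<in>K. single i (nat (f i))) + single z (nat (- s))"
  define v where "v = (\<Sum>i\<in>K. single i (nat (- f i))) + single z (nat s)"
  have lu: "lookup u i = (if i \<in> K then nat (f i) else 0) + (if i = z then nat (- s) else 0)"
    and lv: "lookup v i = (if i \<in> K then nat (- f i) else 0) + (if i = z then nat s else 0)" for i
    using fin by (simp_all add: u_def v_def lookup_add lookup_sum_single lookup_single when_def)
  have zK: "z \<notin> K" using assms(2) by blast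
  have KN: "insert z K \<subseteq> {..<N}" using assms(2) z_less by blast
  have dd: "int (deg u) - int (deg v) = (\<Sum>i\<in>insert z K. int (lookup u i) - int (lookup v i))"
    and vv: "int (val u) - int (val v) = (\<Sum>i\<in>insert z K. (int (lookup u i) - int (lookup v i)) * int (e i))"
  proof -
    have "(\<Sum>i<N. g (lookup w i) * h i) = (\<Sum>i\<in>insert z K. g (lookup w i) * h i)"
      if "\<forall>i. i \<notin> insert z K \<longrightarrow> lookup w i = 0" "g 0 = 0" for w :: mon and g h :: "nat \<Rightarrow> int"
      by (rule sum.mono_neutral_right) (use KN that in auto)
    note * = this[where g = int and h = "\<lambda>_. 1"] this[where g = int and h = "\<lambda>i. int (e i)"]
    show "int (deg u) - int (deg v) = (\<Sum>i\<in>insert z K. int (lookup u i) - int (lookup v i))"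
      using *(1)[of u] *(1)[of v] by (simp add: deg_def lu lv sum_subtractf)
    show "int (val u) - int (val v) = (\<Sum>i\<in>insert z K. (int (lookup u i) - int (lookup v i)) * int (e i))"
      using *(2)[of u] *(2)[of v] by (simp add: val_def lu lv sum_subtractf left_diff_distrib)
  qed
  have diff: "int (lookup u i) - int (lookup v i) = (if i \<in> K then f i else 0)" if "i \<noteq> z" for i
    using that by (simp add: lu lv)
  have sK: "(\<Sum>i\<in>K. F i (int (lookup u i) - int (lookup v i))) = (\<Sum>i\<in>K. F i (f i))"
    for F :: "nat \<Rightarrow> int \<Rightarrow> int"
  proof (rule sum.cong)
    fix i assume i: "i \<in> K"
    with zK have "i \<noteq> z" by auto
    thus "F i (int (lookup u i) - int (lookup v i)) = F i (f i)" using diff[of i] i by simp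
  qed simp
  have "int (deg u) - int (deg v) = 0"
    unfolding dd using fin zK sK[of "\<lambda>_ x. x"] by (simp add: lu lv s_def)
  moreover have "int (val u) - int (val v) = 0"
    unfolding vv using fin zK sK[of "\<lambda>i x. x * int (e i)"] assms(1) by (simp add: e_z)
  moreover have "keys u \<subseteq> {..<N}" "keys v \<subseteq> {..<N}"
    using KN by (auto simp: in_keys_iff lu lv split: if_splits)
  ultimately have "rel u v" by (simp add: rel_iff)
  moreover have "lookup u i = 0 \<and> lookup v i = 0" if "i \<notin> insert z K" for i
    using that by (simp add: lu lv)
  ultimately show thesis using that[of u v] diff by blast
qed

lemma deg_one: "keys w \<subseteq> {..<N} \<Longrightarrow> deg w = 1 \<Longrightarrow> \<exists>i\<in>keys w. w = single i 1"
proof -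
  assume w: "keys w \<subseteq> {..<N}" "deg w = 1"
  then obtain j where j: "j \<in> keys w" by (metis all_not_in_conv deg_zero keys_eq_empty zero_neq_one)
  obtain v where v: "w = single j 1 + v"
    using mon_single_decomp[of 1 w j] j by (metis in_keys_iff less_one linorder_not_le)
  hence "v = 0" using w j by (intro deg_eq_0) (auto simp: keys_add_nat)
  with v j show ?thesis by auto
qed

lemma deg_two:
  assumes w: "keys w \<subseteq> {..<N}" "deg w = 2"
  shows "\<exists>i j. i < N \<and> j < N \<and> w = single i 1 + single j 1"
proof -
  obtain j where j: "j \<in> keys w" using w by (metis all_not_in_conv deg_zero keys_eq_empty zero_neq_numeral)
  obtain v where v: "w = single j 1 + v"
    using mon_single_decomp[of 1 w j] j by (metis in_keys_iff less_one linorder_not_le)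
  hence "keys v \<subseteq> {..<N}" "deg v = 1" using w j by (auto simp: keys_add_nat)
  then obtain i where "i \<in> keys v" "v = single i 1" using deg_one by blast
  thus ?thesis using v j w \<open>keys v \<subseteq> {..<N}\<close> by blast
qed

end


section \<open>Complete intersections\<close>

locale monomial_ci = monomial_curve +
  fixes m :: "nat \<Rightarrow> nat" and \<beta> :: "nat \<Rightarrow> mon"
  assumes ci: "ci m \<beta>"
begin

lemma m_ge_2: "j \<in> inner \<Longrightarrow> 2 \<le> m j"
  using ci by (simp add: ci_def)

lemma \<beta>_rel: "j \<in> inner \<Longrightarrow> rel (single j (m j)) (\<beta> j)"
  using ci by (auto simp: ci_def generates_def moves_def)

lemma \<beta>_simps:
  assumes "j \<in> inner"
  shows "keys (\<beta> j) \<subseteq> {..<N}" "deg (\<beta> j) = m j" "val (\<beta> j) = m j * e j"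
  using \<beta>_rel[OF assms] innerD[OF assms] by (auto simp: rel_iff)

lemma exit_step:
  assumes "rel u v" "u \<in> Y" "v \<notin> Y"
  obtains j w where "j \<in> inner" "single j (m j) + w \<in> Y" "\<beta> j + w \<notin> Y"
  | j w where "j \<in> inner" "\<beta> j + w \<in> Y" "single j (m j) + w \<notin> Y"
proof -
  have "conn (moves m \<beta>) u v" using ci assms(1) by (simp add: ci_def generates_def)
  then obtain y y' where "mstep (moves m \<beta>) y y'" "y \<in> Y" "y' \<notin> Y"
    using conn_exit assms(2,3) by metis
  thus thesis using that unfolding mstep_def moves_def by auto
qed

lemma first_move:
  assumes "rel u v" "u \<noteq> v"
  obtains j w where "j \<in> inner" "u = single j (m j) + w"
  | j w where "j \<in> inner" "u = \<beta> j + w"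
  using exit_step[of u v "{u}"] assms by (metis singletonD singletonI)

text \<open>Otherwise the monomials without the variables leading to \<open>C\<close> form a union of connected
  components, although a power of each inner variable is connected to a monomial in the extremal
  variables.\<close>

lemma acyclic:
  assumes C: "C \<subseteq> inner" "C \<noteq> {}"
  shows "\<exists>i\<in>C. keys (\<beta> i) \<inter> C = {}"
proof (rule ccontr)
  assume "\<not> ?thesis"
  hence cyc: "keys (\<beta> i) \<inter> C \<noteq> {}" if "i \<in> C" for i using that by blast
  define E where "E = {(i, j). i \<in> inner \<and> j \<in> inner \<and> j \<in> keys (\<beta> i)}"
  \<comment> \<open>All inner variables from which \<open>C\<close> can be reached. By cyclicity,
    \<open>i\<close> is one of them exactly if \<open>\<beta> i\<close> contains one, so every move
    preserves their absence.\<close>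
  define C' where "C' = {i \<in> inner. \<exists>c\<in>C. (i, c) \<in> E\<^sup>*}"
  have C'_iff: "i \<in> C' \<longleftrightarrow> keys (\<beta> i) \<inter> C' \<noteq> {}" if i: "i \<in> inner" for i
  proof
    assume "i \<in> C'"
    then obtain c where c: "c \<in> C" "(i, c) \<in> E\<^sup>*" by (auto simp: C'_def)
    have "C \<subseteq> C'" using C by (auto simp: C'_def)
    from c(2) show "keys (\<beta> i) \<inter> C' \<noteq> {}"
    proof (cases rule: converse_rtranclE)
      case base
      with c cyc \<open>C \<subseteq> C'\<close> show ?thesis by blast
    next
      case (step k)
      with c show ?thesis by (auto simp: E_def C'_def)
    qed
  next
    assume "keys (\<beta> i) \<inter> C' \<noteq> {}"
    then obtain k c where "k \<in> keys (\<beta> i)" "k \<in> inner" "c \<in> C" "(k, c) \<in> E\<^sup>*" by (auto simp: C'_def)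
    moreover from this i have "(i, k) \<in> E" by (simp add: E_def)
    ultimately show "i \<in> C'" using i by (auto simp: C'_def intro: converse_rtrancl_into_rtrancl)
  qed
  obtain i0 where i0: "i0 \<in> C" using C by blast
  hence i0': "i0 \<in> C'" "i0 \<in> inner" using C by (auto simp: C'_def)
  let ?u = "single z (e t - e i0) + single t (e i0)" and ?v = "single i0 (e t)"
  have "rel ?u ?v" using rel_extreme[OF i0'(2)] by (rule tor_sym)
  moreover have "?u \<in> {u. keys u \<inter> C' = {}}" by (auto simp: keys_add_nat C'_def inner_def split: if_splits)
  moreover have "?v \<notin> {u. keys u \<inter> C' = {}}" using i0' e_t_pos by auto
  ultimately show False
  proof (cases rule: exit_step)
    case (1 j w)
    thus False using C'_iff[of j] m_ge_2[of j] by (auto simp: keys_add_nat)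
  next
    case (2 j w)
    thus False using C'_iff[of j] by (auto simp: keys_add_nat split: if_splits)
  qed
qed

lemma \<beta>_self: "j \<in> inner \<Longrightarrow> lookup (\<beta> j) j = 0"
  using acyclic[of "{j}"] by (auto simp: in_keys_iff)

lemma no_two_cycle: "i \<in> inner \<Longrightarrow> j \<in> inner \<Longrightarrow> i \<in> keys (\<beta> j) \<Longrightarrow> j \<notin> keys (\<beta> i)"
  using acyclic[of "{i, j}"] by auto

text \<open>Each move has degree at least 2, so the cofactor \<open>w\<close> is trivial in a fibre
  of degree 2.\<close>

lemma degree_two_member:
  assumes "rel u v" "u \<noteq> v" "deg u = 2"
  shows "\<exists>j\<in>inner. m j = 2 \<and> (u = single j 2 \<or> u = \<beta> j)"
  using assms(1,2)
proof (cases rule: first_move)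
  case (1 j w)
  have "keys w \<subseteq> {..<N}" using 1 assms(1) by (auto simp: rel_iff keys_add_nat)
  moreover have "m j + deg w = 2" using 1 assms(3) innerD[of j] by simp
  moreover have "2 \<le> m j" using 1 m_ge_2 by simp
  ultimately have "w = 0 \<and> m j = 2" using deg_eq_0[of w] by simp
  thus ?thesis using 1 by auto
next
  case (2 j w)
  have "keys w \<subseteq> {..<N}" using 2 assms(1) by (auto simp: rel_iff keys_add_nat)
  moreover have "m j + deg w = 2" using 2 assms(3) \<beta>_simps[of j] by simp
  moreover have "2 \<le> m j" using 2 m_ge_2 by simp
  ultimately have "w = 0 \<and> m j = 2" using deg_eq_0[of w] by simp
  thus ?thesis using 2 by auto
qed

text \<open>Both members belong to generators of this fibre, and the fibre contains only one pure
  power of an inner variable; hence the two generators coincide.\<close>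

lemma degree_two_fibre:
  assumes "rel u v" "u \<noteq> v" "deg u = 2"
  obtains j where "j \<in> inner" "m j = 2" "u = single j 2" "v = \<beta> j"
  | j where "j \<in> inner" "m j = 2" "v = single j 2" "u = \<beta> j"
proof -
  obtain j where j: "j \<in> inner" "m j = 2" "u = single j 2 \<or> u = \<beta> j"
    using degree_two_member[OF assms] by blast
  have "deg v = 2" using assms by (simp add: rel_iff)
  then obtain l where l: "l \<in> inner" "m l = 2" "v = single l 2 \<or> v = \<beta> l"
    using degree_two_member[OF tor_sym[OF assms(1)]] assms(2) by metis
  have "rel (single j 2) (single l 2)"
    using \<beta>_rel[OF j(1)] \<beta>_rel[OF l(1)] assms(1) j l by (metis tor_sym tor_trans)
  hence "single j (2::nat) = single l 2" using rel_single_single innerD j(1) l(1) by blast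
  hence "lookup (single j (2::nat)) l = lookup (single l 2) l" by simp
  hence "j = l" by (simp add: lookup_single when_def split: if_splits)
  with j l assms(2) that show thesis by metis
qed

text \<open>One side of a quadratic generator is a square, but neither \<open>x_b x_c\<close> nor
  \<open>x_a x_f\<close> is.\<close>

lemma no_square_free_quadric:
  assumes "a < N" "b < N" "c < N" "f < N" "b \<noteq> c" "a \<noteq> f" "a \<noteq> b" "a \<noteq> c"
  shows "e b + e c \<noteq> e a + e f"
proof
  assume eq: "e b + e c = e a + e f"
  let ?u = "single b 1 + single c (1::nat)" and ?v = "single a 1 + single f (1::nat)"
  have ns: "single i 1 + single k 1 \<noteq> single j (2::nat)" if "i \<noteq> k" for i j k :: nat
  proof
    assume *: "single i 1 + single k 1 = single j (2::nat)"
    have "lookup (single i 1 + single k 1) i = lookup (single j (2::nat)) i"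
      unfolding * ..
    thus False using that by (auto simp: lookup_simps split: if_splits)
  qed
  have "rel ?u ?v" using assms eq by (auto simp: rel_iff keys_add_nat split: if_splits)
  moreover have "?u \<noteq> ?v"
  proof
    assume *: "?u = ?v"
    have "lookup ?u a = lookup ?v a" unfolding * ..
    thus False using assms by (auto simp: lookup_simps)
  qed
  moreover have "deg ?u = 2" using assms by simp
  ultimately show False
    by (cases rule: degree_two_fibre) (use ns assms(5,6) in blast)+
qed

text \<open>\<open>x_b ^ 2\<close> and \<open>x_a x_c\<close> share a quadratic fibre, and only the
  former is a square.\<close>

lemma midpoint_quadric:
  assumes "b \<in> inner" "a < N" "c < N" "a \<noteq> c" "e a + e c = 2 * e b"
  shows "m b = 2" "\<beta> b = single a 1 + single c 1"
proof -
  let ?v = "single a 1 + single c (1::nat)"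
  have ns: "?v \<noteq> single j 2" for j
  proof
    assume *: "?v = single j 2"
    have "lookup ?v a = lookup (single j 2) a" unfolding * ..
    thus False using assms(4) by (auto simp: lookup_simps split: if_splits)
  qed
  have "rel (single b 2) ?v" using assms innerD[OF assms(1)] by (auto simp: rel_iff keys_add_nat split: if_splits)
  moreover have "single b 2 \<noteq> ?v" using ns by metis
  moreover have "deg (single b 2) = 2" using innerD[OF assms(1)] by simp
  ultimately have "m b = 2 \<and> \<beta> b = ?v"
  proof (cases rule: degree_two_fibre)
    case (1 j)
    have "lookup (single b (2::nat)) b = lookup (single j 2) b" using 1 by simp
    hence "j = b" by (simp add: lookup_single when_def split: if_splits)
    with 1 show ?thesis by simp
  qed (use ns in blast)
  thus "m b = 2" "\<beta> b = ?v" by auto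
qed

text \<open>Serves to extract divisibility conditions: \<open>W\<close> will be a linear form in the
  exponents, and \<open>u\<close>, \<open>v\<close> come from \<open>rel_of_int_relation\<close>,
  which realises a chosen integer relation.\<close>

lemma weight_invariant:
  fixes W :: "mon \<Rightarrow> int"
  assumes add: "\<And>u v. W (u + v) = W u + W v"
    and inv: "\<And>j. j \<in> inner \<Longrightarrow> M dvd W (single j (m j)) - W (\<beta> j)"
    and uv: "rel u v"
  shows "M dvd W u - W v"
proof -
  have "conn (moves m \<beta>) u v" using ci uv by (simp add: ci_def generates_def)
  thus ?thesis
  proof (induction rule: rtranclp_induct)
    case (step y y')
    from step(2) obtain j w where j: "j \<in> inner"
      "(y = single j (m j) + w \<and> y' = \<beta> j + w) \<or> (y' = single j (m j) + w \<and> y = \<beta> j + w)"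
      unfolding mstep_def moves_def by auto
    have "M dvd W y - W y'"
      using inv[OF j(1)] j(2) by (auto simp: add dvd_diff_commute)
    from dvd_add[OF step(3) this] show ?case by simp
  qed simp
qed

end

text \<open>Here \<open>A = e a\<close>, \<open>B = e b\<close>, and \<open>p\<close>,
  \<open>q\<close> are the exponents of \<open>b\<close> and \<open>z\<close> in
  \<open>\<beta> a\<close>. For \<open>p > 0\<close> the equation and \<open>h * A < B\<close> force
  \<open>p + q > p * h\<close>, while the bounds on \<open>p\<close> and \<open>q\<close> give
  \<open>p + q \<le> p * h\<close>.\<close>

lemma gap_arith:
  fixes p q A B h :: nat
  assumes "(p + q) * A = p * B" "p \<le> 2" "q \<le> h - 1" "h * A < B" "2 \<le> p + q" "0 < A" "2 \<le> h"
  shows False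
proof -
  have "p = 0 \<or> p = 1 \<or> p = 2" using assms(2) by auto
  thus False
  proof (elim disjE)
    assume "p = 0" thus False using assms by simp
  next
    assume p: "p = 1"
    hence "(p + q) * A \<le> h * A" using assms(3,7) by (intro mult_le_mono1) simp
    thus False using assms(1,4) p by simp
  next
    assume p: "p = 2"
    hence "(p + q) * A \<le> (2 * h) * A" using assms(3,7) by (intro mult_le_mono1) simp
    thus False using assms(1,4) p by simp
  qed
qed

context monomial_ci
begin

text \<open>The monomial \<open>x\<^sub>a ^ h x\<^sub>c\<close> is connected to \<open>x\<^sub>b ^ 2 x\<^sub>z ^ (h - 1)\<close>; consider the move that leaves the set
  of all \<open>w x\<^sub>c\<close>, where \<open>w\<close> has the weight of \<open>x\<^sub>a ^ h\<close>.\<close>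

lemma gap_exit:
  assumes idx: "a < N" "b < N" "c < N" "x < N" and h: "2 \<le> h" and ea: "0 < e a"
    and S: "h * e a + e c = 2 * e b" "h * e a < e b"
    and low: "\<And>j. j < N \<Longrightarrow> j \<notin> {z, a, x} \<Longrightarrow> e b \<le> e j"
    and ex: "e x \<noteq> h * e a" and xbc: "x \<noteq> b" "x \<noteq> c"
  shows "b \<in> inner" "m b = 2" "x \<in> inner" "c \<in> keys (\<beta> x)"
proof -
  have ebc: "e b < e c" using S by linarith
  have eah: "2 * e a \<le> h * e a" using h by simp
  have ab: "e a < e b" using eah ea S(2) by linarith
  have cn: "c \<notin> {z, a, x}" using ab ebc e_z xbc by auto
  have zb: "z \<noteq> b" "z \<noteq> c" using ab ebc e_z by auto
  show b_inner: "b \<in> inner" using zb e_le[OF idx(3)] ebc idx(2) by (auto simp: inner_def)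
  let ?u = "single a h + single c 1" and ?v = "single b 2 + single z (h - 1)"
  have uv: "rel ?u ?v"
    using idx z_less S h e_z by (auto simp: rel_iff keys_add_nat split: if_splits)
  \<comment> \<open>A monomial of value \<open>h * e a\<close>, which is below \<open>e b\<close>,
    involves only \<open>z\<close>, \<open>a\<close>, \<open>x\<close> by \<open>low\<close>; so
    \<open>w\<close> runs through the full fibre of \<open>x_a ^ h\<close>.\<close>
  define Y where "Y = {w + single c 1 | w. keys w \<subseteq> {z, a, x} \<and> val w = h * e a \<and> deg w = h}"
  have YI: "w + single c 1 \<in> Y" if "keys w \<subseteq> {z, a, x}" "val w = h * e a" "deg w = h" for w
    using that unfolding Y_def by blast
  have uY: "?u \<in> Y" by (rule YI) (use idx in auto)
  have vY: "?v \<notin> Y"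
  proof
    assume "?v \<in> Y"
    then obtain w where "?v = w + single c 1" by (auto simp: Y_def)
    hence "lookup ?v c = lookup (w + single c 1) c" by simp
    thus False using zb ebc by (simp add: lookup_simps split: if_splits)
  qed
  have val_small: "keys w \<subseteq> {z, a, x}" if "keys w \<subseteq> {..<N}" "val w < e b" for w
  proof
    fix i assume i: "i \<in> keys w"
    hence "i < N" using that(1) by auto
    moreover have "e i \<le> lookup w i * e i" using i by (simp add: in_keys_iff)
    moreover have "lookup w i * e i \<le> val w" using \<open>i < N\<close> by (rule val_ge)
    ultimately have "\<not> e b \<le> e i" using that(2) by linarith
    thus "i \<in> {z, a, x}" using low[of i] \<open>i < N\<close> by blast
  qed
  have "x \<in> inner \<and> c \<in> keys (\<beta> x)"
    using uv uY vY
  proof (cases rule: exit_step)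
    \<comment> \<open>The variable \<open>c\<close> occurs only once and \<open>m j \<ge> 2\<close>,
      so the pure power divides \<open>w\<close> and the move stays in \<open>Y\<close>.\<close>
    case (1 j w0)
    then obtain w where w: "single j (m j) + w0 = w + single c 1"
      "keys w \<subseteq> {z, a, x}" "val w = h * e a" "deg w = h" by (auto simp: Y_def)
    have jN: "j < N" and mj: "2 \<le> m j" using 1 innerD m_ge_2 by auto
    have wc: "lookup w c = 0" using w(2) cn by (meson in_keys_iff subsetD)
    have lj: "m j + lookup w0 j = lookup w j + (if j = c then 1 else 0)"
      using arg_cong[OF w(1), of "\<lambda>f. lookup f j"] by (simp add: lookup_simps)
    hence jc: "j \<noteq> c" using wc mj by auto
    with lj have "m j \<le> lookup w j" by simp
    then obtain w1 where w1: "w = single j (m j) + w1" by (metis mon_single_decomp)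
    hence w0: "w0 = w1 + single c 1" using w(1) by (simp add: add.assoc)
    have "m j * e j \<le> h * e a" using w(3) w1 jN by simp
    hence "keys (\<beta> j) \<subseteq> {z, a, x}"
      using \<beta>_simps[OF 1(1)] S(2) by (intro val_small) auto
    hence "(\<beta> j + w1) + single c 1 \<in> Y"
      using w w1 \<beta>_simps[OF 1(1)] jN by (intro YI) (auto simp: keys_add_nat)
    thus ?thesis using 1(3) w0 by (simp add: add.assoc)
  next
    case (2 j w0)
    then obtain w where w: "\<beta> j + w0 = w + single c 1"
      "keys w \<subseteq> {z, a, x}" "val w = h * e a" "deg w = h" by (auto simp: Y_def)
    have jN: "j < N" "j \<noteq> z" and mj: "2 \<le> m j" using 2 innerD m_ge_2 by auto
    have wc: "lookup w c = 0" using w(2) cn by (meson in_keys_iff subsetD)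
    have lc: "lookup (\<beta> j) c + lookup w0 c = 1"
      using arg_cong[OF w(1), of "\<lambda>f. lookup f c"] wc by (simp add: lookup_simps)
    show ?thesis
    proof (cases "lookup (\<beta> j) c = 0")
      \<comment> \<open>With \<open>c\<close> in the cofactor, the move acts on \<open>w\<close>
        alone and stays in \<open>Y\<close>.\<close>
      case True
      hence "1 \<le> lookup w0 c" using lc by simp
      then obtain w1 where w1: "w0 = single c 1 + w1" by (metis mon_single_decomp)
      have "(\<beta> j + w1) + single c 1 = w + single c 1" using w(1) w1 by (simp add: add_ac)
      hence w': "w = \<beta> j + w1" by simp
      have "m j * e j \<le> h * e a" using w(3) w' \<beta>_simps[OF 2(1)] by simp
      moreover have "e j \<le> m j * e j" using mj by simp
      ultimately have "\<not> e b \<le> e j" using S(2) by linarith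
      hence "j \<in> {z, a, x}" using low[of j] jN by blast
      hence "(single j (m j) + w1) + single c 1 \<in> Y"
        using w w' \<beta>_simps[OF 2(1)] jN by (intro YI) (auto simp: keys_add_nat split: if_splits)
      moreover have "(single j (m j) + w1) + single c 1 = single j (m j) + w0"
        unfolding w1 by (simp add: add_ac)
      ultimately show ?thesis using 2(3) by simp
    next
      case False
      hence "1 \<le> lookup (\<beta> j) c" by simp
      then obtain w' where w': "\<beta> j = single c 1 + w'" by (metis mon_single_decomp)
      have "(w' + w0) + single c 1 = w + single c 1" using w(1) w' by (simp add: add_ac)
      hence ww: "w = w' + w0" by simp
      have kw': "keys w' \<subseteq> {z, a, x}" "keys w' \<subseteq> {..<N}" "keys w0 \<subseteq> {..<N}"
        using w(2) ww idx z_less by (auto simp: keys_add_nat)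
      have deg: "m j = 1 + deg w'" and val: "m j * e j = e c + val w'"
        using \<beta>_simps[OF 2(1)] w' idx by simp_all
      have le: "deg w' \<le> h" "val w' \<le> h * e a" using w(3,4) ww by simp_all
      \<comment> \<open>For \<open>j = a\<close>, degree and value force \<open>e a = e c\<close>.
        For the others \<open>e b \<le> e j\<close> forces \<open>e j = e b\<close> and
        \<open>m j = 2\<close>, which leaves a single variable of value \<open>h * e a\<close>; this
        is what \<open>ex\<close> forbids.\<close>
      have "j = x"
      proof (rule ccontr)
        assume jx: "j \<noteq> x"
        show False
        proof (cases "j = a")
          case True
          have "m j * e a = e c + val w'" using val True by simp
          hence "h * e a < m j * e a" using S ebc by linarith
          hence "h < m j" by (rule mult_less_cancel2[THEN iffD1, THEN conjunct2])
          hence "m j = h + 1" "deg w' = h" using deg le by auto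
          hence "deg w0 = 0" using w(4) ww by simp
          hence "w0 = 0" using kw'(3) deg_eq_0 by blast
          hence "(h + 1) * e a = e c + h * e a" using val w(3) ww True \<open>m j = h + 1\<close> by simp
          hence "e a = e c" by simp
          thus False using ab ebc by simp
        next
          case False
          hence bj: "e b \<le> e j" using low[of j] jN jx by blast
          have "2 * e j \<le> m j * e j" using mj by simp
          moreover have up: "m j * e j \<le> 2 * e b" using val le(2) S(1) by linarith
          ultimately have "e j = e b" using bj by linarith
          have "m j = 2"
          proof (rule ccontr)
            assume "m j \<noteq> 2"
            hence "3 * e b \<le> m j * e j" using mj \<open>e j = e b\<close> by simp
            thus False using up ab by linarith
          qed
          hence "val w' = h * e a" "deg w' = 1" using val deg \<open>e j = e b\<close> S(1) by auto
          then obtain i where i: "i \<in> keys w'" "w' = single i 1" using deg_one kw'(2) by blast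
          hence "e i = h * e a" using \<open>val w' = h * e a\<close> kw'(2) by auto
          moreover have "i \<in> {z, a, x}" using i kw'(1) by blast
          ultimately show False using ex e_z ea h eah by auto
        qed
      qed
      thus ?thesis using 2(1) False by (auto simp: in_keys_iff)
    qed
  qed
  thus "x \<in> inner" and cx: "c \<in> keys (\<beta> x)" by auto
  \<comment> \<open>The first move at \<open>x_b ^ 2 x_z ^ (h - 1)\<close> uses either the pure
    power of \<open>b\<close> or some \<open>\<beta> j\<close> dividing it; the latter is excluded
    by comparing values.\<close>
  have "?v \<noteq> ?u" using uY vY by metis
  from tor_sym[OF uv] this show "m b = 2"
  proof (cases rule: first_move)
    case (1 j w)
    have "m j \<le> lookup ?v j" using arg_cong[OF 1(2), of "\<lambda>f. lookup f j"] by (simp add: lookup_add)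
    thus ?thesis using m_ge_2[OF 1(1)] innerD[OF 1(1)]
      by (auto simp: lookup_simps split: if_splits)
  next
    case (2 j w)
    note bj = \<beta>_simps[OF 2(1)]
    have le: "lookup (\<beta> j) i \<le> lookup ?v i" for i using 2(2) by (simp add: lookup_add)
    have k: "lookup (\<beta> j) i = 0" if "i \<notin> {b, z}" for i
      using le[of i] that by (auto simp: lookup_simps)
    define p where "p = lookup (\<beta> j) b"
    define q where "q = lookup (\<beta> j) z"
    have \<beta>: "\<beta> j = single b p + single z q"
      using k zb by (intro poly_mapping_eqI) (auto simp: p_def q_def lookup_simps)
    have pq: "p \<le> 2" "q \<le> h - 1"
      using le[of b] le[of z] zb by (auto simp: p_def q_def lookup_simps)
    have mj: "p + q = m j" "p * e b = m j * e j" using bj \<beta> idx z_less e_z by simp_all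
    have "c \<noteq> b" using ebc by auto
    hence "j \<noteq> x" using k[of c] cx zb by (auto simp: in_keys_iff)
    have False
    proof (cases "j = a")
      case True
      have "(p + q) * e a = p * e b" using mj True by simp
      thus False by (rule gap_arith[OF _ pq S(2) _ ea h]) (use mj m_ge_2[OF 2(1)] in simp)
    next
      case False
      hence "e b \<le> e j" using low[of j] innerD[OF 2(1)] \<open>j \<noteq> x\<close> by blast
      moreover have "j \<noteq> b"
      proof
        assume "j = b"
        hence "p = 0" using \<beta>_self[OF 2(1)] by (simp add: p_def)
        thus False using mj m_ge_2[OF 2(1)] innerD[OF 2(1)] by simp
      qed
      ultimately have "e b < e j" using e_eqD[of b j] innerD[OF 2(1)] idx(2) by (auto simp: le_less)
      hence "m j * e b < m j * e j" using m_ge_2[OF 2(1)] by simp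
      moreover have "p * e b \<le> m j * e b" using mj(1) by (intro mult_le_mono1) simp
      ultimately show False using mj(2) by simp
    qed
    thus ?thesis ..
  qed
qed

text \<open>By \<open>gap_exit\<close>, \<open>x_b ^ 2\<close> belongs to a quadratic generator and
  \<open>x\<close> is inner. But \<open>2 * e b = h * e a + e c\<close> with \<open>e c\<close> the
  maximum, and no two points other than \<open>b\<close> have this sum.\<close>

lemma not_ci_four:
  assumes N: "{..<N} = {z, a, b, c, x}" and h: "2 \<le> h" and ea: "0 < e a"
    and S: "h * e a + e c = 2 * e b" "h * e a < e b"
    and ex: "e x \<noteq> h * e a" and xbc: "x \<noteq> b" "x \<noteq> c"
  shows False
proof -
  have idx: "a < N" "b < N" "c < N" "x < N" using N by auto
  have ebc: "e b < e c" using S by linarith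
  have eah: "2 * e a \<le> h * e a" using h by simp
  have low: "e b \<le> e j" if "j < N" "j \<notin> {z, a, x}" for j
    using that N ebc by (metis insertE le_refl less_imp_le lessThan_iff singletonD insertI1 insertI2)
  note X = gap_exit[OF idx h ea S low ex xbc]
  have "t \<in> {z, a, b, c, x}" using t_less N by auto
  moreover have "e a < e c" using eah ea ebc S(2) by linarith
  ultimately have "t = c" using z_neq_t innerD[OF X(1)] innerD[OF X(3)] e_le[OF idx(3)] ebc by auto
  hence xc: "e x < e c" using innerD[OF X(3)] by simp
  note bb = \<beta>_simps[OF X(1)]
  obtain i k where ik: "i < N" "k < N" "\<beta> b = single i 1 + single k 1"
    using deg_two[OF bb(1)] bb(2) X(2) by metis
  have sum: "e i + e k = 2 * e b" using bb(3) X(2) ik by simp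
  have nb: "i \<noteq> b" "k \<noteq> b"
    using \<beta>_self[OF X(1)] ik(3) by (auto simp: lookup_simps split: if_splits)
  have "i \<in> {z, a, c, x}" "k \<in> {z, a, c, x}" using ik nb N by auto
  moreover have "e x \<noteq> e b" using e_eqD[of x b] idx xbc by auto
  moreover define s where "s = h * e a"
  have "s + e c = 2 * e b" "s < e b" "e x \<noteq> s" "2 * e a \<le> s"
    unfolding s_def using S ex eah by blast+
  ultimately show False using sum xc ea ebc e_z by auto
qed

text \<open>The quadrics \<open>\<beta> c = x_b x_f\<close> and \<open>\<beta> b = x_f x_k\<close>
  exist here but do not suffice: \<open>x_b ^ 2 x_z ^ (h - 1)\<close> is connected only to
  \<open>x_f x_k x_z ^ (h - 1)\<close>, not to \<open>x_a ^ h x_c\<close>.\<close>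

lemma not_ci_five:
  assumes N: "{..<N} = {z, a, b, c, f, x}" and h: "2 \<le> h" and ea: "0 < e a" and r: "0 < r"
    and ee: "e b = h * e a + r" "e c = h * e a + 2 * r" "e f = h * e a + 3 * r"
    and ex: "e x \<noteq> h * e a" and xn: "x \<noteq> b" "x \<noteq> c" "x \<noteq> f"
  shows False
proof -
  have idx: "a < N" "b < N" "c < N" "f < N" "x < N" using N by auto
  have eah: "2 * e a \<le> h * e a" using h by simp
  have S: "h * e a + e c = 2 * e b" "h * e a < e b" using ee r by simp_all
  have low: "e b \<le> e j" if "j < N" "j \<notin> {z, a, x}" for j
  proof -
    have "j \<in> {b, c, f}" using that N by blast
    thus ?thesis using ee by auto
  qed
  note X = gap_exit[OF idx(1,2,3,5) h ea S low ex xn(1,2)]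
  have "t \<in> {z, a, b, c, f, x}" using t_less N by auto
  moreover have "e a < e f" "e c < e f" using eah ea ee r by linarith+
  ultimately have tf: "t = f"
    using z_neq_t innerD[OF X(1)] innerD[OF X(3)] e_le[OF idx(4)] by auto
  have "e c \<noteq> e z" "e c \<noteq> e t" using tf ee r e_z by simp_all
  hence c_inner: "c \<in> inner" using idx unfolding inner_def by blast
  have bf: "b \<noteq> f" "b \<noteq> c" "c \<noteq> f" "z \<noteq> f" "a \<noteq> f" "a \<noteq> z" "a \<noteq> b" "z \<noteq> b" "z \<noteq> c" "a \<noteq> c"
    and ord: "e a < e b" "e b < e f"
  proof -
    show *: "e a < e b" "e b < e f" using ee r ea eah by linarith+
    have "e b < e c" "e c < e f" "e z < e a" using ee r ea e_z by linarith+
    with * show "b \<noteq> f" "b \<noteq> c" "c \<noteq> f" "z \<noteq> f" "a \<noteq> f" "a \<noteq> z" "a \<noteq> b" "z \<noteq> b" "z \<noteq> c" "a \<noteq> c"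
      by auto
  qed
  have \<beta>c: "\<beta> c = single b 1 + single f 1" by (rule midpoint_quadric[OF c_inner idx(2,4) bf(1)]) (simp add: ee)
  \<comment> \<open>\<open>x\<close> leads to \<open>c\<close> and \<open>c\<close> leads to
    \<open>b\<close>, so \<open>b\<close> is the member that \<open>acyclic\<close>
    provides.\<close>
  have "keys (\<beta> b) \<inter> {b, c, x} = {}"
  proof -
    have "b \<in> keys (\<beta> c)" using \<beta>c by (simp add: keys_add_nat)
    thus ?thesis using acyclic[of "{b, c, x}"] X c_inner by auto
  qed
  hence kb: "keys (\<beta> b) \<subseteq> {z, a, f}" using \<beta>_simps(1)[OF X(1)] N by blast
  note bb = \<beta>_simps[OF X(1)]
  \<comment> \<open>Among \<open>z\<close>, \<open>a\<close>, \<open>f\<close> a pair of sum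
    \<open>2 * e b\<close> contains \<open>f\<close> exactly once, because
    \<open>e a < e b < e f\<close>.\<close>
  obtain k where k: "k \<in> {z, a}" "\<beta> b = single f 1 + single k 1"
  proof -
    obtain i k where ik: "i < N" "k < N" "\<beta> b = single i 1 + single k 1"
      using deg_two[OF bb(1)] bb(2) X(2) by metis
    have sum: "e i + e k = 2 * e b" using bb(3) X(2) ik by simp
    have "i \<in> {z, a, f}" "k \<in> {z, a, f}" using kb ik(3) by (auto simp: keys_add_nat)
    hence "(i = f \<and> k \<in> {z, a}) \<or> (k = f \<and> i \<in> {z, a})" using sum ord e_z by auto
    thus thesis using that ik(3) by (metis add.commute)
  qed
  have ek: "e f + e k = 2 * e b" using bb(3) X(2) k idx z_less by auto
  let ?v = "single b 2 + single z (h - 1)"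
  let ?v' = "single f 1 + single k 1 + single z (h - 1)"
  let ?u = "single a h + single c 1"
  define Y where "Y = {?v, ?v'}"
  have uv: "rel ?v ?u"
    using idx z_less S h e_z by (auto simp: rel_iff keys_add_nat split: if_splits)
  have vY: "?v \<in> Y" by (simp add: Y_def)
  have uY: "?u \<notin> Y"
  proof
    assume "?u \<in> Y"
    hence "lookup ?u c = lookup ?v c \<or> lookup ?u c = lookup ?v' c" unfolding Y_def by auto
    thus False using bf k(1) by (auto simp: lookup_simps)
  qed
  \<comment> \<open>\<open>\<beta> a\<close> divides neither monomial of \<open>Y\<close>: too few
    factors \<open>z\<close> are available, given that \<open>e b\<close> and \<open>e f\<close>
    exceed \<open>h * e a\<close>.\<close>
  have not_a: False if "a \<in> inner" and le: "\<And>i. lookup (\<beta> a) i \<le> lookup w i" and w: "w \<in> Y" for w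
  proof -
    note aa = \<beta>_simps[OF that(1)] and ma = m_ge_2[OF that(1)]
    from w consider "w = ?v" | "w = ?v'" by (auto simp: Y_def)
    thus False
    proof cases
      case 1
      define p where "p = lookup (\<beta> a) b"
      define q where "q = lookup (\<beta> a) z"
      have "lookup (\<beta> a) i = 0" if "i \<notin> {b, z}" for i
        using le[of i] that 1 by (auto simp: lookup_simps)
      hence \<beta>: "\<beta> a = single b p + single z q"
        using bf by (intro poly_mapping_eqI) (auto simp: p_def q_def lookup_simps)
      have pq: "p \<le> 2" "q \<le> h - 1"
        using le[of b] le[of z] bf 1 by (auto simp: p_def q_def lookup_simps)
      have mj: "p + q = m a" "p * e b = m a * e a" using aa \<beta> idx z_less e_z by simp_all
      have "(p + q) * e a = p * e b" using mj by simp
      thus False by (rule gap_arith[OF _ pq S(2) _ ea h]) (use mj ma in simp)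
    next
      case 2
      define p where "p = lookup (\<beta> a) f"
      define q where "q = lookup (\<beta> a) z"
      have "lookup (\<beta> a) i = 0" if "i \<notin> {f, z}" for i
        using le[of i] that 2 k(1) \<beta>_self[OF \<open>a \<in> inner\<close>]
        by (auto simp: lookup_simps split: if_splits)
      hence \<beta>: "\<beta> a = single f p + single z q"
        using bf by (intro poly_mapping_eqI) (auto simp: p_def q_def lookup_simps)
      have mj: "p + q = m a" "p * e f = m a * e a" using aa \<beta> idx z_less e_z by simp_all
      have p: "p \<le> 1" and q: "q \<le> h - 1 + of_bool (k = z)"
        using le[of f] le[of z] 2 k(1) bf by (auto simp: p_def q_def lookup_simps split: if_splits)
      have "p \<noteq> 0" using mj ma ea by (intro notI) simp
      hence "p = 1" using p by simp
      hence eq: "e f = (1 + q) * e a" using mj by simp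
      show False
      proof (cases "k = z")
        case True
        hence "(1 + q) * e a \<le> (h + 1) * e a" using q h by (intro mult_le_mono1) simp
        moreover have "r = h * e a" using ek True e_z ee by simp
        moreover have "(h + 1) * e a = h * e a + e a" by simp
        ultimately show False using eq ee(3) eah ea by linarith
      next
        case False
        hence "(1 + q) * e a \<le> h * e a" using q h by (intro mult_le_mono1) simp
        thus False using eq ee(3) r by simp
      qed
    qed
  qed
  have inner: "j \<in> {a, b, c, x}" if "j \<in> inner" for j
    using that N innerD[OF that] tf by (auto simp: inner_def)
  from uv vY uY show False
  proof (cases rule: exit_step)
    case (1 j w)
    have mj: "2 \<le> m j" "j \<noteq> z" "j \<noteq> f" using m_ge_2[OF 1(1)] innerD[OF 1(1)] tf by auto
    from 1(2) consider "single j (m j) + w = ?v" | "single j (m j) + w = ?v'" unfolding Y_def by blast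
    thus False
    proof cases
      case A: 1
      have "m j \<le> lookup ?v j" using arg_cong[OF A, of "\<lambda>f. lookup f j"] by (simp add: lookup_add)
      hence "j = b" using mj by (auto simp: lookup_simps split: if_splits)
      hence "w = single z (h - 1)" using A X(2) by simp
      hence "\<beta> j + w \<in> Y" using k(2) \<open>j = b\<close> by (simp add: Y_def)
      thus False using 1(3) by simp
    next
      case A: 2
      have "m j \<le> lookup ?v' j" using arg_cong[OF A, of "\<lambda>f. lookup f j"] by (simp add: lookup_add)
      thus False using mj by (auto simp: lookup_simps split: if_splits)
    qed
  next
    case (2 j w)
    have le: "lookup (\<beta> j) i \<le> lookup (\<beta> j + w) i" for i by (simp add: lookup_add)
    have vc: "lookup v c = 0" if "v \<in> Y" for v
      using that bf k(1) by (auto simp: Y_def lookup_simps)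
    from inner[OF 2(1)] consider "j = a" | "j = b" | "j = c" | "j = x" by blast
    thus False
    proof cases
      case 1
      thus False using not_a[OF _ _ 2(2)] 2(1) le by blast
    next
      case A: 2
      have "lookup (\<beta> j) f = 1" using k A bf by (auto simp: lookup_simps)
      hence "1 \<le> lookup (\<beta> j + w) f" using le[of f] by simp
      moreover have "lookup ?v f = 0" using bf by (simp add: lookup_simps)
      ultimately have "\<beta> j + w \<noteq> ?v" by (metis not_one_le_zero)
      hence "\<beta> j + w = ?v'" using 2(2) by (simp add: Y_def)
      hence "w = single z (h - 1)" using A k(2) by (simp add: add.assoc)
      hence "single j (m j) + w \<in> Y" using A X(2) by (simp add: Y_def)
      thus False using 2(3) by simp
    next
      case A: 3
      have "1 \<le> lookup (\<beta> j + w) f" "1 \<le> lookup (\<beta> j + w) b"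
        using le[of f] le[of b] \<beta>c A bf by (simp_all add: lookup_simps split: if_splits)
      moreover have "lookup y f = 0 \<or> lookup y b = 0" if "y \<in> Y" for y
        using that bf k(1) by (auto simp: Y_def lookup_simps)
      ultimately show False using 2(2) by (metis not_one_le_zero)
    next
      case 4
      have "1 \<le> lookup (\<beta> j) c" using X(4) 4 by (simp add: in_keys_iff Suc_le_eq)
      thus False using vc[OF 2(2)] le[of c] by simp
    qed
  qed
qed

end

lemma bezout_nat_int:
  assumes "gcd x y dvd (n::nat)"
  obtains u v :: int where "int n = u * int x + v * int y"
proof -
  obtain u v where uv: "u * int x + v * int y = gcd (int x) (int y)" using bezout_int by blast
  obtain k where "n = gcd x y * k" using assms by blast
  hence "int n = gcd (int x) (int y) * int k" by (simp add: gcd_int_int_eq)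
  also have "\<dots> = (u * int k) * int x + (v * int k) * int y"
    unfolding uv[symmetric] by (simp add: algebra_simps)
  finally show thesis by (rule that)
qed

lemma mult_div_gcd_dvd: "G dvd G div gcd G (y::nat) * y"
proof -
  have "G div gcd G y * y = G * (y div gcd G y)"
    by (metis dvd_div_mult dvd_mult_div_cancel gcd_dvd1 gcd_dvd2 mult.commute)
  thus ?thesis by simp
qed

section \<open>Necessary conditions for four points and the point 0\<close>

context monomial_ci
begin

text \<open>A relation among \<open>z\<close>, \<open>t\<close>, \<open>p\<close>, \<open>q\<close>
  whose exponents of \<open>q\<close> differ by the order \<open>B\<close> yields
  \<open>m q dvd B\<close>; multiplying the exponents of the generator of \<open>q\<close> by
  \<open>B div m q\<close> gives the required combination.\<close>

lemma gluable_of_ci: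
  assumes N: "{..<N} = {z, t, b, p, q}" and inn: "b \<in> inner" "p \<in> inner" "q \<in> inner"
    and ne: "b \<noteq> p" "b \<noteq> q" "p \<noteq> q" and mb: "m b = 2"
    and nb: "b \<notin> keys (\<beta> p)" "b \<notin> keys (\<beta> q)" and qp: "q \<notin> keys (\<beta> p)"
  shows "gluable (e t) (e p) (e q)"
proof -
  have neq: "b \<noteq> z" "b \<noteq> t" "p \<noteq> z" "p \<noteq> t" "q \<noteq> z" "q \<noteq> t" using inn innerD by auto
  have inner_eq: "inner = {b, p, q}" unfolding inner_def N using neq by auto
  define G where "G = gcd (e t) (e p)"
  define B where "B = G div gcd G (e q)"
  have "gcd (e t) (e p) dvd B * e q" unfolding B_def G_def by (rule mult_div_gcd_dvd)
  then obtain y w where yw: "int (B * e q) = y * int (e t) + w * int (e p)"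
    by (rule bezout_nat_int)
  define f where "f i = (if i = q then int B else if i = t then - y else - w)" for i
  have "(\<Sum>i\<in>{q, t, p}. f i * int (e i)) = 0" using ne neq yw by (simp add: f_def)
  moreover have "{q, t, p} \<subseteq> {..<N} - {z}" using N neq z_neq_t by auto
  ultimately obtain u v where uv: "rel u v"
    "\<And>i. i \<noteq> z \<Longrightarrow> int (lookup u i) - int (lookup v i) = (if i \<in> {q, t, p} then f i else 0)"
    "\<And>i. i \<notin> insert z {q, t, p} \<Longrightarrow> lookup u i = 0 \<and> lookup v i = 0"
    by (rule rel_of_int_relation) (rule that)
  \<comment> \<open>The second summand compensates for the \<open>q\<close> that the move of
    \<open>b\<close> creates, so that only the move of \<open>q\<close> changes \<open>W\<close>, by
    \<open>2 * m q\<close>.\<close>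
  define W where "W u = 2 * int (lookup u q) + int (lookup (\<beta> b) q) * int (lookup u b)" for u
  have l0: "lookup (\<beta> p) q = 0" "lookup (\<beta> p) b = 0" "lookup (\<beta> q) b = 0"
    using nb qp by (simp_all add: in_keys_iff)
  have "2 * int (m q) dvd W u - W v"
  proof (rule weight_invariant[OF _ _ uv(1)])
    show "W (u + v) = W u + W v" for u v by (simp add: W_def lookup_add algebra_simps)
    fix j assume "j \<in> inner"
    hence "j = b \<or> j = p \<or> j = q" using inner_eq by auto
    thus "2 * int (m q) dvd W (single j (m j)) - W (\<beta> j)"
      using ne mb l0 \<beta>_self[OF inn(1)] \<beta>_self[OF inn(3)]
      by (auto simp: W_def lookup_single when_def)
  qed
  moreover have "W u - W v = 2 * int B"
  proof -
    have "W u - W v = 2 * (int (lookup u q) - int (lookup v q))"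
      using uv(3)[of b] ne neq by (simp add: W_def)
    also have "int (lookup u q) - int (lookup v q) = int B" using uv(2)[of q] neq by (simp add: f_def)
    finally show ?thesis .
  qed
  ultimately have "m q dvd B" by simp
  then obtain k where k: "B = m q * k" by blast
  define \<alpha> where "\<alpha> = lookup (\<beta> q) p"
  define \<gamma> where "\<gamma> = lookup (\<beta> q) t"
  note bq = \<beta>_simps[OF inn(3)]
  have "val (\<beta> q) = \<alpha> * e p + \<gamma> * e t" "\<alpha> + \<gamma> \<le> deg (\<beta> q)"
    using l0 \<beta>_self[OF inn(3)] ne neq z_neq_t e_z
    unfolding val_def deg_def N by (auto simp: \<alpha>_def \<gamma>_def)
  hence s: "m q * e q = \<alpha> * e p + \<gamma> * e t" "\<alpha> + \<gamma> \<le> m q" using bq by simp_all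
  have "B * e q = (k * \<alpha>) * e p + (k * \<gamma>) * e t"
    using arg_cong[OF s(1), of "\<lambda>x. k * x"] k by (simp add: algebra_simps)
  moreover have "k * \<alpha> + k * \<gamma> \<le> B"
    using mult_le_mono2[OF s(2), of k] k by (simp add: algebra_simps)
  ultimately show ?thesis unfolding gluable_def B_def G_def by blast
qed

lemma ci_four_cases:
  assumes N: "{..<N} = {z, a, b, c, x}" and ab: "0 < e a" "e a < e b" "e a + e c = 2 * e b"
    and x: "x \<noteq> z" "x \<noteq> a" "x \<noteq> b" "x \<noteq> c"
  shows "(even (e a div gcd (e a) (e b)) \<and>
      (\<exists>\<beta>\<^sub>1 \<beta>\<^sub>2 \<beta>\<^sub>3. gcd (e a) (e b) * e x = \<beta>\<^sub>1 * e a + \<beta>\<^sub>2 * e b + \<beta>\<^sub>3 * e c \<and>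
         \<beta>\<^sub>1 + \<beta>\<^sub>2 + \<beta>\<^sub>3 \<le> gcd (e a) (e b))) \<or>
    (even (e a) \<and> even (e x) \<and>
      (\<exists>p q. {p, q, t} = {a, c, x} \<and> p \<noteq> q \<and> p \<noteq> t \<and> q \<noteq> t \<and> gluable (e t) (e p) (e q)))"
proof -
  have bc: "e b < e c" using ab by linarith
  have idx: "a < N" "b < N" "c < N" "x < N" using N by auto
  have ne: "a \<noteq> b" "a \<noteq> c" "b \<noteq> c" "z \<noteq> a" "z \<noteq> b" "z \<noteq> c" using ab bc e_z by auto
  have "t \<in> {z, a, b, c, x}" using N t_less by blast
  hence tcx: "t = c \<or> t = x" using e_le[OF idx(3)] ab bc z_neq_t by auto
  have inn: "a \<in> inner" "b \<in> inner" using tcx ne x idx by (auto simp: inner_def)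
  note mb = midpoint_quadric[OF inn(2) idx(1,3) ne(2) ab(3)]
  have lb: "lookup (\<beta> b) i = of_bool (i = a) + of_bool (i = c)" for i
    unfolding mb(2) by (auto simp: lookup_simps)
  show ?thesis
  proof (cases "\<exists>j\<in>inner. b \<in> keys (\<beta> j)")
    case False
    hence nb: "lookup (\<beta> j) b = 0" if "j \<in> inner" for j using that by (auto simp: in_keys_iff)
    \<comment> \<open>With \<open>b\<close> absent from every \<open>\<beta> j\<close>, the parity
      of its exponent is invariant. An integer relation with coefficient \<open>g\<close> at
      \<open>b\<close> then shows that \<open>g\<close> is even.\<close>
    define g where "g = gcd (gcd (e a) (e c)) (e x)"
    have "gcd (gcd (e a) (e c)) (e x) dvd g * e b" by (simp add: g_def)
    then obtain y w where yw: "int (g * e b) = y * int (gcd (e a) (e c)) + w * int (e x)"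
      by (rule bezout_nat_int)
    obtain y1 y2 where y12: "int (gcd (e a) (e c)) = y1 * int (e a) + y2 * int (e c)"
      by (rule bezout_nat_int[of "e a" "e c" "gcd (e a) (e c)"]) auto
    define f where "f i = (if i = b then int g else if i = a then - y * y1 else if i = c then - y * y2 else - w)" for i
    have "(\<Sum>i\<in>{b, a, c, x}. f i * int (e i)) = 0"
      using ne x yw unfolding y12 by (simp add: f_def algebra_simps)
    moreover have "{b, a, c, x} \<subseteq> {..<N} - {z}" using idx ne x by auto
    ultimately obtain u v where uv: "rel u v"
      "\<And>i. i \<noteq> z \<Longrightarrow> int (lookup u i) - int (lookup v i) = (if i \<in> {b, a, c, x} then f i else 0)"
      "\<And>i. i \<notin> insert z {b, a, c, x} \<Longrightarrow> lookup u i = 0 \<and> lookup v i = 0"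
      by (rule rel_of_int_relation) (rule that)
    have "2 dvd int (lookup u b) - int (lookup v b)"
    proof (rule weight_invariant[OF _ _ uv(1)])
      fix j assume "j \<in> inner"
      thus "2 dvd int (lookup (single j (m j)) b) - int (lookup (\<beta> j) b)"
        using nb mb(1) by (auto simp: lookup_single when_def)
    qed (simp add: lookup_add)
    hence "even g" using uv(2)[of b] ne by (simp add: f_def)
    hence ev: "even (e a)" "even (e x)" by (auto simp: g_def)
    \<comment> \<open>The inner point besides \<open>a\<close> and \<open>b\<close>: whichever of
      \<open>c\<close> and \<open>x\<close> is not the maximum.\<close>
    define r where "r = (if t = c then x else c)"
    have r: "r \<in> inner" "r \<noteq> a" "r \<noteq> b" "{a, r, t} = {a, c, x}" "{..<N} = {z, t, b, a, r}"
      using tcx ne x idx unfolding N by (auto simp: r_def inner_def)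
    have at: "a \<noteq> t" "r \<noteq> t" using inn(1) r(1) innerD by blast+
    have nk: "b \<notin> keys (\<beta> a)" "b \<notin> keys (\<beta> r)" using nb inn(1) r(1) by (simp_all add: in_keys_iff)
    \<comment> \<open>Acyclicity decides which of the two is glued first.\<close>
    have "\<exists>i\<in>{a, r}. keys (\<beta> i) \<inter> {a, r} = {}" by (rule acyclic) (use inn r in auto)
    hence "gluable (e t) (e a) (e r) \<or> gluable (e t) (e r) (e a)"
    proof (elim bexE insertE)
      fix i assume i: "keys (\<beta> i) \<inter> {a, r} = {}" "i = a"
      show ?thesis
        by (rule disjI1, rule gluable_of_ci[where b = b]) (use i r inn ne nk mb in auto)
    next
      fix i assume i: "keys (\<beta> i) \<inter> {a, r} = {}" "i = r"
      show ?thesis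
        by (rule disjI2, rule gluable_of_ci[where b = b]) (use i r inn ne nk mb in auto)
    qed auto
    hence "\<exists>p q. {p, q, t} = {a, c, x} \<and> p \<noteq> q \<and> p \<noteq> t \<and> q \<noteq> t \<and> gluable (e t) (e p) (e q)"
    proof
      assume "gluable (e t) (e a) (e r)"
      thus ?thesis using r(2,4) at by metis
    next
      assume "gluable (e t) (e r) (e a)"
      moreover have "{r, a, t} = {a, c, x}" using r(4) by (simp add: insert_commute)
      ultimately show ?thesis using r(2) at by metis
    qed
    with ev show ?thesis by blast
  next
    case True
    then obtain j where j: "j \<in> inner" "b \<in> keys (\<beta> j)" by blast
    \<comment> \<open>\<open>b\<close> leads to \<open>a\<close> and \<open>c\<close>, so neither
      leads back to it. This leaves \<open>x\<close>, which is therefore inner, so the maximum is at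
      \<open>c\<close>.\<close>
    have "a \<in> keys (\<beta> b)" "c \<in> keys (\<beta> b)" by (simp_all add: in_keys_iff lb)
    hence "j \<noteq> a" "j \<noteq> c" using no_two_cycle[of b j] j inn by blast+
    moreover have "j \<noteq> b" using j lb[of b] ne by (auto simp: in_keys_iff)
    moreover have "j \<in> {z, a, b, c, x}" using innerD[OF j(1)] N by blast
    ultimately have jx: "j = x" using innerD[OF j(1)] by blast
    hence tc: "t = c" using tcx j(1) innerD by blast
    have inner_eq: "inner = {a, b, x}" unfolding inner_def N using tc ne x by auto
    have x_inn: "x \<in> inner" using j jx by simp
    have "keys (\<beta> a) \<inter> {a, b, x} = {}"
      using acyclic[of "{a, b, x}"] inner_eq j jx \<open>a \<in> keys (\<beta> b)\<close> by auto
    hence la: "lookup (\<beta> a) a = 0" "lookup (\<beta> a) b = 0" "lookup (\<beta> a) x = 0"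
      by (auto simp: in_keys_iff)
    have lbx: "lookup (\<beta> b) x = 0" "lookup (\<beta> b) b = 0" using lb ne x by auto
    have lx: "lookup (\<beta> x) x = 0" using \<beta>_self[OF x_inn] .
    define g where "g = gcd (e a) (e b)"
    have "gcd (e a) (e b) dvd g * e x" by (simp add: g_def)
    then obtain y w where yw: "int (g * e x) = y * int (e a) + w * int (e b)"
      by (rule bezout_nat_int)
    define f where "f i = (if i = x then int g else if i = a then - y else - w)" for i
    have "(\<Sum>i\<in>{x, a, b}. f i * int (e i)) = 0" using ne x yw by (simp add: f_def)
    moreover have "{x, a, b} \<subseteq> {..<N} - {z}" using idx ne x by auto
    ultimately obtain u v where uv: "rel u v"
      "\<And>i. i \<noteq> z \<Longrightarrow> int (lookup u i) - int (lookup v i) = (if i \<in> {x, a, b} then f i else 0)"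
      "\<And>i. i \<notin> insert z {x, a, b} \<Longrightarrow> lookup u i = 0 \<and> lookup v i = 0"
      by (rule rel_of_int_relation) (rule that)
    \<comment> \<open>\<open>x\<close> occurs in none of the \<open>\<beta> j\<close>, so its
      exponent is invariant modulo \<open>m x\<close>.\<close>
    have "int (m x) dvd int (lookup u x) - int (lookup v x)"
    proof (rule weight_invariant[OF _ _ uv(1)])
      fix j assume "j \<in> inner"
      hence "j = a \<or> j = b \<or> j = x" using inner_eq by auto
      thus "int (m x) dvd int (lookup (single j (m j)) x) - int (lookup (\<beta> j) x)"
        using la lbx lx x by (auto simp: lookup_single when_def)
    qed (simp add: lookup_add)
    hence "m x dvd g" using uv(2)[of x] x by (simp add: f_def)
    then obtain k where k: "g = m x * k" by blast
    define \<beta>1 \<beta>2 \<beta>3 where "\<beta>1 = lookup (\<beta> x) a" and "\<beta>2 = lookup (\<beta> x) b" and "\<beta>3 = lookup (\<beta> x) c"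
    note bx = \<beta>_simps[OF x_inn]
    have "val (\<beta> x) = \<beta>1 * e a + \<beta>2 * e b + \<beta>3 * e c" "\<beta>1 + \<beta>2 + \<beta>3 \<le> deg (\<beta> x)"
      using lx ne x e_z unfolding val_def deg_def N by (auto simp: \<beta>1_def \<beta>2_def \<beta>3_def)
    hence s: "m x * e x = \<beta>1 * e a + \<beta>2 * e b + \<beta>3 * e c" "\<beta>1 + \<beta>2 + \<beta>3 \<le> m x"
      using bx by simp_all
    have "g * e x = (k * \<beta>1) * e a + (k * \<beta>2) * e b + (k * \<beta>3) * e c"
      using arg_cong[OF s(1), of "\<lambda>x. k * x"] k by (simp add: algebra_simps)
    moreover have "k * \<beta>1 + k * \<beta>2 + k * \<beta>3 \<le> g"
      using mult_le_mono2[OF s(2), of k] k by (simp add: algebra_simps)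
    moreover have "even (e a div g)"
    proof -
      define G where "G = gcd (e a) (e c)"
      define B where "B = G div gcd G (e b)"
      have "gcd (e a) (e c) dvd B * e b" unfolding B_def G_def by (rule mult_div_gcd_dvd)
      then obtain y w where yw: "int (B * e b) = y * int (e a) + w * int (e c)"
        by (rule bezout_nat_int)
      define f where "f i = (if i = b then int B else if i = a then - y else - w)" for i
      have "(\<Sum>i\<in>{b, a, c}. f i * int (e i)) = 0" using ne yw by (simp add: f_def)
      moreover have "{b, a, c} \<subseteq> {..<N} - {z}" using idx ne by auto
      ultimately obtain u v where uv: "rel u v"
        "\<And>i. i \<noteq> z \<Longrightarrow> int (lookup u i) - int (lookup v i) = (if i \<in> {b, a, c} then f i else 0)"
        "\<And>i. i \<notin> insert z {b, a, c} \<Longrightarrow> lookup u i = 0 \<and> lookup v i = 0"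
        by (rule rel_of_int_relation) (rule that)
      \<comment> \<open>The move of \<open>x\<close> may create \<open>b\<close>, and the second
        summand makes up for it; only the move of \<open>b\<close> changes \<open>W\<close>, by
        \<open>2 * m x\<close>.\<close>
      define W where "W u = int (m x) * int (lookup u b) + int (lookup (\<beta> x) b) * int (lookup u x)" for u
      have "2 * int (m x) dvd W u - W v"
      proof (rule weight_invariant[OF _ _ uv(1)])
        show "W (u + v) = W u + W v" for u v by (simp add: W_def lookup_add algebra_simps)
        fix j assume "j \<in> inner"
        hence "j = a \<or> j = b \<or> j = x" using inner_eq by auto
        thus "2 * int (m x) dvd W (single j (m j)) - W (\<beta> j)"
          using la lbx lx x mb(1) ne by (auto simp: W_def lookup_single when_def)
      qed
      moreover have "W u - W v = int (m x) * int B"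
      proof -
        have "int (lookup u b) - int (lookup v b) = int B" using uv(2)[of b] ne by (simp add: f_def)
        moreover have "lookup u x = 0" "lookup v x = 0" using uv(3)[of x] x by auto
        ultimately show ?thesis by (simp add: W_def flip: right_diff_distrib)
      qed
      ultimately have "int (m x) * 2 dvd int (m x) * int B" by (simp add: mult.commute)
      hence "even B" using m_ge_2[OF x_inn] by simp
      \<comment> \<open>By \<open>e c = 2 * e b - e a\<close>, the point \<open>c\<close> lies in
        the group generated by \<open>a\<close> and \<open>b\<close>.\<close>
      have "gcd G (e b) = g"
      proof (rule dvd_antisym)
        show "gcd G (e b) dvd g"
          unfolding G_def g_def by (meson gcd_dvd1 gcd_dvd2 gcd_greatest dvd_trans)
        have "g dvd e a + e c" unfolding ab(3) by (simp add: g_def)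
        moreover have "g dvd e a" by (simp add: g_def)
        ultimately have "g dvd e c" using dvd_add_right_iff by blast
        thus "g dvd gcd G (e b)" by (simp add: G_def g_def)
      qed
      hence "G = g * B" unfolding B_def by (metis dvd_mult_div_cancel gcd_dvd1)
      hence "g * B dvd e a" by (metis G_def gcd_dvd1)
      hence "g * 2 dvd e a" using \<open>even B\<close> by (meson dvd_trans mult_dvd_mono dvd_refl)
      thus ?thesis using ab(1) by (metis dvd_div_iff_mult dvd_mult_left g_def gcd_eq_0_iff mult.commute not_less_zero)
    qed
    ultimately show ?thesis unfolding g_def by blast
  qed
qed

end

section \<open>Explicit generating sets\<close>

context monomial_curve
begin

lemma generates_of_conn_on:
  "conn_on P {..<N} \<Longrightarrow> \<forall>(p, q)\<in>P. rel p q \<Longrightarrow> generates points P"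
  unfolding conn_on_def generates_def by (auto simp: rel_iff)

text \<open>Base of the gluing: \<open>k\<close> is the order of \<open>e i\<close> modulo
  \<open>e t\<close>. The set \<open>P\<close> is left open so that further pairs can be
  added.\<close>

lemma first_generator:
  assumes i: "i \<in> inner"
  shows "\<exists>k b. rel (single i k) b \<and> (\<forall>P. (single i k, b) \<in> P \<longrightarrow> conn_on P {i, z, t})"
proof -
  define g where "g = gcd (e t) (e i)"
  define k where "k = e t div g"
  define l where "l = e i div g"
  have g: "0 < g" "g dvd e t" "g dvd e i" using e_t_pos by (auto simp: g_def)
  have kl: "e t = g * k" "e i = g * l" using g by (simp_all add: k_def l_def)
  have "0 < k" using kl e_t_pos by (cases k) auto
  have "l \<le> k" using innerD[OF i] kl g(1) by (metis less_imp_le mult_le_cancel1)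
  define b where "b = single t l + single z (k - l)"
  have "k * e i = l * e t" unfolding kl by simp
  hence r: "rel (single i k) b"
    using innerD[OF i] \<open>l \<le> k\<close> z_less t_less e_z
    by (auto simp: b_def rel_iff keys_add_nat split: if_splits)
  moreover have "conn_on P {i, z, t}" if "(single i k, b) \<in> P" for P
  proof (rule conn_on_insert[OF conn_on_extremes _ that _ r \<open>0 < k\<close>])
    show "i \<notin> {z, t}" using innerD[OF i] by simp
    show "keys b \<subseteq> {z, t}" by (auto simp: b_def keys_add_nat split: if_splits)
    show "int k dvd int (lookup u i) - int (lookup v i)"
      if "rel u v" "keys u \<subseteq> {i, z, t}" "keys v \<subseteq> {i, z, t}" for u v
      by (rule rel_dvd[OF that, of "e t"])
         (use innerD[OF i] z_less t_less e_t_pos e_z in \<open>auto simp: k_def g_def\<close>)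
  qed
  ultimately show ?thesis by blast
qed

lemma card_three: "card {x, y, w} \<le> 3"
  by (simp add: card_insert_if)

text \<open>Variables are added in the order \<open>p\<close>, \<open>q\<close>, \<open>b\<close>.
  When \<open>b\<close> is added the other points are all even while \<open>e b\<close> is odd, so
  its exponents agree modulo 2 and the midpoint relation suffices.\<close>

lemma generators_of_gluable:
  assumes N: "{..<N} = {z, t, p, q, b}" and inn: "p \<in> inner" "q \<in> inner" "b \<in> inner"
    and ne: "p \<noteq> q" "p \<noteq> b" "q \<noteq> b" and glue: "gluable (e t) (e p) (e q)"
    and ac: "a \<in> {p, q, t}" "c \<in> {p, q, t}" "e a + e c = 2 * e b"
    and ev: "even (e p)" "even (e q)" "even (e t)" "odd (e b)"
  shows "\<exists>P. finite P \<and> generates points P \<and> card P \<le> 3"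
proof -
  obtain k1 b1 where 1: "rel (single p k1) b1" "\<And>P. (single p k1, b1) \<in> P \<Longrightarrow> conn_on P {p, z, t}"
    using first_generator[OF inn(1)] by blast
  define G where "G = gcd (e t) (e p)"
  define B where "B = G div gcd G (e q)"
  obtain \<alpha> \<gamma> where \<alpha>\<gamma>: "B * e q = \<alpha> * e p + \<gamma> * e t" "\<alpha> + \<gamma> \<le> B"
    using glue unfolding gluable_def B_def G_def by blast
  have G: "0 < G" using e_t_pos by (simp add: G_def)
  hence "0 < B" unfolding B_def by (simp add: div_greater_zero_iff dvd_imp_le)
  define b2 where "b2 = single p \<alpha> + single t \<gamma> + single z (B - (\<alpha> + \<gamma>))"
  define b3 where "b3 = single a 1 + single c (1::nat)"
  have Nd: "p < N" "q < N" "b < N" "a < N" "c < N" using inn innerD ac t_less by auto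
  have 2: "rel (single q B) b2"
    using \<alpha>\<gamma> Nd z_less t_less e_z by (auto simp: b2_def rel_iff keys_add_nat split: if_splits)
  have 3: "rel (single b 2) b3"
    using ac(3) Nd by (auto simp: b3_def rel_iff keys_add_nat split: if_splits)
  define P where "P = {(single p k1, b1), (single q B, b2), (single b 2, b3)}"
  have c1: "conn_on P {p, z, t}" by (rule 1(2)) (simp add: P_def)
  have c2: "conn_on P {q, p, z, t}"
  proof (rule conn_on_insert[OF c1 _ _ _ 2 \<open>0 < B\<close>])
    show "q \<notin> {p, z, t}" using ne innerD[OF inn(2)] by auto
    show "(single q B, b2) \<in> P" by (simp add: P_def)
    show "keys b2 \<subseteq> {p, z, t}" by (auto simp: b2_def keys_add_nat split: if_splits)
    show "int B dvd int (lookup u q) - int (lookup v q)"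
      if "rel u v" "keys u \<subseteq> {q, p, z, t}" "keys v \<subseteq> {q, p, z, t}" for u v
      by (rule rel_dvd[OF that, of G])
         (use innerD[OF inn(2)] Nd z_less t_less G e_z ne in \<open>auto simp: B_def G_def\<close>)
  qed
  have c3: "conn_on P {b, q, p, z, t}"
  proof (rule conn_on_insert[OF c2 _ _ _ 3])
    show "b \<notin> {q, p, z, t}" using ne innerD[OF inn(3)] by auto
    show "(single b 2, b3) \<in> P" by (simp add: P_def)
    show "keys b3 \<subseteq> {q, p, z, t}" using ac by (auto simp: b3_def keys_add_nat split: if_splits)
    have "gcd 2 (e b) = 1" using ev(4) by (simp add: coprime_iff_gcd_eq_1[symmetric])
    thus "int 2 dvd int (lookup u b) - int (lookup v b)"
      if "rel u v" "keys u \<subseteq> {b, q, p, z, t}" "keys v \<subseteq> {b, q, p, z, t}" for u v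
      by (intro rel_dvd[OF that, of 2])
         (use innerD[OF inn(3)] Nd z_less t_less ev e_z ne in auto)
  qed simp
  have "{b, q, p, z, t} = {..<N}" using N by auto
  hence "generates points P"
    using c3 1(1) 2 3 by (intro generates_of_conn_on) (auto simp: P_def)
  moreover have "card P \<le> 3" unfolding P_def by (rule card_three)
  ultimately show ?thesis by (intro exI[of _ P]) (simp add: P_def)
qed

text \<open>Variables are added in the order \<open>a\<close>, \<open>b\<close>, \<open>x\<close>.
  The order of \<open>e b\<close> modulo \<open>gcd (e a) (e t)\<close> is even by the parity
  hypothesis, and that of \<open>e x\<close> modulo \<open>g\<close> is \<open>g\<close> by
  coprimality.\<close>

lemma generators_of_midpoint:
  assumes N: "{..<N} = {z, a, b, t, x}" and inn: "a \<in> inner" "b \<in> inner" "x \<in> inner"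
    and ne: "a \<noteq> b" "a \<noteq> x" "b \<noteq> x" and mid: "e a + e t = 2 * e b"
    and g: "g = gcd (e a) (e b)" "even (e a div g)" "gcd g (e x) = 1"
    and comb: "g * e x = \<beta>\<^sub>1 * e a + \<beta>\<^sub>2 * e b + \<beta>\<^sub>3 * e t" "\<beta>\<^sub>1 + \<beta>\<^sub>2 + \<beta>\<^sub>3 \<le> g"
  shows "\<exists>P. finite P \<and> generates points P \<and> card P \<le> 3"
proof -
  obtain k1 b1 where 1: "rel (single a k1) b1" "\<And>P. (single a k1, b1) \<in> P \<Longrightarrow> conn_on P {a, z, t}"
    using first_generator[OF inn(1)] by blast
  define b2 where "b2 = single a 1 + single t (1::nat)"
  define b3 where "b3 = single a \<beta>\<^sub>1 + single b \<beta>\<^sub>2 + single t \<beta>\<^sub>3 + single z (g - (\<beta>\<^sub>1 + \<beta>\<^sub>2 + \<beta>\<^sub>3))"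
  have Nd: "a < N" "b < N" "x < N" using inn innerD by auto
  have g0: "0 < g" using innerD[OF inn(1)] g(1) by simp
  have gt: "g dvd e t"
  proof -
    have "g dvd e a + e t" unfolding mid by (simp add: g(1))
    moreover have "g dvd e a" by (simp add: g(1))
    ultimately show ?thesis using dvd_add_right_iff by blast
  qed
  have 2: "rel (single b 2) b2"
    using mid Nd t_less by (auto simp: b2_def rel_iff keys_add_nat split: if_splits)
  have 3: "rel (single x g) b3"
    using comb Nd z_less t_less e_z by (auto simp: b3_def rel_iff keys_add_nat split: if_splits)
  define P where "P = {(single a k1, b1), (single b 2, b2), (single x g, b3)}"
  have c1: "conn_on P {a, z, t}" by (rule 1(2)) (simp add: P_def)
  have c2: "conn_on P {b, a, z, t}"
  proof (rule conn_on_insert[OF c1 _ _ _ 2])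
    show "b \<notin> {a, z, t}" using ne innerD[OF inn(2)] by auto
    show "(single b 2, b2) \<in> P" by (simp add: P_def)
    show "keys b2 \<subseteq> {a, z, t}" by (auto simp: b2_def keys_add_nat split: if_splits)
    define G where "G = gcd (e a) (e t)"
    have "g * 2 dvd e a"
      using g(1,2) by (metis dvd_mult_div_cancel gcd_dvd1 mult_dvd_mono dvd_refl)
    moreover have "g * 2 dvd e a + e t" unfolding mid using g(1) by (simp add: mult.commute)
    ultimately have "g * 2 dvd G" unfolding G_def by (simp add: dvd_add_right_iff)
    moreover have "gcd G (e b) = g"
    proof (rule dvd_antisym)
      show "gcd G (e b) dvd g"
        unfolding G_def g(1) by (meson gcd_dvd1 gcd_dvd2 gcd_greatest dvd_trans)
      show "g dvd gcd G (e b)" using gt by (simp add: G_def g(1))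
    qed
    ultimately have "2 dvd G div gcd G (e b)" using g0 by (metis dvd_div_iff_mult dvd_mult_left gcd_dvd1 mult.commute not_less_zero)
    thus "int 2 dvd int (lookup u b) - int (lookup v b)"
      if "rel u v" "keys u \<subseteq> {b, a, z, t}" "keys v \<subseteq> {b, a, z, t}" for u v
      by (intro rel_dvd[OF that, of G])
         (use innerD[OF inn(2)] Nd z_less t_less e_t_pos e_z ne in \<open>auto simp: G_def\<close>)
  qed simp
  have c3: "conn_on P {x, b, a, z, t}"
  proof (rule conn_on_insert[OF c2 _ _ _ 3 g0])
    show "x \<notin> {b, a, z, t}" using ne innerD[OF inn(3)] by auto
    show "(single x g, b3) \<in> P" by (simp add: P_def)
    show "keys b3 \<subseteq> {b, a, z, t}" by (auto simp: b3_def keys_add_nat split: if_splits)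
    show "int g dvd int (lookup u x) - int (lookup v x)"
      if "rel u v" "keys u \<subseteq> {x, b, a, z, t}" "keys v \<subseteq> {x, b, a, z, t}" for u v
      by (rule rel_dvd[OF that, of g])
         (use innerD[OF inn(3)] Nd z_less t_less g(3) g0 gt e_z ne in \<open>auto simp: g(1)\<close>)
  qed
  have "{x, b, a, z, t} = {..<N}" using N by auto
  hence "generates points P"
    using c3 1(1) 2 3 by (intro generates_of_conn_on) (auto simp: P_def)
  moreover have "card P \<le> 3" unfolding P_def by (rule card_three)
  ultimately show ?thesis by (intro exI[of _ P]) (simp add: P_def)
qed

end

section \<open>Confluence of the reduction\<close>

definition rvec :: "nat ^ 'm \<Rightarrow> rat ^ 'm" where "rvec v = (\<chi> j. of_nat (v $ j))"

text \<open>The three spans of the reduction are obtained for \<open>K = \<nat>, \<int>, UNIV\<close>.\<close>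

definition combos :: "rat set \<Rightarrow> (nat ^ 'm) set \<Rightarrow> (rat ^ 'm) set" where
  "combos K V = {w. \<exists>c. (\<forall>v. c v \<in> K) \<and> w = (\<Sum>v\<in>V. c v *s rvec v)}"

definition coeff_semiring :: "rat set \<Rightarrow> bool" where
  "coeff_semiring K \<longleftrightarrow> 0 \<in> K \<and> 1 \<in> K \<and> (\<forall>x\<in>K. \<forall>y\<in>K. x + y \<in> K \<and> x * y \<in> K)"

lemma coeff_semirings [simp]: "coeff_semiring \<nat>" "coeff_semiring \<int>" "coeff_semiring UNIV"
  by (auto simp: coeff_semiring_def)

lemma rvec_scale: "rvec (B *s v) = of_nat B *s rvec v"
  by (simp add: rvec_def vec_eq_iff)

lemma in_rat_span_iff: "in_rat_span V b \<longleftrightarrow> rvec b \<in> combos UNIV V"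
  by (simp add: in_rat_span_def combos_def rvec_def vec_eq_iff)

lemma in_int_span_iff: "in_int_span V b \<longleftrightarrow> rvec b \<in> combos \<int> V"
proof
  assume "in_int_span V b"
  then obtain c where c: "\<And>j. int (b $ j) = (\<Sum>v\<in>V. c v * int (v $ j))" by (auto simp: in_int_span_def)
  have "(of_nat (b $ j) :: rat) = (\<Sum>v\<in>V. of_int (c v) * of_nat (v $ j))" for j
    using arg_cong[OF c[of j], of "of_int :: int \<Rightarrow> rat"] by simp
  thus "rvec b \<in> combos \<int> V" unfolding combos_def
    by (intro CollectI exI[of _ "\<lambda>v. of_int (c v)"]) (simp add: rvec_def vec_eq_iff)
next
  assume "rvec b \<in> combos \<int> V"
  then obtain c where c: "\<And>v. c v \<in> \<int>" "rvec b = (\<Sum>v\<in>V. c v *s rvec v)" by (auto simp: combos_def)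
  have "\<forall>v. \<exists>d. c v = of_int d" using c(1) by (auto elim: Ints_cases)
  then obtain d where d: "\<And>v. c v = of_int (d v)" by metis
  have "(of_int (int (b $ j)) :: rat) = of_int (\<Sum>v\<in>V. d v * int (v $ j))" for j
    using arg_cong[OF c(2), of "\<lambda>x. x $ j"] by (simp add: rvec_def d)
  thus "in_int_span V b" unfolding in_int_span_def of_int_eq_iff by (intro exI[of _ d]) simp
qed

lemma in_nat_span_iff: "in_nat_span V b \<longleftrightarrow> rvec b \<in> combos \<nat> V"
proof
  assume "in_nat_span V b"
  then obtain c where c: "\<And>j. b $ j = (\<Sum>v\<in>V. c v * v $ j)" by (auto simp: in_nat_span_def)
  have "(of_nat (b $ j) :: rat) = (\<Sum>v\<in>V. of_nat (c v) * of_nat (v $ j))" for j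
    using arg_cong[OF c[of j], of "of_nat :: nat \<Rightarrow> rat"] by simp
  thus "rvec b \<in> combos \<nat> V" unfolding combos_def
    by (intro CollectI exI[of _ "\<lambda>v. of_nat (c v)"]) (simp add: rvec_def vec_eq_iff)
next
  assume "rvec b \<in> combos \<nat> V"
  then obtain c where c: "\<And>v. c v \<in> \<nat>" "rvec b = (\<Sum>v\<in>V. c v *s rvec v)" by (auto simp: combos_def)
  have "\<forall>v. \<exists>d. c v = of_nat d" using c(1) by (auto elim: Nats_cases)
  then obtain d where d: "\<And>v. c v = of_nat (d v)" by metis
  have "(of_nat (b $ j) :: rat) = of_nat (\<Sum>v\<in>V. d v * v $ j)" for j
    using arg_cong[OF c(2), of "\<lambda>x. x $ j"] by (simp add: rvec_def d)
  thus "in_nat_span V b" unfolding in_nat_span_def of_nat_eq_iff by (intro exI[of _ d]) simp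
qed

lemma combos_zero: "coeff_semiring K \<Longrightarrow> 0 \<in> combos K V"
  unfolding combos_def by (intro CollectI exI[of _ "\<lambda>_. 0"]) (auto simp: coeff_semiring_def)

lemma combos_add:
  assumes K: "coeff_semiring K" and "x \<in> combos K V" "y \<in> combos K V"
  shows "x + y \<in> combos K V"
proof -
  obtain c d where "\<And>v. c v \<in> K" "x = (\<Sum>v\<in>V. c v *s rvec v)" "\<And>v. d v \<in> K" "y = (\<Sum>v\<in>V. d v *s rvec v)"
    using assms by (auto simp: combos_def)
  thus ?thesis using K unfolding combos_def
    by (intro CollectI exI[of _ "\<lambda>v. c v + d v"]) (auto simp: coeff_semiring_def vec_eq_iff algebra_simps sum.distrib)
qed

lemma combos_scale:
  assumes K: "coeff_semiring K" "k \<in> K" and "x \<in> combos K V"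
  shows "k *s x \<in> combos K V"
proof -
  obtain c where "\<And>v. c v \<in> K" "x = (\<Sum>v\<in>V. c v *s rvec v)"
    using assms by (auto simp: combos_def)
  thus ?thesis using K unfolding combos_def
    by (intro CollectI exI[of _ "\<lambda>v. k * c v"]) (auto simp: coeff_semiring_def vec_eq_iff sum_distrib_left mult_ac)
qed

text \<open>\<open>b\<close> may already lie in \<open>V\<close>, since repeated vectors of a family
  collapse in \<open>set_mset\<close>.\<close>

lemma combos_insert:
  assumes K: "coeff_semiring K" and V: "finite V"
  shows "combos K (insert b V) = {k *s rvec b + w | k w. k \<in> K \<and> w \<in> combos K V}"
proof (intro equalityI subsetI)
  fix x assume "x \<in> combos K (insert b V)"
  then obtain c where c: "\<And>v. c v \<in> K" "x = (\<Sum>v\<in>insert b V. c v *s rvec v)" by (auto simp: combos_def)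
  show "x \<in> {k *s rvec b + w | k w. k \<in> K \<and> w \<in> combos K V}"
  proof (cases "b \<in> V")
    case True
    hence "x \<in> combos K V" using c by (auto simp: combos_def insert_absorb)
    moreover have "x = 0 *s rvec b + x" by (simp add: vec_eq_iff)
    ultimately show ?thesis using K unfolding coeff_semiring_def by blast
  next
    case False
    hence "x = c b *s rvec b + (\<Sum>v\<in>V. c v *s rvec v)" using c(2) V by simp
    moreover have "(\<Sum>v\<in>V. c v *s rvec v) \<in> combos K V" using c(1) by (auto simp: combos_def)
    ultimately show ?thesis using c(1) by blast
  qed
next
  fix x assume "x \<in> {k *s rvec b + w | k w. k \<in> K \<and> w \<in> combos K V}"
  then obtain k w where x: "x = k *s rvec b + w" "k \<in> K" "w \<in> combos K V" by blast
  obtain c where c: "\<And>v. c v \<in> K" "w = (\<Sum>v\<in>V. c v *s rvec v)" using x(3) by (auto simp: combos_def)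
  have "w \<in> combos K (insert b V)"
  proof (cases "b \<in> V")
    case False
    have "(\<Sum>v\<in>V. (c(b := 0)) v *s rvec v) = w"
      unfolding c(2) by (rule sum.cong) (use False in auto)
    hence "w = (\<Sum>v\<in>insert b V. (c(b := 0)) v *s rvec v)"
      using V False by (simp add: vec_eq_iff)
    moreover have "(c(b := 0)) v \<in> K" for v using c(1) K by (simp add: coeff_semiring_def)
    ultimately show ?thesis unfolding combos_def by blast
  qed (use x(3) in \<open>simp add: insert_absorb\<close>)
  moreover have "rvec b \<in> combos K (insert b V)"
  proof -
    have "(\<Sum>v\<in>insert b V. (if v = b then 1 else 0) *s rvec v) = (\<Sum>v\<in>insert b V. if v = b then rvec b else 0)"
      by (rule sum.cong) auto
    also have "\<dots> = rvec b" using V by simp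
    finally show ?thesis using K unfolding combos_def
      by (intro CollectI exI[of _ "\<lambda>v. if v = b then 1 else 0"]) (simp add: coeff_semiring_def)
  qed
  ultimately show "x \<in> combos K (insert b V)"
    unfolding x(1) by (intro combos_add combos_scale K x(2))
qed

lemma mem_combos_insert:
  "coeff_semiring K \<Longrightarrow> finite V \<Longrightarrow>
     x \<in> combos K (insert b V) \<longleftrightarrow> (\<exists>k\<in>K. \<exists>w\<in>combos K V. x = k *s rvec b + w)"
  by (auto simp: combos_insert)

lemma combos_mono: "coeff_semiring K \<Longrightarrow> finite V \<Longrightarrow> combos K V \<subseteq> combos K (insert b V)"
proof
  fix x assume K: "coeff_semiring K" "finite V" and x: "x \<in> combos K V"
  have "x = 0 *s rvec b + x" by simp
  moreover have "0 \<in> K" using K(1) by (simp add: coeff_semiring_def)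
  ultimately show "x \<in> combos K (insert b V)" using x unfolding mem_combos_insert[OF K] by blast
qed

lemma combos_insert_member:
  assumes "coeff_semiring K" "finite V" "rvec b \<in> combos K V"
  shows "combos K (insert b V) = combos K V"
proof (rule antisym)
  show "combos K (insert b V) \<subseteq> combos K V"
  proof
    fix x assume "x \<in> combos K (insert b V)"
    then obtain k w where "k \<in> K" "w \<in> combos K V" "x = k *s rvec b + w"
      using assms by (auto simp: mem_combos_insert)
    thus "x \<in> combos K V" using assms by (auto intro: combos_add combos_scale)
  qed
qed (use assms combos_mono in blast)

lemma combos_minus: "x \<in> combos \<int> V \<Longrightarrow> - x \<in> combos \<int> V"
  using combos_scale[of \<int> "-1" x V] by simp

lemma combos_coeff_mono: "K \<subseteq> L \<Longrightarrow> combos K V \<subseteq> combos L V"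
proof
  fix x assume KL: "K \<subseteq> L" and "x \<in> combos K V"
  then obtain c where "\<And>v. c v \<in> K" "x = (\<Sum>v\<in>V. c v *s rvec v)" by (auto simp: combos_def)
  with KL show "x \<in> combos L V" unfolding combos_def by (intro CollectI exI[of _ c]) auto
qed

lemmas combos_Nats_Ints = combos_coeff_mono[OF Nats_subset_Ints]
lemmas combos_UNIV = combos_coeff_mono[OF subset_UNIV]

text \<open>By division with remainder, the \<open>x\<close> with \<open>x *s b\<close> in the
  integer span are the multiples of the least positive one; a common denominator of rational
  coefficients shows that a positive one exists.\<close>

lemma red_multiplier:
  assumes V: "finite V" and b: "in_rat_span V b"
  shows "0 < red_multiplier V b"
    and "in_int_span V (x *s b) \<longleftrightarrow> red_multiplier V b dvd x"
proof -
  obtain c where c: "rvec b = (\<Sum>v\<in>V. c v *s rvec v)"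
    using b unfolding in_rat_span_iff combos_def by blast
  define q where "q v = snd (quotient_of (c v))" for v
  define Q where "Q = (\<Prod>v\<in>V. q v)"
  have qpos: "q v > 0" for v by (simp add: q_def quotient_of_denom_pos')
  have Q: "Q > 0" unfolding Q_def by (rule prod_pos) (rule qpos)
  have "of_int Q * c v \<in> \<int>" if "v \<in> V" for v
  proof -
    obtain p r where pr: "quotient_of (c v) = (p, r)" by (cases "quotient_of (c v)")
    hence "of_int (q v) * c v = of_int p"
      using quotient_of_div[OF pr] qpos[of v] by (simp add: q_def)
    moreover have "Q = q v * (\<Prod>u\<in>V - {v}. q u)" unfolding Q_def using V that by (rule prod.remove)
    ultimately have "of_int Q * c v = of_int ((\<Prod>u\<in>V - {v}. q u) * p)"
      by (simp add: mult_ac)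
    thus ?thesis by (metis Ints_of_int)
  qed
  hence "of_int Q *s rvec b \<in> combos \<int> V" unfolding combos_def c
    by (intro CollectI exI[of _ "\<lambda>v. if v \<in> V then of_int Q * c v else 0"])
       (auto simp: vec_eq_iff sum_distrib_left mult_ac)
  hence QS: "of_nat (nat Q) *s rvec b \<in> combos \<int> V" using Q by simp
  let ?B = "red_multiplier V b"
  have "0 < ?B \<and> in_int_span V (?B *s b)" unfolding red_multiplier_def
    by (rule LeastI[of _ "nat Q"]) (use Q QS in \<open>simp add: in_int_span_iff rvec_scale\<close>)
  hence B: "0 < ?B" "of_nat ?B *s rvec b \<in> combos \<int> V"
    by (simp_all add: in_int_span_iff rvec_scale)
  show "0 < ?B" by (rule B(1))
  have B_le: "?B \<le> x" if "0 < x" "of_nat x *s rvec b \<in> combos \<int> V" for x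
    unfolding red_multiplier_def by (rule Least_le) (use that in \<open>simp add: in_int_span_iff rvec_scale\<close>)
  show "in_int_span V (x *s b) \<longleftrightarrow> ?B dvd x"
  proof
    assume "in_int_span V (x *s b)"
    hence x: "of_nat x *s rvec b \<in> combos \<int> V" by (simp add: in_int_span_iff rvec_scale)
    have eq: "(of_nat (x mod ?B) :: rat) = of_nat x - of_nat (x div ?B) * of_nat ?B"
      by (metis add_diff_cancel_left' div_mult_mod_eq of_nat_add of_nat_mult)
    have "of_nat (x mod ?B) *s rvec b
        = of_nat x *s rvec b + - (of_nat (x div ?B) *s (of_nat ?B *s rvec b))"
      unfolding eq by (simp add: vec_eq_iff algebra_simps)
    also have "\<dots> \<in> combos \<int> V"
      by (intro combos_add combos_minus combos_scale x B(2)) auto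
    finally have "of_nat (x mod ?B) *s rvec b \<in> combos \<int> V" .
    hence "x mod ?B = 0" using B_le[of "x mod ?B"] B(1) by (metis gr0I linorder_not_le mod_less_divisor)
    thus "?B dvd x" by auto
  next
    assume "?B dvd x"
    then obtain k where "x = ?B * k" by blast
    hence "of_nat x *s rvec b = of_nat k *s (of_nat ?B *s rvec b)" by (simp add: vec_eq_iff mult_ac)
    also have "\<dots> \<in> combos \<int> V" by (intro combos_scale B(2)) auto
    finally show "in_int_span V (x *s b)" by (simp add: in_int_span_iff rvec_scale)
  qed
qed

lemma rat_cancel:
  assumes "k *s rvec b + w \<in> combos UNIV V" "w \<in> combos UNIV V" "k \<noteq> 0"
  shows "rvec b \<in> combos UNIV V"
proof -
  have "(1 / k) *s ((k *s rvec b + w) + (- 1) *s w) \<in> combos UNIV V"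
    by (intro combos_scale combos_add assms) auto
  also have "(1 / k) *s ((k *s rvec b + w) + (- 1) *s w) = rvec b"
    using assms(3) by (simp add: vec_eq_iff)
  finally show ?thesis .
qed

text \<open>Being independent even of \<open>V\<close> together with \<open>c\<close>, the vector
  \<open>b\<close> has coefficient 0 in any combination equal to \<open>x\<close>.\<close>

lemma combos_drop_independent:
  assumes K: "coeff_semiring K" and V: "finite V" and b: "rvec b \<notin> combos UNIV (insert c V)"
    and x: "x \<in> combos UNIV (insert c V)"
  shows "x \<in> combos K (insert b V) \<longleftrightarrow> x \<in> combos K V"
proof
  assume "x \<in> combos K (insert b V)"
  then obtain k w where kw: "k \<in> K" "w \<in> combos K V" "x = k *s rvec b + w"
    using K V by (auto simp: mem_combos_insert)
  have "w \<in> combos UNIV (insert c V)"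
    using kw(2) combos_UNIV[of K V] combos_mono[of UNIV V c] V by auto
  hence "k = 0" using rat_cancel[of k b w] b x kw(3) by blast
  thus "x \<in> combos K V" using kw by simp
next
  assume "x \<in> combos K V"
  thus "x \<in> combos K (insert b V)" using combos_mono[OF K V] by blast
qed

lemma combos_insert_scaled:
  assumes "coeff_semiring K" "finite V" "of_nat k \<in> K"
  shows "combos K (insert (k *s c) V) \<subseteq> combos K (insert c V)"
proof
  fix x assume "x \<in> combos K (insert (k *s c) V)"
  then obtain l w where lw: "l \<in> K" "w \<in> combos K V" "x = l *s rvec (k *s c) + w"
    using assms by (auto simp: mem_combos_insert)
  have "x = (l * of_nat k) *s rvec c + w" using lw(3) by (simp add: rvec_scale vec_eq_iff)
  moreover have "l * of_nat k \<in> K" using assms lw(1) by (simp add: coeff_semiring_def)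
  ultimately show "x \<in> combos K (insert c V)"
    using lw(2) unfolding mem_combos_insert[OF assms(1,2)] by blast
qed

section \<open>A strongly confluent relaxation of the reduction\<close>

definition removable :: "(nat ^ 'm) set \<Rightarrow> nat ^ 'm \<Rightarrow> bool" where
  "removable V b \<longleftrightarrow> \<not> in_rat_span V b \<or> in_nat_span V b"

text \<open>\<open>k\<close> divides the order of \<open>b\<close> modulo the integer span of
  \<open>V\<close>; if no positive multiple of \<open>b\<close> lies in that span, every
  \<open>k > 0\<close> is admissible.\<close>

definition scalable :: "(nat ^ 'm) set \<Rightarrow> nat ^ 'm \<Rightarrow> nat \<Rightarrow> bool" where
  "scalable V b k \<longleftrightarrow> 0 < k \<and> (\<forall>x. in_int_span V (x *s b) \<longrightarrow> k dvd x)"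

lemma rvec_mem_combos: "coeff_semiring K \<Longrightarrow> finite V \<Longrightarrow> rvec b \<in> combos K (insert b V)"
  unfolding mem_combos_insert
  by (intro bexI[of _ 1] bexI[of _ 0] combos_zero) (auto simp: coeff_semiring_def)

lemma removable_drop_independent:
  assumes V: "finite V" and b: "\<not> in_rat_span (insert c V) b" and c: "removable (insert b V) c"
  shows "removable V b \<and> removable V c"
proof
  have "\<not> in_rat_span V b" using b combos_mono[of UNIV V c] V by (auto simp: in_rat_span_iff)
  thus "removable V b" by (simp add: removable_def)
  have c': "rvec c \<in> combos UNIV (insert c V)" using V by (simp add: rvec_mem_combos)
  have b': "rvec b \<notin> combos UNIV (insert c V)" using b by (simp add: in_rat_span_iff)
  show "removable V c"
    using c combos_drop_independent[OF _ V b' c'] by (simp add: removable_def in_rat_span_iff in_nat_span_iff)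
qed

lemma combos_Nats_nonneg: "x \<in> combos \<nat> V \<Longrightarrow> 0 \<le> x $ j"
proof -
  assume "x \<in> combos \<nat> V"
  then obtain f where f: "\<And>v. f v \<in> \<nat>" "x = (\<Sum>v\<in>V. f v *s rvec v)" by (auto simp: combos_def)
  have "0 \<le> f v" for v using f(1)[of v] by (auto elim: Nats_cases)
  thus ?thesis by (simp add: f(2) rvec_def sum_nonneg)
qed

text \<open>The critical case is that each vector needs the other. Both coefficients are then at
  least 1, and since all coordinates are nonnegative this forces \<open>b = c\<close>.\<close>

lemma removable_removable:
  assumes V: "finite V" and b: "removable (insert c V) b" and c: "removable (insert b V) c" and ne: "b \<noteq> c"
  shows "removable V b \<and> removable V c"
proof (cases "in_rat_span (insert c V) b \<and> in_rat_span (insert b V) c")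
  case False
  thus ?thesis using removable_drop_independent[OF V] b c by blast
next
  case True
  hence bN: "rvec b \<in> combos \<nat> (insert c V)" and cN: "rvec c \<in> combos \<nat> (insert b V)"
    using b c by (simp_all add: removable_def in_nat_span_iff)
  have two: "rvec b \<in> combos \<nat> V \<Longrightarrow> rvec c \<in> combos \<nat> V"
    and two': "rvec c \<in> combos \<nat> V \<Longrightarrow> rvec b \<in> combos \<nat> V"
    using bN cN V by (simp_all add: combos_insert_member)
  obtain k u where k: "k \<in> \<nat>" "u \<in> combos \<nat> V" "rvec b = k *s rvec c + u"
    using bN V by (auto simp: mem_combos_insert)
  obtain l w where l: "l \<in> \<nat>" "w \<in> combos \<nat> V" "rvec c = l *s rvec b + w"
    using cN V by (auto simp: mem_combos_insert)
  show ?thesis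
  proof (cases "rvec b \<in> combos \<nat> V")
    case True
    thus ?thesis using two by (simp add: removable_def in_nat_span_iff)
  next
    case nb: False
    hence nc: "rvec c \<notin> combos \<nat> V" using two' by blast
    obtain k' l' where kl: "k = of_nat k'" "l = of_nat l'" using k l by (auto elim!: Nats_cases)
    have "k \<noteq> 0"
    proof
      assume "k = 0"
      hence "rvec b = u" using k(3) by simp
      thus False using k(2) nb by simp
    qed
    moreover have "l \<noteq> 0"
    proof
      assume "l = 0"
      hence "rvec c = w" using l(3) by simp
      thus False using l(2) nc by simp
    qed
    ultimately have ge1: "1 \<le> k" "1 \<le> l" using kl by simp_all
    have "rvec b $ j = rvec c $ j" for j
    proof -
      have bc: "0 \<le> rvec b $ j" "0 \<le> rvec c $ j" by (simp_all add: rvec_def)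
      have "rvec b $ j = k * rvec c $ j + u $ j" "rvec c $ j = l * rvec b $ j + w $ j"
        using arg_cong[OF k(3), of "\<lambda>x. x $ j"] arg_cong[OF l(3), of "\<lambda>x. x $ j"] by simp_all
      moreover have "1 * rvec c $ j \<le> k * rvec c $ j" "1 * rvec b $ j \<le> l * rvec b $ j"
        using ge1 bc by (intro mult_right_mono; simp)+
      ultimately show ?thesis
        using combos_Nats_nonneg[OF k(2), of j] combos_Nats_nonneg[OF l(2), of j] by linarith
    qed
    hence "b = c" by (simp add: rvec_def vec_eq_iff)
    with ne show ?thesis by simp
  qed
qed

text \<open>If \<open>b\<close> is \<open>l *s c\<close> plus a natural combination of
  \<open>V\<close>, then \<open>l *s c\<close> lies in the integer span of \<open>b\<close> and
  \<open>V\<close>; so \<open>k\<close> divides \<open>l\<close>, and the combination survives the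
  scaling of \<open>c\<close>.\<close>

lemma removable_scalable:
  assumes V: "finite V" and b: "removable (insert c V) b" and c: "scalable (insert b V) c k"
  shows "removable (insert (k *s c) V) b" "scalable V c k"
proof -
  show "scalable V c k"
    using c combos_mono[of \<int> V b] V by (auto simp: scalable_def in_int_span_iff)
  show "removable (insert (k *s c) V) b"
  proof (cases "in_rat_span (insert c V) b")
    case False
    hence "\<not> in_rat_span (insert (k *s c) V) b"
      using combos_insert_scaled[of UNIV V k c] V by (auto simp: in_rat_span_iff)
    thus ?thesis by (simp add: removable_def)
  next
    case True
    hence "rvec b \<in> combos \<nat> (insert c V)" using b by (simp add: removable_def in_nat_span_iff)
    then obtain l w where l: "l \<in> \<nat>" "w \<in> combos \<nat> V" "rvec b = l *s rvec c + w"
      using V by (auto simp: mem_combos_insert)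
    from l(1) obtain l' where l': "l = of_nat l'" by (auto elim: Nats_cases)
    have "rvec (l' *s c) = 1 *s rvec b + - w" by (simp add: rvec_scale l(3) l')
    moreover have "- w \<in> combos \<int> V" using l(2) combos_Nats_Ints combos_minus by blast
    moreover have "(1::rat) \<in> \<int>" by simp
    ultimately have "in_int_span (insert b V) (l' *s c)"
      unfolding in_int_span_iff mem_combos_insert[OF coeff_semirings(2) V] by blast
    then obtain i where i: "l' = k * i" using c by (auto simp: scalable_def)
    have "rvec b = of_nat i *s rvec (k *s c) + w" by (simp add: l(3) l' i rvec_scale vec_eq_iff mult_ac)
    moreover have "(of_nat i::rat) \<in> \<nat>" by simp
    ultimately have "in_nat_span (insert (k *s c) V) b"
      using l(2) unfolding in_nat_span_iff mem_combos_insert[OF coeff_semirings(1) V] by blast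
    thus ?thesis by (simp add: removable_def)
  qed
qed

text \<open>Scaling another vector shrinks the integer span, so fewer multiples of \<open>b\<close>
  have to be tested.\<close>

lemma scalable_scalable:
  assumes V: "finite V" and "scalable (insert c V) b k"
  shows "scalable (insert (l *s c) V) b k"
  using assms combos_insert_scaled[of \<int> V l c] by (auto simp: scalable_def in_int_span_iff)

text \<open>The reduction with arbitrary admissible scalings; unlike \<open>red_step\<close> it is strongly confluent.\<close>

inductive gen_step :: "(nat ^ 'm) multiset \<Rightarrow> (nat ^ 'm) multiset \<Rightarrow> bool" where
  remove: "removable (set_mset R) b \<Longrightarrow> gen_step (add_mset b R) R"
| scale: "scalable (set_mset R) b k \<Longrightarrow> gen_step (add_mset b R) (add_mset (k *s b) R)"

lemma removable_scaled:
  assumes "removable V b" "scalable V b k"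
  shows "removable V (k *s b)"
proof (cases "in_rat_span V b")
  case True
  hence "rvec b \<in> combos \<nat> V" using assms(1) by (simp add: removable_def in_nat_span_iff)
  hence "of_nat k *s rvec b \<in> combos \<nat> V" by (intro combos_scale) auto
  thus ?thesis by (simp add: removable_def in_nat_span_iff rvec_scale)
next
  case False
  have "k > 0" using assms(2) by (simp add: scalable_def)
  have "\<not> in_rat_span V (k *s b)"
  proof
    assume "in_rat_span V (k *s b)"
    hence "of_nat k *s rvec b + 0 \<in> combos UNIV V" by (simp add: in_rat_span_iff rvec_scale)
    from rat_cancel[OF this] False \<open>k > 0\<close> show False
      by (simp add: in_rat_span_iff combos_zero)
  qed
  thus ?thesis by (simp add: removable_def)
qed

text \<open>Two scalings of the same vector meet at the factor \<open>lcm k l\<close>.\<close>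

lemma scalable_lcm:
  assumes k: "scalable V b k" and l: "scalable V b l"
  shows "scalable V (k *s b) (lcm k l div k)"
proof -
  have pos: "0 < k" "0 < l" using k l by (auto simp: scalable_def)
  obtain r where r: "lcm k l = k * r" by (meson dvd_lcm1 dvdE)
  have "r dvd x" if "in_int_span V (x *s (k *s b))" for x
  proof -
    have "x *s (k *s b) = (x * k) *s b" by (simp add: vec_eq_iff)
    hence "l dvd x * k" using that l by (auto simp: scalable_def)
    hence "lcm k l dvd x * k" by simp
    thus ?thesis using pos by (simp add: r mult.commute)
  qed
  moreover have "0 < r" using pos r by (metis gr0I lcm_eq_0_iff mult_0_right not_less_zero)
  ultimately show ?thesis using pos by (simp add: scalable_def r)
qed

text \<open>Steps on different vectors commute, except that scaling a vector that the other step
  removes is simply lost. On one vector, removal overrides scaling and two scalings meet in the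
  lcm.\<close>

lemma gen_step_diamond:
  assumes "gen_step M N1" "gen_step M N2"
  shows "\<exists>U. gen_step\<^sup>=\<^sup>= N1 U \<and> gen_step\<^sup>=\<^sup>= N2 U"
proof -
  have same: "\<exists>U. gen_step\<^sup>=\<^sup>= R U \<and> gen_step\<^sup>=\<^sup>= (add_mset (k *s b) R) U"
    if "removable (set_mset R) b" "scalable (set_mset R) b k" for R and b :: "nat ^ 'a" and k
    using removable_scaled[OF that] gen_step.remove[of R "k *s b"] by auto
  have diff: "\<exists>U. gen_step\<^sup>=\<^sup>= (add_mset c T) U \<and> gen_step\<^sup>=\<^sup>= (add_mset (k *s c) (add_mset b T)) U"
    if "removable (set_mset (add_mset c T)) b" "scalable (set_mset (add_mset b T)) c k"
    for T and b c :: "nat ^ 'a" and k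
  proof -
    have *: "removable (set_mset (add_mset (k *s c) T)) b" "scalable (set_mset T) c k"
      using removable_scalable[of "set_mset T" c b k] that by simp_all
    have "gen_step (add_mset c T) (add_mset (k *s c) T)" using *(2) by (rule gen_step.scale)
    moreover have "gen_step (add_mset (k *s c) (add_mset b T)) (add_mset (k *s c) T)"
      using gen_step.remove[OF *(1)] by (simp only: add_mset_commute)
    ultimately show ?thesis by blast
  qed
  have cases: "\<exists>b R. M = add_mset b R \<and> ((removable (set_mset R) b \<and> N = R) \<or>
      (\<exists>k. scalable (set_mset R) b k \<and> N = add_mset (k *s b) R))" if "gen_step M N" for N
    using that by (cases rule: gen_step.cases) blast+
  obtain b R where M1: "M = add_mset b R" and
    N1: "(removable (set_mset R) b \<and> N1 = R) \<or> (\<exists>k. scalable (set_mset R) b k \<and> N1 = add_mset (k *s b) R)"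
    using cases[OF assms(1)] by blast
  obtain c S where M2: "M = add_mset c S" and
    N2: "(removable (set_mset S) c \<and> N2 = S) \<or> (\<exists>k. scalable (set_mset S) c k \<and> N2 = add_mset (k *s c) S)"
    using cases[OF assms(2)] by blast
  show ?thesis
  proof (cases "b = c")
    case True
    hence S: "S = R" using M1 M2 by simp
    from N1 N2 consider "N1 = R" "N2 = R"
      | k where "removable (set_mset R) b" "scalable (set_mset R) b k" "N1 = R" "N2 = add_mset (k *s b) R"
      | k where "removable (set_mset R) b" "scalable (set_mset R) b k" "N2 = R" "N1 = add_mset (k *s b) R"
      | k l where "scalable (set_mset R) b k" "scalable (set_mset R) b l"
          "N1 = add_mset (k *s b) R" "N2 = add_mset (l *s b) R"
      unfolding S True[symmetric] by blast
    thus ?thesis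
    proof cases
      case 1 thus ?thesis by blast
    next
      case 2 thus ?thesis using same[of R b k] by blast
    next
      case 3 thus ?thesis using same[of R b k] by blast
    next
      case 4
      have "k * (lcm k l div k) = lcm k l" "l * (lcm l k div l) = lcm k l"
        by (simp_all add: lcm.commute)
      hence "(lcm k l div k) *s (k *s b) = lcm k l *s b" "(lcm l k div l) *s (l *s b) = lcm k l *s b"
        by (metis mult.commute vector_smult_assoc)+
      hence "gen_step N1 (add_mset (lcm k l *s b) R)" "gen_step N2 (add_mset (lcm k l *s b) R)"
        using gen_step.scale[OF scalable_lcm[OF 4(1,2)]] gen_step.scale[OF scalable_lcm[OF 4(2,1)]]
        unfolding 4(3,4) by simp_all
      thus ?thesis by blast
    qed
  next
    case False
    then obtain T where T: "R = add_mset c T" "S = add_mset b T"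
      using M1 M2 by (metis add_eq_conv_ex)
    from N1 N2 consider "removable (set_mset R) b" "removable (set_mset S) c" "N1 = R" "N2 = S"
      | k where "removable (set_mset R) b" "scalable (set_mset S) c k" "N1 = R" "N2 = add_mset (k *s c) S"
      | k where "removable (set_mset S) c" "scalable (set_mset R) b k" "N2 = S" "N1 = add_mset (k *s b) R"
      | k l where "scalable (set_mset R) b k" "scalable (set_mset S) c l"
          "N1 = add_mset (k *s b) R" "N2 = add_mset (l *s c) S"
      by blast
    thus ?thesis
    proof cases
      case 1
      have "removable (set_mset T) b \<and> removable (set_mset T) c"
        by (rule removable_removable) (use 1 T False in auto)
      hence "gen_step N1 T" "gen_step N2 T" using gen_step.remove 1(3,4) T by metis+
      thus ?thesis by blast
    next
      case 2 thus ?thesis using diff[of c T b k] T by simp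
    next
      case 3 thus ?thesis using diff[of b T c k] T by blast
    next
      case 4
      have "scalable (set_mset (add_mset (k *s b) T)) c l" "scalable (set_mset (add_mset (l *s c) T)) b k"
        using scalable_scalable[of "set_mset T"] 4(1,2) T by simp_all
      from gen_step.scale[OF this(1)] gen_step.scale[OF this(2)]
      have "gen_step N1 (add_mset (k *s b) (add_mset (l *s c) T))"
        "gen_step N2 (add_mset (k *s b) (add_mset (l *s c) T))"
        unfolding 4(3,4) T by (simp_all only: add_mset_commute)
      thus ?thesis by blast
    qed
  qed
qed

lemma confluentp_gen_step: "confluentp (gen_step :: (nat ^ 'm) multiset \<Rightarrow> _)"
proof (rule strong_confluentp_imp_confluentp, rule strong_confluentpI)
  fix x y w :: "(nat ^ 'm) multiset"
  assume "gen_step x y" "gen_step x w"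
  then obtain u where u: "gen_step\<^sup>=\<^sup>= y u" "gen_step\<^sup>=\<^sup>= w u" using gen_step_diamond by blast
  from u(1) have "gen_step\<^sup>*\<^sup>* y u" by auto
  with u(2) show "\<exists>u. gen_step\<^sup>*\<^sup>* y u \<and> gen_step\<^sup>=\<^sup>= w u" by blast
qed

lemma red_step_gen_step: "red_step M N \<Longrightarrow> gen_step M N"
proof (induction rule: red_step.induct)
  case (op_iii R b B)
  have "scalable (set_mset R) b B"
    using red_multiplier[OF finite_set_mset op_iii(1)] op_iii(2) by (simp add: scalable_def)
  thus ?case by (rule gen_step.scale)
qed (auto intro: gen_step.remove simp: removable_def)

text \<open>In a normal family no vector is removable and multiplying by the multiplier changes
  nothing; any admissible factor divides the multiplier, so it changes nothing either.\<close>

lemma gen_step_normal: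
  assumes "\<nexists>N. red_step M N" "gen_step M N"
  shows "N = M"
  using assms(2)
proof cases
  case (remove b)
  thus ?thesis using assms(1) op_i op_ii unfolding removable_def by blast
next
  case (scale R b k)
  let ?B = "red_multiplier (set_mset R) b"
  have rat: "in_rat_span (set_mset R) b" using assms(1) op_i scale by blast
  have B: "?B *s b = b" using assms(1) op_iii[OF rat refl] scale by blast
  have dvd: "k dvd ?B"
    using red_multiplier(2)[OF _ rat, of ?B] scale by (simp add: scalable_def)
  have "k *s b = b"
  proof (cases "b = 0")
    case False
    then obtain j where "b $ j \<noteq> 0" by (metis vec_eq_iff zero_index)
    moreover have "?B * b $ j = b $ j" using arg_cong[OF B, of "\<lambda>x. x $ j"] by simp
    ultimately have "?B = 1" by simp
    thus ?thesis using dvd by (simp add: vec_eq_iff)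
  qed (simp add: vec_eq_iff)
  thus ?thesis using scale by simp
qed

lemma red_eqI:
  assumes N: "red_step\<^sup>*\<^sup>* M N" "\<nexists>N'. red_step N N'"
  shows "red M = N"
  unfolding red_def
proof (rule the_equality)
  fix N' assume N': "red_step\<^sup>*\<^sup>* M N' \<and> (\<nexists>M''. red_step N' M'')"
  have le: "red_step\<^sup>*\<^sup>* M L \<Longrightarrow> gen_step\<^sup>*\<^sup>* M L" for L
    by (rule rtranclp_mono[THEN predicate2D, rotated]) (auto intro: red_step_gen_step)
  obtain U where U: "gen_step\<^sup>*\<^sup>* N U" "gen_step\<^sup>*\<^sup>* N' U"
    using confluentpD[OF confluentp_gen_step le[OF N(1)] le] N' by blast
  have "U = L" if "gen_step\<^sup>*\<^sup>* L U" "\<nexists>N'. red_step L N'" for L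
    using that(1)
  proof (induction rule: rtranclp_induct)
    case (step y u)
    thus ?case using gen_step_normal[OF that(2)] by simp
  qed simp
  thus "N' = N" using U N N' by metis
qed (use N in blast)

section \<open>Following the reduction to its normal form\<close>

lemma in_int_span_image:
  assumes "inj_on f A"
  shows "in_int_span (f ` A) b \<longleftrightarrow> (\<exists>c. \<forall>j. int (b $ j) = (\<Sum>u\<in>A. c u * int (f u $ j)))"
proof
  assume "in_int_span (f ` A) b"
  then obtain c where "\<forall>j. int (b $ j) = (\<Sum>v\<in>f ` A. c v * int (v $ j))" by (auto simp: in_int_span_def)
  thus "\<exists>c. \<forall>j. int (b $ j) = (\<Sum>u\<in>A. c u * int (f u $ j))"
    by (intro exI[of _ "c \<circ> f"]) (simp add: sum.reindex[OF assms] o_def)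
next
  assume "\<exists>c. \<forall>j. int (b $ j) = (\<Sum>u\<in>A. c u * int (f u $ j))"
  then obtain c where "\<forall>j. int (b $ j) = (\<Sum>u\<in>A. c u * int (f u $ j))" by blast
  thus "in_int_span (f ` A) b" unfolding in_int_span_def
    by (intro exI[of _ "c \<circ> the_inv_into A f"])
       (simp add: sum.reindex[OF assms] o_def the_inv_into_f_f[OF assms])
qed

lemma in_nat_span_image:
  assumes "inj_on f A"
  shows "in_nat_span (f ` A) b \<longleftrightarrow> (\<exists>c. \<forall>j. b $ j = (\<Sum>u\<in>A. c u * (f u $ j)))"
proof
  assume "in_nat_span (f ` A) b"
  then obtain c where "\<forall>j. b $ j = (\<Sum>v\<in>f ` A. c v * v $ j)" by (auto simp: in_nat_span_def)
  thus "\<exists>c. \<forall>j. b $ j = (\<Sum>u\<in>A. c u * (f u $ j))"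
    by (intro exI[of _ "c \<circ> f"]) (simp add: sum.reindex[OF assms] o_def)
next
  assume "\<exists>c. \<forall>j. b $ j = (\<Sum>u\<in>A. c u * (f u $ j))"
  then obtain c where "\<forall>j. b $ j = (\<Sum>u\<in>A. c u * (f u $ j))" by blast
  thus "in_nat_span (f ` A) b" unfolding in_nat_span_def
    by (intro exI[of _ "c \<circ> the_inv_into A f"])
       (simp add: sum.reindex[OF assms] o_def the_inv_into_f_f[OF assms])
qed

text \<open>The hypotheses identify \<open>x\<close> with the multiplier, so operation (iii) turns
  \<open>b\<close> into a vector that (ii) removes.\<close>

lemma red_steps_remove_multiple:
  assumes x: "0 < x" "in_nat_span (set_mset R) (x *s b)"
    and dvd: "\<And>y. in_int_span (set_mset R) (y *s b) \<Longrightarrow> x dvd y"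
  shows "red_step\<^sup>*\<^sup>* (add_mset b R) R"
proof -
  let ?V = "set_mset R"
  have nat: "rvec (x *s b) \<in> combos \<nat> ?V" using x(2) by (simp add: in_nat_span_iff)
  hence "of_nat x *s rvec b + 0 \<in> combos UNIV ?V" using combos_UNIV by (auto simp: rvec_scale)
  hence rat: "in_rat_span ?V b"
    using rat_cancel[of "of_nat x" b 0 ?V] x(1) by (simp add: in_rat_span_iff combos_zero)
  have "in_int_span ?V (x *s b)" using nat combos_Nats_Ints by (auto simp: in_int_span_iff)
  hence "red_multiplier ?V b dvd x" using red_multiplier(2)[OF _ rat] by simp
  moreover have "x dvd red_multiplier ?V b"
    by (rule dvd) (simp add: red_multiplier(2)[OF _ rat])
  ultimately have B: "x = red_multiplier ?V b" by (rule dvd_antisym[symmetric])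
  have "red_step\<^sup>*\<^sup>* (add_mset b R) (add_mset (x *s b) R)"
  proof (cases "x *s b = b")
    case False
    thus ?thesis using op_iii[OF rat B] by blast
  qed simp
  also have "red_step (add_mset (x *s b) R) R" using x(2) by (rule op_ii)
  finally show ?thesis .
qed

definition relation :: "(nat ^ 'm) set \<Rightarrow> (nat ^ 'm \<Rightarrow> int) \<Rightarrow> bool" where
  "relation S c \<longleftrightarrow> (\<forall>j. (\<Sum>v\<in>S. c v * int (v $ j)) = 0)"

definition scaled :: "(nat ^ 'm \<Rightarrow> nat) \<Rightarrow> (nat ^ 'm) set \<Rightarrow> (nat ^ 'm) multiset" where
  "scaled k S = image_mset (\<lambda>v. k v *s v) (mset_set S)"

definition relation_dvd :: "(nat ^ 'm) set \<Rightarrow> (nat ^ 'm \<Rightarrow> nat) \<Rightarrow> bool" where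
  "relation_dvd S k \<longleftrightarrow> (\<forall>v\<in>S. 0 < k v \<and> (\<forall>c. relation S c \<longrightarrow> int (k v) dvd c v))"

text \<open>As long as no vector can be removed, the family consists of multiples \<open>k v\<close> of the original
  vectors whose factors divide the coefficients of every integral relation.\<close>

lemma red_normal_form_nonempty:
  assumes S: "finite S" "S \<noteq> {}"
    and npar: "\<And>u v a b. u \<in> S \<Longrightarrow> v \<in> S \<Longrightarrow> 0 < a \<Longrightarrow> 0 < b \<Longrightarrow> a *s u = b *s v \<Longrightarrow> u = v"
    and rel: "\<And>v. v \<in> S \<Longrightarrow> \<exists>c. relation S c \<and> c v \<noteq> 0"
    and nonat: "\<And>v x. v \<in> S \<Longrightarrow> 0 < x \<Longrightarrow> in_nat_span (S - {v}) (x *s v) \<Longrightarrow>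
       \<exists>c. relation S c \<and> \<not> int x dvd c v"
    and k: "relation_dvd S k"
  shows "\<exists>N. red_step\<^sup>*\<^sup>* (scaled k S) N \<and> (\<nexists>N'. red_step N N') \<and> N \<noteq> {#}"
proof -
  obtain C where C: "\<And>v. v \<in> S \<Longrightarrow> relation S (C v) \<and> C v v \<noteq> 0" using rel by metis
  \<comment> \<open>Each factor divides the nonzero coefficient \<open>C v v\<close>, so the sum of
    the factors never exceeds \<open>K\<close>. As it grows with every step, the reduction
    stops.\<close>
  define K where "K = (\<Sum>v\<in>S. nat \<bar>C v v\<bar>)"
  have bound: "(\<Sum>v\<in>S. k v) \<le> K" if "relation_dvd S k" for k
    unfolding K_def
  proof (rule sum_mono)
    fix v assume "v \<in> S"
    hence "int (k v) dvd C v v" "C v v \<noteq> 0" using that C by (auto simp: relation_dvd_def)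
    hence "\<bar>int (k v)\<bar> \<le> \<bar>C v v\<bar>" by (metis dvd_imp_le_int)
    thus "k v \<le> nat \<bar>C v v\<bar>" by linarith
  qed
  have step: "\<exists>k'. N' = scaled k' S \<and> relation_dvd S k' \<and> (\<Sum>v\<in>S. k v) < (\<Sum>v\<in>S. k' v)"
    if k: "relation_dvd S k" and st: "red_step (scaled k S) N'" for k N'
  proof -
    have kpos: "0 < k v" if "v \<in> S" for v using k that by (simp add: relation_dvd_def)
    have inj: "inj_on (\<lambda>u. k u *s u) A" if "A \<subseteq> S" for A
    proof (rule inj_onI)
      fix u v assume "u \<in> A" "v \<in> A" and eq: "k u *s u = k v *s v"
      hence uv: "u \<in> S" "v \<in> S" using that by auto
      show "u = v" by (rule npar[OF uv kpos[OF uv(1)] kpos[OF uv(2)] eq])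
    qed
    have decomp: "\<exists>v\<in>S. b = k v *s v \<and> R = scaled k (S - {v})" if "scaled k S = add_mset b R" for b R
    proof -
      have "b \<in># scaled k S" using that by simp
      then obtain v where v: "v \<in> S" "b = k v *s v" using S(1) by (auto simp: scaled_def)
      have "scaled k S = add_mset (k v *s v) (scaled k (S - {v}))"
        using mset_set.remove[OF S(1) v(1)] by (simp add: scaled_def)
      thus ?thesis using v that by auto
    qed
    have set: "set_mset (scaled k (S - {v})) = (\<lambda>u. k u *s u) ` (S - {v})" for v
      using S(1) by (simp add: scaled_def)
    \<comment> \<open>A relation with nonzero coefficient at \<open>v\<close> excludes operation
      (i), however the vectors are scaled.\<close>
    have rat: "in_rat_span (set_mset (scaled k (S - {v}))) (k v *s v)" if v: "v \<in> S" for v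
    proof -
      let ?V = "(\<lambda>u. k u *s u) ` (S - {v})"
      obtain c where c: "relation S c" "c v \<noteq> 0" using rel[OF v] by blast
      have mem: "rvec u \<in> combos UNIV ?V" if "u \<in> S - {v}" for u
      proof -
        have "k u *s u \<in> ?V" using that by blast
        hence "rvec (k u *s u) \<in> combos UNIV (insert (k u *s u) ?V)" using S(1) by (simp add: rvec_mem_combos)
        hence "of_nat (k u) *s rvec u + 0 \<in> combos UNIV ?V"
          using \<open>k u *s u \<in> ?V\<close> by (simp add: insert_absorb rvec_scale)
        from rat_cancel[OF this] show ?thesis using kpos[of u] that by (simp add: combos_zero)
      qed
      have "(\<Sum>u\<in>A. of_int (c u) *s rvec u) \<in> combos UNIV ?V" if "A \<subseteq> S - {v}" "finite A" for A
        using that(2,1)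
      proof (induction A rule: finite_induct)
        case (insert u A)
        thus ?case using mem by (auto intro!: combos_add combos_scale)
      qed (simp add: combos_zero)
      hence "(\<Sum>u\<in>S - {v}. of_int (c u) *s rvec u) \<in> combos UNIV ?V" using S(1) by simp
      moreover have "of_int (c v) *s rvec v + (\<Sum>u\<in>S - {v}. of_int (c u) *s rvec u) = 0"
      proof -
        have "(of_int (\<Sum>u\<in>S. c u * int (u $ j)) :: rat) = 0" for j
          using c(1) by (simp add: relation_def)
        hence "(\<Sum>u\<in>S. of_int (c u) *s rvec u) = 0" by (simp add: vec_eq_iff rvec_def)
        thus ?thesis using sum.remove[OF S(1) v, of "\<lambda>u. of_int (c u) *s rvec u"] by simp
      qed
      ultimately have "rvec v \<in> combos UNIV ?V"
        using rat_cancel[of "of_int (c v)" v "\<Sum>u\<in>S - {v}. of_int (c u) *s rvec u" ?V] c(2)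
        by (simp add: combos_zero)
      thus ?thesis unfolding set in_rat_span_iff rvec_scale by (intro combos_scale) auto
    qed
    \<comment> \<open>Operation (ii) would make \<open>k v\<close> a multiple as in
      \<open>nonat\<close>, and the relation obtained there contradicts the divisibility
      invariant.\<close>
    have nnat: "\<not> in_nat_span (set_mset (scaled k (S - {v}))) (k v *s v)" if v: "v \<in> S" for v
    proof
      assume "in_nat_span (set_mset (scaled k (S - {v}))) (k v *s v)"
      then obtain c where c: "\<forall>j. (k v *s v) $ j = (\<Sum>u\<in>S - {v}. c u * (k u *s u) $ j)"
        unfolding set by (subst (asm) in_nat_span_image[OF inj]) auto
      have "in_nat_span (S - {v}) (k v *s v)" unfolding in_nat_span_def
        by (intro exI[of _ "\<lambda>u. c u * k u"]) (use c in \<open>simp add: mult.assoc\<close>)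
      then obtain c where "relation S c" "\<not> int (k v) dvd c v" using nonat[OF v kpos[OF v]] by blast
      thus False using k v unfolding relation_dvd_def by blast
    qed
    from st show ?thesis
    proof cases
      case (op_i b)
      then obtain v where "v \<in> S" "b = k v *s v" "N' = scaled k (S - {v})" using decomp by blast
      thus ?thesis using op_i(2) rat by simp
    next
      case (op_ii b)
      then obtain v where "v \<in> S" "b = k v *s v" "N' = scaled k (S - {v})" using decomp by blast
      thus ?thesis using op_ii(2) nnat by simp
    next
      case (op_iii R b B)
      obtain v where v: "v \<in> S" "b = k v *s v" "R = scaled k (S - {v})" using decomp[OF op_iii(1)] by blast
      define k' where "k' = k(v := B * k v)"
      note mult = red_multiplier[OF finite_set_mset rat[OF v(1)]]
      have B: "0 < B" "B \<noteq> 1"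
        using mult(1) op_iii(4,5) v by (auto simp: vec_eq_iff)
      have same: "scaled k' (S - {v}) = scaled k (S - {v})"
        unfolding scaled_def by (rule image_mset_cong) (auto simp: k'_def S(1))
      have N': "N' = scaled k' S"
      proof -
        have "scaled k' S = add_mset (k' v *s v) (scaled k' (S - {v}))"
          using mset_set.remove[OF S(1) v(1)] by (simp add: scaled_def)
        also have "k' v *s v = B *s b" using v(2) by (simp add: k'_def vec_eq_iff)
        finally show ?thesis using op_iii(2) v(3) same by simp
      qed
      \<comment> \<open>The relation puts the multiple of the scaled vector by
        \<open>c v div k v\<close>, up to sign, into the integer span of the others; so the
        multiplier \<open>B\<close> divides this quotient.\<close>
      have "int (B * k v) dvd c v" if c: "relation S c" for c
      proof -
        have kc: "int (k u) dvd c u" if "u \<in> S" for u using k c that by (auto simp: relation_dvd_def)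
        obtain y where y: "c v = int (k v) * y" using kc[OF v(1)] by blast
        \<comment> \<open>\<open>in_int_span\<close> speaks of natural multiples only, so the sign
          is moved to the other coefficients.\<close>
        define s where "s = (if y \<ge> 0 then - 1 else 1 :: int)"
        have "int ((nat \<bar>y\<bar> *s (k v *s v)) $ j)
            = (\<Sum>u\<in>S - {v}. (s * (c u div int (k u))) * int ((k u *s u) $ j))" for j
        proof -
          have "c v * int (v $ j) + (\<Sum>u\<in>S - {v}. c u * int (u $ j)) = 0"
            using c sum.remove[OF S(1) v(1), of "\<lambda>u. c u * int (u $ j)"] by (simp add: relation_def)
          moreover have "(\<Sum>u\<in>S - {v}. (s * (c u div int (k u))) * int ((k u *s u) $ j))
              = s * (\<Sum>u\<in>S - {v}. c u * int (u $ j))"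
            unfolding sum_distrib_left
          proof (rule sum.cong)
            fix u assume "u \<in> S - {v}"
            then obtain w where "c u = int (k u) * w" "k u \<noteq> 0" using kc[of u] kpos[of u] by (metis DiffD1 dvdE not_gr_zero)
            thus "s * (c u div int (k u)) * int ((k u *s u) $ j) = s * (c u * int (u $ j))" by simp
          qed simp
          moreover have "int ((nat \<bar>y\<bar> *s (k v *s v)) $ j) = - (s * (c v * int (v $ j)))"
            by (simp add: y s_def abs_if)
          ultimately show ?thesis by (simp add: add_eq_0_iff)
        qed
        hence "in_int_span (set_mset (scaled k (S - {v}))) (nat \<bar>y\<bar> *s (k v *s v))"
          unfolding set by (subst in_int_span_image[OF inj]) auto
        hence "B dvd nat \<bar>y\<bar>" using mult(2) op_iii(4) v by simp
        hence "int B dvd int (nat \<bar>y\<bar>)" by (simp only: of_nat_dvd_iff)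
        hence "int B dvd y" by simp
        thus ?thesis by (simp add: y mult.commute)
      qed
      hence "relation_dvd S k'"
        using k B by (auto simp: relation_dvd_def k'_def)
      moreover have "(\<Sum>v\<in>S. k v) < (\<Sum>v\<in>S. k' v)"
      proof (rule sum_strict_mono_ex1[OF S(1)])
        show "\<forall>u\<in>S. k u \<le> k' u" using B by (simp add: k'_def)
        show "\<exists>u\<in>S. k u < k' u" using v(1) kpos[OF v(1)] B by (intro bexI[of _ v]) (simp_all add: k'_def)
      qed
      ultimately show ?thesis using N' by blast
    qed
  qed
  show ?thesis using k
  proof (induction "K - (\<Sum>v\<in>S. k v)" arbitrary: k rule: less_induct)
    case less
    show ?case
    proof (cases "\<exists>N'. red_step (scaled k S) N'")
      case False
      moreover have "scaled k S \<noteq> {#}" using S by (simp add: scaled_def mset_set_empty_iff)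
      ultimately show ?thesis by blast
    next
      case True
      then obtain k' where k': "red_step (scaled k S) (scaled k' S)" "relation_dvd S k'"
        "(\<Sum>v\<in>S. k v) < (\<Sum>v\<in>S. k' v)" using step[OF less.prems] by metis
      hence "K - (\<Sum>v\<in>S. k' v) < K - (\<Sum>v\<in>S. k v)" using bound[OF k'(2)] by linarith
      from less.hyps[OF this k'(2)] k'(1) show ?thesis by (meson converse_rtranclp_into_rtranclp)
    qed
  qed
qed


section \<open>Reduction of four points on a line\<close>

definition lvec :: "nat \<Rightarrow> nat \<Rightarrow> nat ^ 2" where "lvec D i = vector [i, D - i]"

lemma lvec_nth [simp]: "lvec D i $ 1 = i" "lvec D i $ 2 = D - i"
  by (simp_all add: lvec_def)

lemma inj_lvec: "inj_on (lvec D) A"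
  by (rule inj_onI) (metis lvec_nth(1))

text \<open>The coordinates of \<open>lvec D i\<close> add up to \<open>D\<close>, so the second
  equation can be traded for equality of the total coefficients.\<close>

lemma sum_line:
  fixes c :: "nat \<Rightarrow> int"
  assumes "A \<subseteq> {..D}" "i \<le> D" "0 < D"
  shows "(\<forall>j. int ((x *s lvec D i) $ j) = (\<Sum>u\<in>A. c u * int (lvec D u $ j))) \<longleftrightarrow>
     int (x * i) = (\<Sum>u\<in>A. c u * int u) \<and> int x = (\<Sum>u\<in>A. c u)"
proof -
  have "(\<Sum>u\<in>A. c u * int (D - u)) = (\<Sum>u\<in>A. c u) * int D - (\<Sum>u\<in>A. c u * int u)"
    unfolding sum_distrib_right sum_subtractf[symmetric]
    by (rule sum.cong) (use assms(1) in \<open>auto simp: of_nat_diff algebra_simps\<close>)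
  moreover have "int (x * (D - i)) = int x * int D - int (x * i)"
    using assms(2) by (simp add: of_nat_diff algebra_simps)
  ultimately show ?thesis using assms(3) by (auto simp: forall_2)
qed

lemma in_int_span_line:
  assumes "A \<subseteq> {..D}" "i \<le> D" "0 < D"
  shows "in_int_span (lvec D ` A) (x *s lvec D i) \<longleftrightarrow>
     (\<exists>c. int (x * i) = (\<Sum>u\<in>A. c u * int u) \<and> int x = (\<Sum>u\<in>A. c u))"
  unfolding in_int_span_image[OF inj_lvec] sum_line[OF assms] ..

lemma in_nat_span_line:
  assumes "A \<subseteq> {..D}" "i \<le> D" "0 < D"
  shows "in_nat_span (lvec D ` A) (x *s lvec D i) \<longleftrightarrow>
     (\<exists>c. x * i = (\<Sum>u\<in>A. c u * u) \<and> x = (\<Sum>u\<in>A. c u))"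
proof -
  have "(\<forall>j. (x *s lvec D i) $ j = (\<Sum>u\<in>A. c u * (lvec D u $ j))) \<longleftrightarrow>
      x * i = (\<Sum>u\<in>A. c u * u) \<and> x = (\<Sum>u\<in>A. c u)" for c
  proof -
    have "(\<forall>j. (x *s lvec D i) $ j = (\<Sum>u\<in>A. c u * (lvec D u $ j))) \<longleftrightarrow>
        (\<forall>j. int ((x *s lvec D i) $ j) = (\<Sum>u\<in>A. int (c u) * int (lvec D u $ j)))"
      by (simp only: of_nat_eq_iff[symmetric, where 'a = int] of_nat_sum of_nat_mult)
    also have "\<dots> \<longleftrightarrow> int (x * i) = (\<Sum>u\<in>A. int (c u) * int u) \<and> int x = (\<Sum>u\<in>A. int (c u))"
      by (rule sum_line[OF assms])
    also have "\<dots> \<longleftrightarrow> x * i = (\<Sum>u\<in>A. c u * u) \<and> x = (\<Sum>u\<in>A. c u)"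
      by (simp only: of_nat_eq_iff[symmetric, where 'a = int] of_nat_sum of_nat_mult)
    finally show ?thesis .
  qed
  thus ?thesis unfolding in_nat_span_image[OF inj_lvec] by simp
qed

lemma relation_line:
  assumes "A \<subseteq> {..D}" "0 < D"
  shows "relation (lvec D ` A) c \<longleftrightarrow>
     (\<Sum>u\<in>A. c (lvec D u) * int u) = 0 \<and> (\<Sum>u\<in>A. c (lvec D u)) = 0"
proof -
  have "(\<Sum>v\<in>lvec D ` A. c v * int (v $ j)) = (\<Sum>u\<in>A. c (lvec D u) * int (lvec D u $ j))" for j
    by (simp add: sum.reindex[OF inj_lvec] o_def)
  thus ?thesis using sum_line[OF assms(1) _ assms(2), of 0 0 "c \<circ> lvec D"]
    by (auto simp: relation_def eq_commute[of 0])
qed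

lemma red_steps_drop_point:
  assumes A: "A \<subseteq> {..D}" "i \<le> D" "i \<notin> A" "0 < D"
    and x: "0 < x" "x * i = (\<Sum>u\<in>A. c u * u)" "x = (\<Sum>u\<in>A. c u)"
    and dvd: "\<And>y f. int (y * i) = (\<Sum>u\<in>A. f u * int u) \<Longrightarrow> x dvd y"
  shows "red_step\<^sup>*\<^sup>* (mset_set (lvec D ` insert i A)) (mset_set (lvec D ` A))"
proof -
  have fin: "finite A" using A(1) finite_subset by blast
  have "lvec D i \<notin> lvec D ` A"
    using A(3) by (metis imageE lvec_nth(1))
  hence eq: "mset_set (lvec D ` insert i A) = add_mset (lvec D i) (mset_set (lvec D ` A))"
    using fin by simp
  show ?thesis unfolding eq
  proof (rule red_steps_remove_multiple[OF x(1)])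
    show "in_nat_span (set_mset (mset_set (lvec D ` A))) (x *s lvec D i)"
      using fin x in_nat_span_line[OF A(1,2,4)] by auto
    fix y assume "in_int_span (set_mset (mset_set (lvec D ` A))) (y *s lvec D i)"
    thus "x dvd y" using fin dvd in_int_span_line[OF A(1,2,4)] by auto
  qed
qed

text \<open>First \<open>q\<close> goes, as its multiplier \<open>B\<close> takes it into the
  natural span of the others, then \<open>p\<close>; the two end points are independent and fall to
  operation (i).\<close>

lemma red_steps_of_gluable:
  assumes pq: "0 < p" "p < D" "0 < q" "q < D" "p \<noteq> q" and glue: "gluable D p q"
  shows "red_step\<^sup>*\<^sup>* (mset_set (lvec D ` {q, p, D, 0})) {#}"
proof -
  have D: "0 < D" using pq by simp
  define G where "G = gcd D p"
  define B where "B = G div gcd G q"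
  have G: "0 < G" using D by (simp add: G_def)
  hence B: "0 < B" unfolding B_def by (simp add: div_greater_zero_iff dvd_imp_le)
  obtain \<alpha> \<gamma> where ag: "B * q = \<alpha> * p + \<gamma> * D" "\<alpha> + \<gamma> \<le> B"
    using glue unfolding gluable_def B_def G_def by blast
  \<comment> \<open>The coefficient of the point 0 takes up the slack
    \<open>B - (\<alpha> + \<gamma>)\<close>.\<close>
  have 1: "red_step\<^sup>*\<^sup>* (mset_set (lvec D ` {q, p, D, 0})) (mset_set (lvec D ` {p, D, 0}))"
  proof (rule red_steps_drop_point[OF _ _ _ D B, where c = "\<lambda>u. if u = p then \<alpha> else if u = D then \<gamma> else B - (\<alpha> + \<gamma>)"])
    fix y f assume "int (y * q) = (\<Sum>u\<in>{p, D, 0}. f u * int u)"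
    hence "int (y * q) = f p * int p + f D * int D" using pq by simp
    moreover have "int G dvd f p * int p + f D * int D" by (intro dvd_add dvd_mult) (simp_all add: G_def)
    ultimately have "int G dvd int (y * q)" by simp
    hence "G dvd y * q" by (simp only: of_nat_dvd_iff)
    thus "B dvd y" unfolding B_def using G by (rule dvd_mult_div_gcd)
  qed (use pq ag in auto)
  define x where "x = D div G"
  define l where "l = p div G"
  have xl: "D = x * G" "p = l * G" by (simp_all add: x_def l_def G_def)
  have x: "0 < x" using xl D by (metis gr0I mult_0 less_irrefl)
  have lx: "l \<le> x" using pq(2) xl G by (metis less_imp_le mult_le_cancel2)
  have 2: "red_step\<^sup>*\<^sup>* (mset_set (lvec D ` {p, D, 0})) (mset_set (lvec D ` {D, 0}))"
  proof (rule red_steps_drop_point[OF _ _ _ D x, where c = "\<lambda>u. if u = D then l else x - l"])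
    fix y f assume "int (y * p) = (\<Sum>u\<in>{D, 0}. f u * int u)"
    hence "int (y * p) = f D * int D" using pq by simp
    hence "int D dvd int (y * p)" by simp
    hence "D dvd y * p" by (simp only: of_nat_dvd_iff)
    hence "D div gcd D p dvd y" using D by (rule dvd_mult_div_gcd)
    thus "x dvd y" by (simp add: x_def G_def)
  next
    show "x * p = (\<Sum>u\<in>{D, 0}. (if u = D then l else x - l) * u)"
      using D by (simp add: mult.left_commute[of x l] xl(2)) (simp add: xl(1))
  qed (use pq lx D in auto)
  have ne: "lvec D D \<noteq> lvec D 0" using D by (metis lvec_nth(1) less_irrefl)
  have "mset_set (lvec D ` {D, 0}) = add_mset (lvec D 0) {#lvec D D#}"
    using ne by (simp add: add_mset_commute)
  moreover have "red_step (add_mset (lvec D 0) {#lvec D D#}) {#lvec D D#}"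
  proof (rule op_i, rule notI)
    assume "in_rat_span (set_mset {#lvec D D#}) (lvec D 0)"
    then obtain c :: "nat ^ 2 \<Rightarrow> rat" where
      "\<forall>j. of_nat (lvec D 0 $ j) = (\<Sum>v\<in>{lvec D D}. c v * of_nat (v $ j))"
      by (auto simp: in_rat_span_def)
    from this[rule_format, of 2] show False using D by simp
  qed
  moreover have "red_step {#lvec D D#} {#}"
  proof (rule op_i, rule notI)
    assume "in_rat_span (set_mset {#}) (lvec D D)"
    hence "\<forall>j. of_nat (lvec D D $ j) = (0 :: rat)" by (simp add: in_rat_span_def)
    from this[rule_format, of 1] show False using D by simp
  qed
  ultimately have "red_step\<^sup>*\<^sup>* (mset_set (lvec D ` {D, 0})) {#}" by simp
  with 1 2 show ?thesis by (meson rtranclp_trans)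
qed

text \<open>The point 0 has value 0, so its coefficient is free to make the total vanish.\<close>

lemma line_relation_exists:
  assumes pq: "0 < p" "p < D" "0 < q" "q < D" "p \<noteq> q"
    and y: "int (x * q) = y * int p + w * int D"
  shows "relation (lvec D ` {q, p, D, 0}) (\<lambda>v. if v $ 1 = q then int x else
     if v $ 1 = p then - y else if v $ 1 = D then - w else y + w - int x)"
  by (subst relation_line) (use pq y in \<open>auto simp: algebra_simps\<close>)

text \<open>\<open>B\<close> is the coefficient of \<open>q\<close> in an integral relation, so
  \<open>x\<close> divides \<open>B\<close>, and the given combination can be multiplied by
  \<open>B div x\<close>.\<close>

lemma gluable_of_multiple:
  assumes pq: "0 < p" "p < D" "0 < q" "q < D" "p \<noteq> q"
    and x: "0 < x" "x * q = \<alpha> * p + \<gamma> * D" "\<alpha> + \<gamma> \<le> x"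
    and dvd: "\<And>c. relation (lvec D ` {q, p, D, 0}) c \<Longrightarrow> int x dvd c (lvec D q)"
  shows "gluable D p q"
proof -
  define B where "B = gcd D p div gcd (gcd D p) q"
  have "gcd D p dvd B * q" unfolding B_def by (rule mult_div_gcd_dvd)
  then obtain w y where "int (B * q) = w * int D + y * int p" by (rule bezout_nat_int)
  hence "int (B * q) = y * int p + w * int D" by simp
  from dvd[OF line_relation_exists[OF pq this]] have "x dvd B" by simp
  then obtain k where k: "B = x * k" by blast
  have "B * q = (k * \<alpha>) * p + (k * \<gamma>) * D"
    using arg_cong[OF x(2), of "\<lambda>x. k * x"] k by (simp add: algebra_simps)
  moreover have "k * \<alpha> + k * \<gamma> \<le> B"
    using mult_le_mono2[OF x(3), of k] k by (simp add: algebra_simps)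
  ultimately show ?thesis unfolding gluable_def B_def by blast
qed

text \<open>If neither gluing holds, no vector ever becomes removable. The end points cause no
  trouble, since no positive multiple of one is a natural combination of the other three
  points.\<close>

lemma red_four_points:
  assumes pq: "0 < p" "p < D" "0 < q" "q < D" "p \<noteq> q"
  shows "red (mset_set (lvec D ` {q, p, D, 0})) = {#} \<longleftrightarrow> gluable D p q \<or> gluable D q p"
proof
  have D: "0 < D" using pq by simp
  have nil: "\<nexists>N. red_step {#} (N :: (nat ^ 2) multiset)" by (auto elim: red_step.cases)
  assume "gluable D p q \<or> gluable D q p"
  thus "red (mset_set (lvec D ` {q, p, D, 0})) = {#}"
  proof
    assume "gluable D p q"
    from red_eqI[OF red_steps_of_gluable[OF pq this] nil] show ?thesis .
  next
    assume "gluable D q p"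
    from red_eqI[OF red_steps_of_gluable[OF pq(3,4,1,2) pq(5)[symmetric] this] nil] show ?thesis
      by (simp add: insert_commute)
  qed
next
  have D: "0 < D" using pq by simp
  assume red: "red (mset_set (lvec D ` {q, p, D, 0})) = {#}"
  show "gluable D p q \<or> gluable D q p"
  proof (rule ccontr)
    assume ng: "\<not> ?thesis"
    let ?E = "{q, p, D, 0}" and ?S = "lvec D ` {q, p, D, 0}"
    have comm: "{q, p, D, 0} = {p, q, D, 0}" by (rule insert_commute)
    have EI: "i \<le> D" if "i \<in> ?E" for i using that pq by auto
    have diff: "?S - {lvec D i} = lvec D ` (?E - {i})" if "i \<in> ?E" for i
      using that inj_on_image_set_diff[OF inj_lvec[of D UNIV], of ?E "{i}"] by simp
    have nat: "\<exists>c. x * i = (\<Sum>u\<in>?E - {i}. c u * u) \<and> x = (\<Sum>u\<in>?E - {i}. c u)"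
      if "i \<in> ?E" "in_nat_span (?S - {lvec D i}) (x *s lvec D i)" for i x
      using that(2) unfolding diff[OF that(1)]
      by (subst (asm) in_nat_span_line) (use EI that(1) D in auto)
    have "\<exists>N. red_step\<^sup>*\<^sup>* (scaled (\<lambda>_. 1) ?S) N \<and> (\<nexists>N'. red_step N N') \<and> N \<noteq> {#}"
    proof (rule red_normal_form_nonempty)
      show "relation_dvd ?S (\<lambda>_. 1)" by (simp add: relation_dvd_def)
      fix u v :: "nat ^ 2" and a b :: nat
      assume "u \<in> ?S" "v \<in> ?S" and ab: "0 < a" "0 < b" "a *s u = b *s v"
      then obtain i j where ij: "i \<in> ?E" "j \<in> ?E" "u = lvec D i" "v = lvec D j" by blast
      have e: "a * i = b * j" "a * (D - i) = b * (D - j)"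
        using arg_cong[OF ab(3), of "\<lambda>x. x $ 1"] arg_cong[OF ab(3), of "\<lambda>x. x $ 2"] ij by simp_all
      have "a * i + a * (D - i) = b * j + b * (D - j)" using e by simp
      hence "a * D = b * D" using EI[OF ij(1)] EI[OF ij(2)] by (simp flip: distrib_left)
      hence "i = j" using D e(1) ab by simp
      thus "u = v" using ij by simp
    next
      \<comment> \<open>Each of the two relations involves one inner point and both end points, so
        together they have nonzero coefficients at all four points.\<close>
      have p: "relation ?S (\<lambda>v. if v $ 1 = p then int D else if v $ 1 = q then - 0 else
          if v $ 1 = D then - int p else 0 + int p - int D)"
        using line_relation_exists[OF pq(3,4,1,2) pq(5)[symmetric], of D 0 "int p"] unfolding comm by simp
      have q: "relation ?S (\<lambda>v. if v $ 1 = q then int D else if v $ 1 = p then - 0 else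
          if v $ 1 = D then - int q else 0 + int q - int D)"
        using line_relation_exists[OF pq, of D 0 "int q"] by simp
      fix v assume "v \<in> ?S"
      then obtain i where "i \<in> ?E" "v = lvec D i" by blast
      thus "\<exists>c. relation ?S c \<and> c v \<noteq> 0"
        using pq D by (cases "i = q") (rule exI, rule conjI, rule q, simp, rule exI, rule conjI, rule p, auto)
    next
      fix v :: "nat ^ 2" and x :: nat
      assume "v \<in> ?S" and x: "0 < x" and "in_nat_span (?S - {v}) (x *s v)"
      then obtain i where i: "i \<in> ?E" "v = lvec D i" and ns: "in_nat_span (?S - {lvec D i}) (x *s lvec D i)"
        by blast
      obtain c where c: "x * i = (\<Sum>u\<in>?E - {i}. c u * u)" "x = (\<Sum>u\<in>?E - {i}. c u)"
        using nat[OF i(1) ns] by blast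
      show "\<exists>c. relation ?S c \<and> \<not> int x dvd c v"
      proof (rule ccontr)
        assume "\<not> ?thesis"
        hence dv: "int x dvd f (lvec D i)" if "relation ?S f" for f using that i by blast
        from i(1) consider "i = q" | "i = p" | "i = D" | "i = 0" by blast
        thus False
        proof cases
          case 1
          have "?E - {i} = {p, D, 0}" using 1 pq by auto
          hence "x * q = c p * p + c D * D" "c p + c D \<le> x" using c 1 pq by simp_all
          from gluable_of_multiple[OF pq x this] dv ng show False using 1 by blast
        next
          case 2
          have "?E - {i} = {q, D, 0}" using 2 pq by auto
          hence "x * p = c q * q + c D * D" "c q + c D \<le> x" using c 2 pq by simp_all
          from gluable_of_multiple[OF pq(3,4,1,2) pq(5)[symmetric] x this] dv ng show False
            using 2 unfolding comm by blast
        next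
          \<comment> \<open>All other points lie strictly below \<open>D\<close>, so
            \<open>x\<close> of them cannot add up to \<open>x * D\<close>.\<close>
          case 3
          have "?E - {i} = {q, p, 0}" using 3 pq by auto
          hence *: "x * D = c q * q + c p * p" "x = c q + (c p + c 0)" using c 3 pq by simp_all
          have "c q * q + c q \<le> c q * D" "c p * p + c p \<le> c p * D"
            using mult_le_mono2[of "Suc q" D "c q"] mult_le_mono2[of "Suc p" D "c p"] pq by simp_all
          moreover have "x * D = c q * D + (c p * D + c 0 * D)" using *(2) by (simp add: algebra_simps)
          moreover have "c 0 \<le> c 0 * D" using D by simp
          ultimately show False using * x by linarith
        next
          case 4
          have "?E - {i} = {q, p, D}" using 4 pq by auto
          hence "c q * q + (c p * p + c D * D) = 0" "x = c q + (c p + c D)" using c 4 pq by simp_all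
          thus False using pq x by simp
        qed
      qed
    qed simp_all
    moreover have "(\<lambda>v :: nat ^ 2. 1 *s v) = (\<lambda>v. v)" by (simp add: fun_eq_iff vec_eq_iff)
    hence "scaled (\<lambda>_. 1) ?S = mset_set ?S" by (simp only: scaled_def) simp
    ultimately obtain N where N: "red_step\<^sup>*\<^sup>* (mset_set ?S) N" "\<nexists>N'. red_step N N'" "N \<noteq> {#}"
      by metis
    from red_eqI[OF N(1,2)] N(3) red show False by simp
  qed
qed


section \<open>The classification\<close>

lemma generalized_arith_seq_form:
  assumes "3 \<le> n" "generalized_arith_seq (map d [1..<n])"
  obtains h r where "0 < h" "0 < r" "\<And>i. 2 \<le> i \<Longrightarrow> i < n \<Longrightarrow> d i = h * d 1 + (i - 1) * r"
proof -
  have upt: "[1..<n] = 1 # [2..<n]" using assms(1) by (simp add: upt_conv_Cons numeral_2_eq_2)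
  obtain h where h: "0 < h" "increasing_arith_seq (h * d 1 # map d [2..<n])"
    using assms(2) unfolding generalized_arith_seq_def upt by auto
  let ?L = "h * d 1 # map d [2..<n]"
  have len: "length ?L = n - 1" using assms(1) by simp
  have nth: "?L ! i = (if i = 0 then h * d 1 else d (i + 1))" if "i < n - 1" for i
    using that by (cases i) auto
  obtain s :: int where s: "\<And>i. Suc i < n - 1 \<Longrightarrow> int (?L ! Suc i) = int (?L ! i) + s"
    using h(2) unfolding increasing_arith_seq_def arith_seq_def len by blast
  have "?L ! 0 < ?L ! 1"
    using h(2) assms(1) unfolding increasing_arith_seq_def
    by (intro sorted_wrt_nth_less[of "(<)"]) auto
  moreover have "Suc 0 < n - 1" using assms(1) by linarith
  from s[OF this] have "int (?L ! 1) = int (?L ! 0) + s" by (simp only: One_nat_def)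
  ultimately have "0 < s" by linarith
  then obtain r where r: "s = int r" "0 < r" by (metis zero_less_imp_eq_int)
  have L: "?L ! i = h * d 1 + i * r" if "i < n - 1" for i
    using that
  proof (induction i)
    case (Suc i)
    have "int (?L ! Suc i) = int (h * d 1 + Suc i * r)"
      using s[OF Suc.prems] Suc r(1) by simp
    thus ?case by (simp only: of_nat_eq_iff)
  qed simp
  have "d i = h * d 1 + (i - 1) * r" if "2 \<le> i" "i < n" for i
    using L[of "i - 1"] nth[of "i - 1"] that by (auto split: if_splits)
  with h(1) r(2) show thesis by (rule that)
qed

text \<open>\<open>a\<close> is the term that would precede \<open>d 2\<close>; with it in front the
  list is arithmetic.\<close>

lemma not_arith_seq_first:
  assumes "\<not> arith_seq (x # map d [2..<n])" "\<And>i. 2 \<le> i \<Longrightarrow> i < n \<Longrightarrow> d i = a + (i - 1) * r"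
  shows "x \<noteq> a"
proof
  assume "x = a"
  define L where "L = x # map d [2..<n]"
  have L: "L ! i = a + i * r" if "i < length L" for i
    using that assms(2) \<open>x = a\<close> unfolding L_def by (cases i) auto
  have "arith_seq L" unfolding arith_seq_def
  proof (intro exI[of _ "int r"] allI impI)
    fix i assume "Suc i < length L"
    thus "int (L ! Suc i) = int (L ! i) + int r" using L[of i] L[of "Suc i"] by simp
  qed
  with assms(1) show False by (simp add: L_def)
qed

theorem theorem6p3:
  fixes d :: "nat \<Rightarrow> nat" and n :: nat
  assumes "n \<ge> 4"
    and "\<And>i. i \<in> {1..n} \<Longrightarrow> d i > 0"
    and "inj_on d {1..n}"
    and "Gcd (d ` {1..n}) = 1"
    and "generalized_arith_seq (map d [1..<n])"
    and "\<not> arith_seq (d n # map d [2..<n])"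
  shows "complete_intersection n
           (toric_ideal (star (map d [1..<n+1])) :: ((nat \<Rightarrow>\<^sub>0 nat) \<Rightarrow>\<^sub>0 'k::field) set)
     \<longleftrightarrow>
       n = 4 \<and> increasing_arith_seq [d 1, d 2, d 3] \<and>
       ((even (d 1 div gcd (d 1) (d 2)) \<and>
         (\<exists>\<beta>\<^sub>1 \<beta>\<^sub>2 \<beta>\<^sub>3 :: nat.
            gcd (d 1) (d 2) * d 4 = \<beta>\<^sub>1 * d 1 + \<beta>\<^sub>2 * d 2 + \<beta>\<^sub>3 * d 3 \<and>
            \<beta>\<^sub>1 + \<beta>\<^sub>2 + \<beta>\<^sub>3 \<le> gcd (d 1) (d 2)))
        \<or>
        (even (d 1) \<and> even (d 4) \<and> red (mset (star [d 1, d 3, d 4])) = {#}))"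
    (is "?CI \<longleftrightarrow> n = 4 \<and> ?incr \<and> (?one \<or> ?two)")
proof -
  obtain h r where h: "0 < h" and r: "0 < r"
    and form: "\<And>i. 2 \<le> i \<Longrightarrow> i < n \<Longrightarrow> d i = h * d 1 + (i - 1) * r"
    using generalized_arith_seq_form[OF _ assms(5)] assms(1) by auto
  have dn: "d n \<noteq> h * d 1" by (rule not_arith_seq_first[OF assms(6) form])
  have d1: "0 < d 1" using assms(1,2) by simp
  \<comment> \<open>Indices start at 0, so \<open>e i\<close> is \<open>d (i + 1)\<close>, and the
    index \<open>n\<close> stands for the additional point 0.\<close>
  define e where "e i = (if i < n then d (i + 1) else 0)" for i
  obtain t where t: "t < n" "\<And>i. i < n \<Longrightarrow> e i \<le> e t"
  proof -
    have "Max (e ` {..<n}) \<in> e ` {..<n}" using assms(1) by (intro Max_in) (auto simp: lessThan_empty_iff)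
    then obtain t where "t < n" "e t = Max (e ` {..<n})" by auto
    with that show thesis by simp
  qed
  have epos: "0 < e i" if "i < n" for i using that assms(2)[of "i + 1"] by (simp add: e_def)
  have curve: "monomial_curve (Suc n) e n t"
  proof
    show "inj_on e {..<Suc n}"
    proof (rule inj_onI)
      fix i j assume "i \<in> {..<Suc n}" "j \<in> {..<Suc n}" "e i = e j"
      thus "i = j" using inj_onD[OF assms(3), of "i + 1" "j + 1"] epos[of i] epos[of j]
        by (cases "i < n"; cases "j < n") (auto simp: e_def)
    qed
    show "e i \<le> e t" if "i < Suc n" for i using t(2)[of i] that by (cases "i < n") (auto simp: e_def)
  qed (use t(1) epos[of t] in \<open>auto simp: e_def\<close>)
  interpret monomial_curve "Suc n" e n t by (rule curve)
  have star_eq: "star ds = map (lvec (Max (set ds))) (ds @ [0])" for ds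
    by (simp add: star_def Let_def lvec_def)
  have "star (map d [1..<n + 1]) = points"
  proof -
    have m: "map d [1..<n + 1] = map e [0..<n]"
      by (rule nth_equalityI) (auto simp: e_def simp del: upt_Suc)
    have "Max (e ` {..<n}) = e t" using t by (intro Max_eqI) auto
    hence "Max (set (map d [1..<n + 1])) = e t" unfolding m by (simp add: lessThan_atLeast0)
    thus ?thesis unfolding star_eq unfolding m points_def by (simp add: lvec_def e_def)
  qed
  hence CI: "?CI \<longleftrightarrow> min_num_generators (mpoly_ring (Suc n)) (toric_ideal points :: (mon \<Rightarrow>\<^sub>0 'k) set) = Suc n - 2"
    by (simp add: complete_intersection_def)
  have e0: "e 0 = d 1" and e1: "e 1 = d 2" and e2: "e 2 = d 3" and e3: "e 3 = d 4"
    using assms(1) by (simp_all add: e_def eval_nat_numeral)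
  have d23: "d 2 = h * d 1 + r" "d 3 = h * d 1 + 2 * r" using form[of 2] form[of 3] assms(1) by simp_all
  have set4: "{..<Suc n} = {n, 0, 1, 2, 3}" if "n = 4"
    unfolding that by auto
  \<comment> \<open>Stated for any two points \<open>p\<close>, \<open>q\<close> besides the
    maximum, because the maximum may be \<open>d 3\<close> or \<open>d 4\<close>.\<close>
  have red4: "red (mset (star [d 1, d 3, d 4])) = {#} \<longleftrightarrow> gluable (e t) (e p) (e q) \<or> gluable (e t) (e q) (e p)"
    if n: "n = 4" and pqt: "{p, q, t} = {0, 2, 3}" "p \<noteq> q" "p \<noteq> t" "q \<noteq> t" for p q
  proof -
    have "p \<in> {0, 2, 3}" "q \<in> {0, 2, 3}" using pqt(1) by blast+
    hence "p < n" "q < n" using n by auto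
    hence inner: "p \<in> inner" "q \<in> inner" using pqt by (auto simp: inner_def)
    have "e p \<noteq> e q" using e_eqD[of p q] pqt(2) \<open>p < n\<close> \<open>q < n\<close> by auto
    have S: "set [d 1, d 3, d 4] = {e q, e p, e t}"
    proof -
      have "set [d 1, d 3, d 4] = e ` {0, 2, 3}" by (simp add: e0 e2 e3)
      also have "\<dots> = {e q, e p, e t}" unfolding pqt(1)[symmetric] by auto
      finally show ?thesis .
    qed
    hence M: "Max (set [d 1, d 3, d 4]) = e t"
      using innerD[OF inner(1)] innerD[OF inner(2)] by (simp only:) (rule Max_eqI, auto)
    have dist: "distinct [d 1, d 3, d 4, 0]"
    proof -
      have "d 1 \<noteq> d 3" "d 1 \<noteq> d 4" "d 3 \<noteq> d 4"
        using inj_onD[OF assms(3), of 1 3] inj_onD[OF assms(3), of 1 4] inj_onD[OF assms(3), of 3 4] n by auto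
      moreover have "d 1 \<noteq> 0" "d 3 \<noteq> 0" "d 4 \<noteq> 0" using assms(2)[of 1] assms(2)[of 3] assms(2)[of 4] n by auto
      ultimately show ?thesis by simp
    qed
    have "mset (star [d 1, d 3, d 4]) = mset (map (lvec (e t)) [d 1, d 3, d 4, 0])"
      unfolding star_eq M by simp
    also have "\<dots> = mset_set (set (map (lvec (e t)) [d 1, d 3, d 4, 0]))"
      by (rule mset_set_set[symmetric]) (use dist in \<open>simp only: distinct_map inj_lvec\<close>)
    also have "set (map (lvec (e t)) [d 1, d 3, d 4, 0]) = lvec (e t) ` insert 0 (set [d 1, d 3, d 4])"
      by auto
    also have "insert 0 (set [d 1, d 3, d 4]) = {e q, e p, e t, 0}" unfolding S by auto
    finally show ?thesis
      using red_four_points[of "e p" "e t" "e q"] innerD[OF inner(1)] innerD[OF inner(2)] \<open>e p \<noteq> e q\<close> by simp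
  qed
  \<comment> \<open>\<open>d 3\<close> adds nothing to the gcd because
    \<open>h * d 1 + d 3 = 2 * d 2\<close>.\<close>
  have gcd4: "gcd (gcd (d 1) (d 2)) (d 4) = 1" if n: "n = 4"
  proof -
    let ?g = "gcd (gcd (d 1) (d 2)) (d 4)"
    have g: "?g dvd d 1" "?g dvd d 2" "?g dvd d 4" by (meson dvd_trans gcd_dvd1 gcd_dvd2)+
    have "h * d 1 + d 3 = 2 * d 2" using d23 by simp
    hence "?g dvd h * d 1 + d 3" using dvd_mult[OF g(2), of 2] by (simp only:)
    hence "?g dvd d 3" using g(1) by (meson dvd_add_right_iff dvd_mult)
    have "?g dvd Gcd (d ` {1..n})"
    proof (rule Gcd_greatest)
      fix x assume "x \<in> d ` {1..n}"
      then obtain i where "x = d i" "i \<in> {1..4}" using n by auto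
      moreover from this have "i = 1 \<or> i = 2 \<or> i = 3 \<or> i = 4" by auto
      ultimately show "?g dvd x" using g \<open>?g dvd d 3\<close> by auto
    qed
    thus ?thesis using assms(4) by simp
  qed
  show ?thesis
  proof
    assume ?CI
    then obtain m \<beta> where "ci m \<beta>" using CI ci_exists by blast
    hence "monomial_ci (Suc n) e n t m \<beta>"
      using curve by (simp add: monomial_ci_def monomial_ci_axioms_def)
    then interpret monomial_ci "Suc n" e n t m \<beta> .
    have e_form: "e i = h * d 1 + i * r" if "1 \<le> i" "Suc i < n" for i
      using form[of "i + 1"] that by (simp add: e_def)
    \<comment> \<open>Otherwise \<open>d 2\<close>, ..., \<open>d 5\<close> are four consecutive
      terms of a progression and give two square-free quadratic monomials of the same
      weight.\<close>
    have "n < 6"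
    proof (rule ccontr)
      assume n6: "\<not> n < 6"
      hence "e 2 + e 3 = e 1 + e 4" using e_form[of 1] e_form[of 2] e_form[of 3] e_form[of 4] by simp
      thus False using no_square_free_quadric[of 1 2 3 4] n6 by simp
    qed
    moreover have "n \<noteq> 5"
    proof
      assume n: "n = 5"
      have ef: "e 1 = h * d 1 + r" "e 2 = h * d 1 + 2 * r" "e 3 = h * d 1 + 3 * r"
        using e_form[of 1] e_form[of 2] e_form[of 3] n by simp_all
      show False
      proof (cases "h = 1")
        \<comment> \<open>For \<open>h = 1\<close> the first element joins the progression, which
          again has four consecutive terms.\<close>
        case True
        hence "e 1 + e 2 = e 0 + e 3" using ef e0 by simp
        thus False using no_square_free_quadric[of 0 1 2 3] n by simp
      next
        case False
        have "{..<Suc n} = {n, 0, 1, 2, 3, 4}" unfolding n by auto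
        moreover have "e 4 \<noteq> h * e 0" using dn n e0 by (simp add: e_def)
        ultimately show False
          using not_ci_five[of 0 1 2 3 4 h r] False h r ef d1 unfolding e0 by simp
      qed
    qed
    ultimately have n: "n = 4" using assms(1) by simp
    \<comment> \<open>Index 3, that is \<open>d n\<close>, takes the role of \<open>x\<close> in
      \<open>not_ci_four\<close>.\<close>
    have "h = 1"
    proof (rule ccontr)
      assume "h \<noteq> 1"
      moreover have "e 3 \<noteq> h * e 0" using dn n e0 e3 by simp
      ultimately show False
        using not_ci_four[OF set4[OF n], of h] h r d23 d1 unfolding e0 e1 e2 by simp
    qed
    hence d: "d 2 = d 1 + r" "d 3 = d 1 + 2 * r" using d23 by simp_all
    have ?incr
    proof -
      have "int ([d 1, d 2, d 3] ! Suc i) = int ([d 1, d 2, d 3] ! i) + int r"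
        if "Suc i < length [d 1, d 2, d 3]" for i
        using that d by (cases i) (auto simp: less_Suc_eq)
      thus ?thesis using d r unfolding increasing_arith_seq_def arith_seq_def by auto
    qed
    moreover have "?one \<or> (even (d 1) \<and> even (d 4) \<and>
        (\<exists>p q. {p, q, t} = {0, 2, 3} \<and> p \<noteq> q \<and> p \<noteq> t \<and> q \<noteq> t \<and> gluable (e t) (e p) (e q)))"
    proof -
      have "0 < e 0" "e 0 < e 1" "e 0 + e 2 = 2 * e 1"
        unfolding e0 e1 e2 using d d1 r by simp_all
      from ci_four_cases[OF set4[OF n] this] n show ?thesis
        unfolding e0 e1 e2 e3 by simp
    qed
    hence "?one \<or> ?two" using red4[OF n] by blast
    ultimately show "n = 4 \<and> ?incr \<and> (?one \<or> ?two)" using n by blast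
  next
    assume R: "n = 4 \<and> ?incr \<and> (?one \<or> ?two)"
    hence n: "n = 4" by blast
    obtain s :: int where s: "\<And>i. Suc i < 3 \<Longrightarrow> int ([d 1, d 2, d 3] ! Suc i) = int ([d 1, d 2, d 3] ! i) + s"
      using R unfolding increasing_arith_seq_def arith_seq_def by auto
    have mid: "e 0 + e 2 = 2 * e 1" using s[of 0] s[of 1] unfolding e0 e1 e2 by simp
    have lt: "e 0 < e 1" "e 1 < e 2"
      using R unfolding e0 e1 e2 increasing_arith_seq_def by auto
    have t4: "t < 4" using t(1) n by simp
    have le: "e 2 \<le> e t" using t(2)[of 2] n by simp
    have t23: "t = 2 \<or> t = 3"
    proof -
      have "t \<noteq> 0" using le lt by (metis leD less_trans)
      moreover have "t \<noteq> 1" using le lt by (metis leD)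
      ultimately show ?thesis using t4 by linarith
    qed
    have inner_iff: "i \<in> inner \<longleftrightarrow> i < 4 \<and> i \<noteq> t" for i
      unfolding inner_def using n by auto
    have "\<exists>P. finite P \<and> generates points P \<and> card P \<le> 3"
    proof (cases ?one)
      case True
      define g where "g = gcd (e 0) (e 1)"
      obtain b1 b2 b3 where b: "g * e 3 = b1 * e 0 + b2 * e 1 + b3 * e 2" "b1 + b2 + b3 \<le> g"
        using True unfolding g_def e0 e1 e2 e3 by blast
      \<comment> \<open>A combination of at most \<open>g\<close> of the first three values is at
        most \<open>g * e 2\<close>, so \<open>e 3\<close> cannot be the maximum.\<close>
      have "t = 2"
      proof (rule ccontr)
        assume "t \<noteq> 2"
        hence t3: "t = 3" using t23 by simp
        moreover have "e 2 \<noteq> e 3" using e_eqD[of 2 3] n by auto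
        ultimately have "e 2 < e 3" using le by simp
        have "g * e 3 \<le> (b1 + b2 + b3) * e 2" unfolding b(1) distrib_right
          using lt by (intro add_mono mult_le_mono2) auto
        also have "\<dots> \<le> g * e 2" using b(2) by (rule mult_le_mono1)
        finally have "g * e 3 \<le> g * e 2" .
        hence "e 3 \<le> e 2 \<or> g = 0" by auto
        moreover have "g \<noteq> 0" using e0 d1 by (simp add: g_def)
        ultimately show False using \<open>e 2 < e 3\<close> by simp
      qed
      have N: "{..<Suc n} = {n, 0, 1, t, 3}" using set4[OF n] \<open>t = 2\<close> by simp
      have inn: "0 \<in> inner" "1 \<in> inner" "3 \<in> inner" unfolding inner_iff using \<open>t = 2\<close> by simp_all
      have mid': "e 0 + e t = 2 * e 1" using mid \<open>t = 2\<close> by simp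
      have ev: "even (e 0 div g)" using True unfolding g_def e0 e1 by blast
      have gc: "gcd g (e 3) = 1" using gcd4[OF n] unfolding g_def e0 e1 e3 .
      have b': "g * e 3 = b1 * e 0 + b2 * e 1 + b3 * e t" using b(1) \<open>t = 2\<close> by simp
      show ?thesis
        by (rule generators_of_midpoint[OF N inn _ _ _ mid' g_def ev gc b' b(2)]) simp_all
    next
      case False
      with R have two: ?two by blast
      define q where "q = (if t = 2 then 3 else 2 :: nat)"
      have q: "{0, q, t} = {0, 2, 3}" "0 \<noteq> q" "0 \<noteq> t" "q \<noteq> t" "q < 4" "q \<noteq> 1" "t \<noteq> 1"
        using t23 by (auto simp: q_def)
      have glue: "gluable (e t) (e 0) (e q) \<or> gluable (e t) (e q) (e 0)"
        using red4[OF n q(1-4)] two by blast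
      have ev: "even (e 0)" "even (e 2)" "even (e 3)"
      proof -
        show "even (e 0)" "even (e 3)" using two unfolding e0 e3 by blast+
        moreover have "even (e 0 + e 2)" unfolding mid by simp
        ultimately show "even (e 2)" by simp
      qed
      \<comment> \<open>Otherwise 2 would divide all the integers, against
        \<open>gcd4\<close>.\<close>
      have od: "odd (e 1)"
      proof
        assume "even (e 1)"
        hence "2 dvd gcd (gcd (d 1) (d 2)) (d 4)" using ev unfolding e0 e1 e3 by simp
        thus False unfolding gcd4[OF n] by simp
      qed
      have evqt: "even (e q)" "even (e t)" using ev t23 by (auto simp: q_def)
      have ac: "0 \<in> {0, q, t}" "2 \<in> {0, q, t}" unfolding q(1) by simp_all
      have N: "{..<Suc n} = {n, t, 0, q, 1}" "{..<Suc n} = {n, t, q, 0, 1}"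
        unfolding set4[OF n] using q(1) t23 by (auto simp: q_def)
      have inn: "0 \<in> inner" "q \<in> inner" "1 \<in> inner" unfolding inner_iff using q by simp_all
      from glue show ?thesis
      proof
        assume gl: "gluable (e t) (e 0) (e q)"
        show ?thesis
          by (rule generators_of_gluable[OF N(1) inn(1,2,3) _ _ _ gl ac mid]) (use q ev evqt od in auto)
      next
        assume gl: "gluable (e t) (e q) (e 0)"
        have ac': "0 \<in> {q, 0, t}" "2 \<in> {q, 0, t}" using ac by auto
        show ?thesis
          by (rule generators_of_gluable[OF N(2) inn(2,1,3) _ _ _ gl ac' mid]) (use q ev evqt od in auto)
      qed
    qed
    then obtain P where P: "generates points P" "finite P" "card P \<le> 3" by blast
    have "card P \<le> Suc n - 2" using P(3) n by simp
    with P(1,2) show ?CI unfolding CI by (intro min_num_generators_eqI)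
  qed
qed

end
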